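(* Let $\varepsilon\in(0,1/4]$ and let $G:H\to H$ be a bounded linear injective operator with $V\subset \operatorname{Ran}(G)\subset D(A^{\frac14+\varepsilon})$. For all $T>0$, $\gamma\in[1/4,1/4+\varepsilon)$ and $x\in D(A^\gamma)$ there exists a constant $c_2=c_2\big(\varepsilon,G,\gamma,\|A^\gamma x\|,T\big)>0$ such that $$\sup_{n\in\mathbb N}\ \sup_{t\in[0,T]}\|A^\gamma v_n(t)\|\le c_2\qquad \mathbb P\text{-a.s.},$$ where $v_n$ are the finite dimensional approximations with initial datum $\Pi_nx$ defined in the context. The estimate is uniform for $x$ in bounded sets of $D(A^\gamma)$.
   Context: $\mathcal D\subset\mathbb R^2$ is a non-empty bounded connected open set with Lipschitz boundary. $H$, $V$ and $\mathcal H^2$ are the closures of $\{u\in C_c^\infty(\mathcal D;\mathbb R^2):\operatorname{div}u=0\}$ in $L^2(\mathcal D;\mathbb R^2)$, $H^1(\mathcal D;\mathbb R^2)$ and $H^2(\mathcal D;\mathbb R^2)$ respectively. $H$ carries the $L^2$ inner product $\langle\cdot,\cdot\rangle$ and norm $\|\cdot\|$, and $\|x\|_V^2=\sum_{j=1}^2\|\partial_jx\|^2$. $\Pi:L^2(\mathcal D;\mathbb R^2)\to H$ is the orthogonal (Leray) projector. The Stokes operator is $A:\mathcal H^2\to H$, $Ax=\Pi(-\Delta x_1,-\Delta x_2)^T$, with $D(A)=\mathcal H^2$; it is taken to be positive-definite, self-adjoint and invertible with compact inverse, with an orthonormal complete system $(e_k)_{k\in\mathbb N}$ of $H$ made of eigenvectors,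 $Ae_k=\lambda_ke_k$, where the sequence $(\lambda_k)\subset(0,+\infty)$ is increasing and divergent. For $\alpha>0$, $D(A^\alpha)$ is the range of $A^{-\alpha}$, $A^\alpha$ is the inverse of $A^{-\alpha}$, and $D(A^\alpha)$ has norm $\|A^\alpha x\|$; $D(A^0)=H$, and $D(A^{1/2})=V$. The trilinear form $b(x,y,z)=\sum_{i,j=1}^2\int_{\mathcal D}z_j\,x_i\,\partial_iy_j\,d\mathscr L^2$ on $V\times V\times V$ extends to a bounded trilinear form on $D(A^{1/4})\times D(A^{1/4})\times V$, and satisfies $b(x,y,z)=-b(x,z,y)$ whenever both sides make sense. The Navier-Stokes nonlinearity $B(x)=\Pi[(x\cdot\nabla)x]$ extends to a continuous map $B:D(A^{1/4})\to V'$ with ${}_{V'}\langle B(x),y\rangle_V=b(x,x,y)$ for $x\in D(A^{1/4})$, $y\in V$. On a filtered complete probability space $(\Omega,\mathcal F,\{\mathcal F_t\}_{t\ge0},\mathbb P)$, $(w^k)_{k\in\mathbb N}$ are mutually independent adapted real Brownian motions; $GW_t=\sum_kw^k_tGe_k$ is understood through $\langle GW_t,\phi\rangle=\sum_kw^k_t\langle Ge_k,\phi\rangle$ for $\phi\in D(A)$. The Ornstein-Uhlenbeck process $Z$ is the pathwise unique predictable process with $\mathbb P$-a.s. trajectories $z\in L^1(0,T;H)$ for all $T>0$ such that, $\mathbb P$-a.s., $\langle z(t),\phi\rangle+\int_0^t\langle z(s),A\phi\rangle ds=\langle GW_t,\phi\rangle$ for all $\phi\in D(A)$, $t\ge0$.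 Under the hypotheses on $G$, $\mathbb P$-a.s. $z\in C([0,T];D(A^{\gamma'}))$ for all $\gamma'\in[0,1/4+\varepsilon)$ and $T>0$. $\Pi_n$ is the projector of $H$ onto $H_n=\operatorname{span}\{e_1,\dots,e_n\}$, and $B_n=\Pi_nB$, i.e. $B_n(y)=\sum_{k=1}^n{}_{V'}\langle B(y),e_k\rangle_V\,e_k$ for $y\in D(A^{1/4})$. Let $z$ be a $\mathbb P$-a.s. fixed trajectory of $Z$. Then $v_n\in C([0,T];H_n)$ is the unique solution of $$v_n'+Av_n+B_n(v_n+z)=0\ \text{ on }(0,T],\qquad v_n(0)=\Pi_nx .$$ Convention: $(v_n)$ denotes (without relabelling) a subsequence of these approximations converging weakly* in $L^\infty(0,T;H)$, weakly in $L^2(0,T;V)$ and strongly in $L^2(0,T;H)$ to the unique $v\in C([0,T];H)\cap L^2(0,T;V)$ satisfying $\langle v(t),\phi\rangle+\int_0^t\langle v(s),A\phi\rangle ds=\int_0^tb(v(s)+z(s),\phi,v(s)+z(s))ds+\langle x,\phi\rangle$ for all $\phi\in D(A)$, $t\in[0,T]$.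
   Formalization: The constant c_2 may also depend on the trajectory z of Z (a deterministic c_2 is impossible, since z has unbounded support and the nonlinearity is quadratic); D(A) is allowed to be larger than the closure of test fields in H^2. *)

theory Defs
  imports "HOL-Probability.Probability"
begin

section \<open>The Hilbert space of square-integrable planar vector fields\<close>

definition sq_integrable :: "(real^2 \<Rightarrow> real^2) \<Rightarrow> bool" where
  "sq_integrable f \<longleftrightarrow> f \<in> borel_measurable lborel \<and> integrable lborel (\<lambda>p. (norm (f p))\<^sup>2)"

definition ae_eq :: "(real^2 \<Rightarrow> real^2) \<Rightarrow> (real^2 \<Rightarrow> real^2) \<Rightarrow> bool" where
  "ae_eq f g \<longleftrightarrow> sq_integrable f \<and> sq_integrable g \<and> (AE p in lborel. f p = g p)"

lemma sq_integrable_zero: "sq_integrable (\<lambda>_. 0)"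
  by (simp add: sq_integrable_def)

lemma sq_integrable_add:
  assumes "sq_integrable f" "sq_integrable g"
  shows "sq_integrable (\<lambda>p. f p + g p)"
proof -
  have m: "f \<in> borel_measurable lborel" "g \<in> borel_measurable lborel"
    using assms by (auto simp: sq_integrable_def)
  have "integrable lborel (\<lambda>p. (norm (f p + g p))\<^sup>2)"
  proof (rule Bochner_Integration.integrable_bound)
    show "integrable lborel (\<lambda>p. 2 * (norm (f p))\<^sup>2 + 2 * (norm (g p))\<^sup>2)"
      using assms by (auto simp: sq_integrable_def)
    show "AE p in lborel. norm ((norm (f p + g p))\<^sup>2) \<le> norm (2 * (norm (f p))\<^sup>2 + 2 * (norm (g p))\<^sup>2)"
    proof (rule AE_I2)
      fix p
      have "(norm (f p + g p))\<^sup>2 \<le> (norm (f p) + norm (g p))\<^sup>2"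
        by (intro power_mono norm_triangle_ineq) auto
      also have "\<dots> \<le> 2 * (norm (f p))\<^sup>2 + 2 * (norm (g p))\<^sup>2"
        using sum_squares_ge_zero[of "norm (f p) - norm (g p)" 0]
        by (simp add: power2_eq_square algebra_simps)
      finally show "norm ((norm (f p + g p))\<^sup>2) \<le> norm (2 * (norm (f p))\<^sup>2 + 2 * (norm (g p))\<^sup>2)"
        by simp
    qed
  qed (use m in measurable)
  then show ?thesis using m by (auto simp: sq_integrable_def)
qed

lemma sq_integrable_scaleR:
  assumes "sq_integrable f"
  shows "sq_integrable (\<lambda>p. c *\<^sub>R f p)"
  using assms by (auto simp: sq_integrable_def power_mult_distrib)

lemma sq_integrable_inner:
  assumes "sq_integrable f" "sq_integrable g"
  shows "integrable lborel (\<lambda>p. f p \<bullet> g p)"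
proof -
  have m: "f \<in> borel_measurable lborel" "g \<in> borel_measurable lborel"
    using assms by (auto simp: sq_integrable_def)
  show ?thesis
  proof (rule Bochner_Integration.integrable_bound)
    show "integrable lborel (\<lambda>p. (norm (f p))\<^sup>2 + (norm (g p))\<^sup>2)"
      using assms by (auto simp: sq_integrable_def)
    show "AE p in lborel. norm (f p \<bullet> g p) \<le> norm ((norm (f p))\<^sup>2 + (norm (g p))\<^sup>2)"
    proof (rule AE_I2)
      fix p
      have "\<bar>f p \<bullet> g p\<bar> \<le> norm (f p) * norm (g p)" by (rule Cauchy_Schwarz_ineq2)
      also have "\<dots> \<le> (norm (f p))\<^sup>2 + (norm (g p))\<^sup>2"
      proof -
        have "0 \<le> (norm (f p) - norm (g p))\<^sup>2" "0 \<le> norm (f p) * norm (g p)" by auto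
        then show ?thesis unfolding power2_diff by linarith
      qed
      finally show "norm (f p \<bullet> g p) \<le> norm ((norm (f p))\<^sup>2 + (norm (g p))\<^sup>2)" by simp
    qed
  qed (use m in measurable)
qed

text \<open>Elements of the following type are square-integrable fields on the whole plane modulo
  almost-everywhere equality; for an open set D, the space \<open>L\<^sup>2(D;R\<^sup>2)\<close> is identified below with
  the closed subspace of the classes that vanish off D (extension by zero).\<close>

quotient_type L2field = "real^2 \<Rightarrow> real^2" / partial: ae_eq
proof (rule part_equivpI)
  show "\<exists>x. ae_eq x x"
    using sq_integrable_zero by (auto simp: ae_eq_def intro!: exI[of _ "\<lambda>_. 0"])
  show "symp ae_eq"
    by (auto simp: symp_def ae_eq_def elim: AE_mp)
  show "transp ae_eq"
  proof (rule transpI)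
    fix f g h assume a: "ae_eq f g" "ae_eq g h"
    have "AE p in lborel. f p = g p" "AE p in lborel. g p = h p"
      using a by (auto simp: ae_eq_def)
    then have "AE p in lborel. f p = h p" by eventually_elim simp
    then show "ae_eq f h" using a by (auto simp: ae_eq_def)
  qed
qed

instantiation L2field :: real_inner
begin

lift_definition zero_L2field :: L2field is "\<lambda>_. 0"
  by (simp add: ae_eq_def sq_integrable_zero)

lift_definition plus_L2field :: "L2field \<Rightarrow> L2field \<Rightarrow> L2field" is "\<lambda>f g p. f p + g p"
  by (auto simp: ae_eq_def intro!: sq_integrable_add elim: AE_mp)

lift_definition scaleR_L2field :: "real \<Rightarrow> L2field \<Rightarrow> L2field" is "\<lambda>c f p. c *\<^sub>R f p"
  by (auto simp: ae_eq_def intro!: sq_integrable_scaleR elim: AE_mp)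

definition uminus_L2field :: "L2field \<Rightarrow> L2field" where
  "uminus_L2field u = (-1) *\<^sub>R u"

definition minus_L2field :: "L2field \<Rightarrow> L2field \<Rightarrow> L2field" where
  "minus_L2field u v = u + - v"

lift_definition inner_L2field :: "L2field \<Rightarrow> L2field \<Rightarrow> real" is "\<lambda>f g. LINT p|lborel. f p \<bullet> g p"
proof -
  fix f f' g g' :: "real^2 \<Rightarrow> real^2"
  assume a: "ae_eq f f'" "ae_eq g g'"
  then have [measurable]: "f \<in> borel_measurable lborel" "f' \<in> borel_measurable lborel"
    "g \<in> borel_measurable lborel" "g' \<in> borel_measurable lborel"
    by (auto simp: ae_eq_def sq_integrable_def)
  have "AE p in lborel. f p = f' p" "AE p in lborel. g p = g' p"
    using a by (auto simp: ae_eq_def)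
  then have "AE p in lborel. f p \<bullet> g p = f' p \<bullet> g' p" by eventually_elim simp
  then show "(LINT p|lborel. f p \<bullet> g p) = (LINT p|lborel. f' p \<bullet> g' p)"
    by (intro integral_cong_AE) auto
qed

definition norm_L2field :: "L2field \<Rightarrow> real" where
  "norm_L2field u = sqrt (inner u u)"

definition sgn_L2field :: "L2field \<Rightarrow> L2field" where
  "sgn_L2field u = inverse (norm u) *\<^sub>R u"

definition dist_L2field :: "L2field \<Rightarrow> L2field \<Rightarrow> real" where
  "dist_L2field u v = norm (u - v)"

definition uniformity_L2field :: "(L2field \<times> L2field) filter" where
  "uniformity_L2field = (INF e\<in>{0<..}. principal {(u, v). dist u v < e})"

definition open_L2field :: "L2field set \<Rightarrow> bool" where
  "open_L2field U \<longleftrightarrow> (\<forall>u\<in>U. eventually (\<lambda>(u', v). u' = u \<longrightarrow> v \<in> U) uniformity)"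

instance
proof
  fix u v w :: L2field and a b r :: real
  show "u + v + w = u + (v + w)"
    by transfer (auto simp: ae_eq_def add.assoc intro!: sq_integrable_add)
  show "u + v = v + u"
    by transfer (auto simp: ae_eq_def add.commute intro!: sq_integrable_add)
  show "0 + u = u"
    by transfer (auto simp: ae_eq_def)
  show "- u + u = 0"
    unfolding uminus_L2field_def
    by transfer (auto simp: ae_eq_def sq_integrable_zero)
  show "u - v = u + - v"
    by (rule minus_L2field_def)
  show "a *\<^sub>R (u + v) = a *\<^sub>R u + a *\<^sub>R v"
    by transfer (auto simp: ae_eq_def scaleR_add_right intro!: sq_integrable_add sq_integrable_scaleR)
  show "(a + b) *\<^sub>R u = a *\<^sub>R u + b *\<^sub>R u"
    by transfer (auto simp: ae_eq_def scaleR_add_left intro!: sq_integrable_add sq_integrable_scaleR)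
  show "a *\<^sub>R b *\<^sub>R u = (a * b) *\<^sub>R u"
    by transfer (auto simp: ae_eq_def intro!: sq_integrable_scaleR)
  show "1 *\<^sub>R u = u"
    by transfer (auto simp: ae_eq_def)
  show "sgn u = inverse (norm u) *\<^sub>R u"
    by (rule sgn_L2field_def)
  show "dist u v = norm (u - v)"
    by (rule dist_L2field_def)
  show "uniformity = (INF e\<in>{0<..}. principal {(x :: L2field, y). dist x y < e})"
    by (rule uniformity_L2field_def)
  show "open U \<longleftrightarrow> (\<forall>x\<in>U. \<forall>\<^sub>F (x', y) in uniformity. x' = x \<longrightarrow> y \<in> U)" for U :: "L2field set"
    by (rule open_L2field_def)
  show "inner u v = inner v u"
    by transfer (simp add: inner_commute)
  show "inner (u + v) w = inner u w + inner v w"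
    by transfer (auto simp: ae_eq_def inner_add_left sq_integrable_inner)
  show "inner (r *\<^sub>R u) v = r * inner u v"
    by transfer (auto simp: ae_eq_def)
  show "0 \<le> inner u u"
    by transfer auto
  show "inner u u = 0 \<longleftrightarrow> u = 0"
  proof transfer
    fix f :: "real^2 \<Rightarrow> real^2" assume a: "ae_eq f f"
    then have i: "integrable lborel (\<lambda>p. f p \<bullet> f p)" and f: "sq_integrable f"
      by (auto simp: ae_eq_def intro: sq_integrable_inner)
    have "(LINT p|lborel. f p \<bullet> f p) = 0 \<longleftrightarrow> (AE p in lborel. f p \<bullet> f p = 0)"
      by (intro integral_nonneg_eq_0_iff_AE i) auto
    then show "(LINT p|lborel. f p \<bullet> f p) = 0 \<longleftrightarrow> ae_eq f (\<lambda>_. 0)"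
      using f sq_integrable_zero by (auto simp: ae_eq_def)
  qed
  show "norm u = sqrt (inner u u)"
    by (rule norm_L2field_def)
qed

end

section \<open>Domains, test functions and weak derivatives\<close>

definition lipschitz_boundary :: "(real^2) set \<Rightarrow> bool" where
  "lipschitz_boundary D \<longleftrightarrow>
     (\<forall>p \<in> frontier D. \<exists>r>0. \<exists>Q :: real^2 \<Rightarrow> real^2. \<exists>g :: real \<Rightarrow> real. \<exists>L.
        orthogonal_transformation Q \<and> L-lipschitz_on UNIV g \<and>
        D \<inter> ball p r = {q \<in> ball p r. g (Q q $ 1) < Q q $ 2})"

definition classical_partial :: "2 \<Rightarrow> (real^2 \<Rightarrow> 'b::real_normed_vector) \<Rightarrow> real^2 \<Rightarrow> 'b" where
  "classical_partial i f p = frechet_derivative f (at p) (axis i 1)"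

primrec C_k :: "nat \<Rightarrow> (real^2 \<Rightarrow> 'b::real_normed_vector) \<Rightarrow> bool" where
  "C_k 0 f \<longleftrightarrow> continuous_on UNIV f"
| "C_k (Suc k) f \<longleftrightarrow> (\<forall>p. f differentiable (at p)) \<and> (\<forall>i. C_k k (classical_partial i f))"

definition test_function :: "(real^2) set \<Rightarrow> (real^2 \<Rightarrow> 'b::real_normed_vector) \<Rightarrow> bool" where
  "test_function D f \<longleftrightarrow> (\<forall>k. C_k k f) \<and> (\<exists>K. compact K \<and> K \<subseteq> D \<and> (\<forall>p. p \<notin> K \<longrightarrow> f p = 0))"

definition divergence :: "(real^2 \<Rightarrow> real^2) \<Rightarrow> real^2 \<Rightarrow> real" where
  "divergence f p = (\<Sum>i\<in>UNIV. classical_partial i f p $ i)"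

definition solenoidal_tests :: "(real^2) set \<Rightarrow> L2field set" where
  "solenoidal_tests D = {abs_L2field f | f. test_function D f \<and> (\<forall>p. divergence f p = 0)}"

definition L2_on :: "(real^2) set \<Rightarrow> L2field set" where
  "L2_on D = {u. AE p in lborel. p \<notin> D \<longrightarrow> rep_L2field u p = 0}"

definition is_weak_partial :: "(real^2) set \<Rightarrow> 2 \<Rightarrow> L2field \<Rightarrow> L2field \<Rightarrow> bool" where
  "is_weak_partial D i u g \<longleftrightarrow>
     (\<forall>\<phi> :: real^2 \<Rightarrow> real. test_function D \<phi> \<longrightarrow>
        (LINT p:D|lborel. classical_partial i \<phi> p *\<^sub>R rep_L2field u p)
          = - (LINT p:D|lborel. \<phi> p *\<^sub>R rep_L2field g p))"

definition weak_partial :: "(real^2) set \<Rightarrow> 2 \<Rightarrow> L2field \<Rightarrow> L2field" where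
  "weak_partial D i u = (THE g. g \<in> L2_on D \<and> is_weak_partial D i u g)"

definition H1 :: "(real^2) set \<Rightarrow> L2field set" where
  "H1 D = {u \<in> L2_on D. \<forall>i. \<exists>g \<in> L2_on D. is_weak_partial D i u g}"

definition H2 :: "(real^2) set \<Rightarrow> L2field set" where
  "H2 D = {u \<in> H1 D. \<forall>i. weak_partial D i u \<in> H1 D}"

definition H1_norm :: "(real^2) set \<Rightarrow> L2field \<Rightarrow> real" where
  "H1_norm D u = sqrt ((norm u)\<^sup>2 + (\<Sum>i\<in>UNIV. (norm (weak_partial D i u))\<^sup>2))"

definition H2_norm :: "(real^2) set \<Rightarrow> L2field \<Rightarrow> real" where
  "H2_norm D u = sqrt ((H1_norm D u)\<^sup>2
     + (\<Sum>i\<in>UNIV. \<Sum>j\<in>UNIV. (norm (weak_partial D i (weak_partial D j u)))\<^sup>2))"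

definition weak_laplacian :: "(real^2) set \<Rightarrow> L2field \<Rightarrow> L2field" where
  "weak_laplacian D u = (\<Sum>i\<in>UNIV. weak_partial D i (weak_partial D i u))"


section \<open>Solenoidal spaces, Leray projector, Stokes operator and its powers\<close>

definition space_H :: "(real^2) set \<Rightarrow> L2field set" where
  "space_H D = closure (solenoidal_tests D)"

definition space_V :: "(real^2) set \<Rightarrow> L2field set" where
  "space_V D = {u \<in> H1 D. \<forall>\<eta>>0. \<exists>\<phi> \<in> solenoidal_tests D. H1_norm D (u - \<phi>) < \<eta>}"

definition space_H2 :: "(real^2) set \<Rightarrow> L2field set" where
  "space_H2 D = {u \<in> H2 D. \<forall>\<eta>>0. \<exists>\<phi> \<in> solenoidal_tests D. H2_norm D (u - \<phi>) < \<eta>}"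

definition V_norm :: "(real^2) set \<Rightarrow> L2field \<Rightarrow> real" where
  "V_norm D u = sqrt (\<Sum>j\<in>UNIV. (norm (weak_partial D j u))\<^sup>2)"

definition leray :: "(real^2) set \<Rightarrow> L2field \<Rightarrow> L2field" where
  "leray D u = (THE w. w \<in> space_H D \<and> (\<forall>h \<in> space_H D. inner (u - w) h = 0))"

text \<open>The closure \<^term>\<open>space_H2 D\<close> consists of fields whose gradient also has zero trace, so the
  operator \<open>x \<mapsto> \<Pi>(-\<Delta>x)\<close> with exactly that domain is symmetric but never onto H. The Stokes
  operator is therefore taken to be a positive-definite self-adjoint operator in H, boundedly
  invertible with compact inverse, which is given by this formula on \<^term>\<open>space_H2 D\<close>; its domain
  \<open>DA\<close> may be larger than \<^term>\<open>space_H2 D\<close>. The form domain is fixed separately, by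
  \<open>D(A\<^sup>1\<^sup>/\<^sup>2) = V\<close>, in \<open>stokes_setting\<close> below, which determines the operator.\<close>

definition stokes_operator :: "(real^2) set \<Rightarrow> L2field set \<Rightarrow> (L2field \<Rightarrow> L2field) \<Rightarrow> bool" where
  "stokes_operator D DA A \<longleftrightarrow>
     \<comment> \<open>a densely defined linear operator in H\<close>
     subspace DA \<and> DA \<subseteq> space_H D \<and> space_H D \<subseteq> closure DA \<and> A ` DA \<subseteq> space_H D \<and>
     (\<forall>x\<in>DA. \<forall>y\<in>DA. A (x + y) = A x + A y) \<and> (\<forall>x\<in>DA. \<forall>c. A (c *\<^sub>R x) = c *\<^sub>R A x) \<and>
     \<comment> \<open>given by the projected Laplacian\<close>
     space_H2 D \<subseteq> DA \<and> (\<forall>x \<in> space_H2 D. A x = leray D (- weak_laplacian D x)) \<and>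
     \<comment> \<open>positive-definite\<close>
     (\<forall>x\<in>DA. x \<noteq> 0 \<longrightarrow> inner (A x) x > 0) \<and>
     \<comment> \<open>self-adjoint: symmetric, and the domain of the adjoint is no larger\<close>
     (\<forall>x\<in>DA. \<forall>y\<in>DA. inner (A x) y = inner x (A y)) \<and>
     (\<forall>y \<in> space_H D. \<forall>f \<in> space_H D. (\<forall>x\<in>DA. inner (A x) y = inner x f) \<longrightarrow> y \<in> DA \<and> A y = f) \<and>
     \<comment> \<open>invertible, with compact inverse\<close>
     bij_betw A DA (space_H D) \<and> compact (closure {x \<in> DA. norm (A x) \<le> 1})"

text \<open>Sequences indexed by the positive integers are shifted to start at 0.\<close>

definition eigensystem ::
  "(real^2) set \<Rightarrow> L2field set \<Rightarrow> (L2field \<Rightarrow> L2field) \<Rightarrow> (nat \<Rightarrow> L2field) \<Rightarrow> (nat \<Rightarrow> real) \<Rightarrow> bool" where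
  "eigensystem D DA A e lam \<longleftrightarrow>
     (\<forall>k. e k \<in> DA \<and> A (e k) = lam k *\<^sub>R e k) \<and>
     (\<forall>j k. inner (e j) (e k) = (if j = k then 1 else 0)) \<and>
     space_H D \<subseteq> closure (span (range e)) \<and>
     (\<forall>k. 0 < lam k) \<and> incseq lam \<and> filterlim lam at_top sequentially"

definition neg_pow :: "(nat \<Rightarrow> L2field) \<Rightarrow> (nat \<Rightarrow> real) \<Rightarrow> real \<Rightarrow> L2field \<Rightarrow> L2field" where
  "neg_pow e lam \<alpha> x = (\<Sum>k. (lam k powr (- \<alpha>) * inner x (e k)) *\<^sub>R e k)"

definition dom_pow :: "(real^2) set \<Rightarrow> (nat \<Rightarrow> L2field) \<Rightarrow> (nat \<Rightarrow> real) \<Rightarrow> real \<Rightarrow> L2field set" where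
  "dom_pow D e lam \<alpha> = neg_pow e lam \<alpha> ` space_H D"

definition A_pow :: "(real^2) set \<Rightarrow> (nat \<Rightarrow> L2field) \<Rightarrow> (nat \<Rightarrow> real) \<Rightarrow> real \<Rightarrow> L2field \<Rightarrow> L2field" where
  "A_pow D e lam \<alpha> = inv_into (space_H D) (neg_pow e lam \<alpha>)"

definition stokes_setting ::
  "(real^2) set \<Rightarrow> L2field set \<Rightarrow> (L2field \<Rightarrow> L2field) \<Rightarrow> (nat \<Rightarrow> L2field) \<Rightarrow> (nat \<Rightarrow> real) \<Rightarrow> bool" where
  "stokes_setting D DA A e lam \<longleftrightarrow>
     stokes_operator D DA A \<and> eigensystem D DA A e lam \<and> dom_pow D e lam (1/2) = space_V D"


section \<open>The nonlinearity and its Galerkin approximations\<close>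

definition b_form :: "(real^2) set \<Rightarrow> L2field \<Rightarrow> L2field \<Rightarrow> L2field \<Rightarrow> real" where
  "b_form D x y z = (\<Sum>i\<in>UNIV. \<Sum>j\<in>UNIV.
     LINT p:D|lborel. rep_L2field z p $ j * rep_L2field x p $ i * rep_L2field (weak_partial D i y) p $ j)"

text \<open>\<open>b\<close> is the extension of \<^term>\<open>b_form D\<close> from \<open>V \<times> V \<times> V\<close> to a bounded trilinear form on
  \<open>D(A\<^sup>1\<^sup>/\<^sup>4) \<times> D(A\<^sup>1\<^sup>/\<^sup>4) \<times> V\<close>; it is unique because V is dense in \<open>D(A\<^sup>1\<^sup>/\<^sup>4)\<close>.\<close>

definition bounded_extension ::
  "(real^2) set \<Rightarrow> (nat \<Rightarrow> L2field) \<Rightarrow> (nat \<Rightarrow> real)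
     \<Rightarrow> (L2field \<Rightarrow> L2field \<Rightarrow> L2field \<Rightarrow> real) \<Rightarrow> bool" where
  "bounded_extension D e lam b \<longleftrightarrow>
     (let X = dom_pow D e lam (1/4); V = space_V D; N = (\<lambda>x. norm (A_pow D e lam (1/4) x)) in
       (\<forall>x\<in>V. \<forall>y\<in>V. \<forall>z\<in>V. b x y z = b_form D x y z) \<and>
       (\<forall>x\<in>X. \<forall>x'\<in>X. \<forall>y\<in>X. \<forall>z\<in>V. \<forall>c. b (c *\<^sub>R x + x') y z = c * b x y z + b x' y z) \<and>
       (\<forall>x\<in>X. \<forall>y\<in>X. \<forall>y'\<in>X. \<forall>z\<in>V. \<forall>c. b x (c *\<^sub>R y + y') z = c * b x y z + b x y' z) \<and>
       (\<forall>x\<in>X. \<forall>y\<in>X. \<forall>z\<in>V. \<forall>z'\<in>V. \<forall>c. b x y (c *\<^sub>R z + z') = c * b x y z + b x y z') \<and>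
       (\<exists>C. \<forall>x\<in>X. \<forall>y\<in>X. \<forall>z\<in>V. \<bar>b x y z\<bar> \<le> C * N x * N y * V_norm D z))"

text \<open>\<open>B(x)\<close> as a functional on V.\<close>

definition nonlin :: "(L2field \<Rightarrow> L2field \<Rightarrow> L2field \<Rightarrow> real) \<Rightarrow> L2field \<Rightarrow> L2field \<Rightarrow> real" where
  "nonlin b x = (\<lambda>y. b x x y)"

definition proj_n :: "(nat \<Rightarrow> L2field) \<Rightarrow> nat \<Rightarrow> L2field \<Rightarrow> L2field" where
  "proj_n e n x = (\<Sum>k<n. inner x (e k) *\<^sub>R e k)"

definition nonlin_n ::
  "(nat \<Rightarrow> L2field) \<Rightarrow> (L2field \<Rightarrow> L2field \<Rightarrow> L2field \<Rightarrow> real) \<Rightarrow> nat \<Rightarrow> L2field \<Rightarrow> L2field" where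
  "nonlin_n e b n y = (\<Sum>k<n. nonlin b y (e k) *\<^sub>R e k)"

definition galerkin_solution ::
  "(L2field \<Rightarrow> L2field) \<Rightarrow> (nat \<Rightarrow> L2field) \<Rightarrow> (L2field \<Rightarrow> L2field \<Rightarrow> L2field \<Rightarrow> real)
     \<Rightarrow> real \<Rightarrow> (real \<Rightarrow> L2field) \<Rightarrow> L2field \<Rightarrow> nat \<Rightarrow> (real \<Rightarrow> L2field) \<Rightarrow> bool" where
  "galerkin_solution A e b T z x n v \<longleftrightarrow>
     continuous_on {0..T} v \<and> (\<forall>t\<in>{0..T}. v t \<in> span (e ` {..<n})) \<and>
     v 0 = proj_n e n x \<and>
     (\<forall>t\<in>{0<..T}. (v has_vector_derivative - (A (v t) + nonlin_n e b n (v t + z t))) (at t within {0..T}))"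


section \<open>Brownian motions and the Ornstein-Uhlenbeck process\<close>

definition filtered_complete_space :: "'w measure \<Rightarrow> (real \<Rightarrow> 'w measure) \<Rightarrow> bool" where
  "filtered_complete_space M F \<longleftrightarrow>
     prob_space M \<and> complete_measure M \<and> (\<forall>t\<ge>0. subalgebra M (F t)) \<and>
     (\<forall>s t. 0 \<le> s \<and> s \<le> t \<longrightarrow> sets (F s) \<subseteq> sets (F t))"

definition adapted_brownian_motion ::
  "'w measure \<Rightarrow> (real \<Rightarrow> 'w measure) \<Rightarrow> (real \<Rightarrow> 'w \<Rightarrow> real) \<Rightarrow> bool" where
  "adapted_brownian_motion M F w \<longleftrightarrow>
     (\<forall>t\<ge>0. w t \<in> borel_measurable (F t)) \<and>
     (AE \<omega> in M. w 0 \<omega> = 0 \<and> continuous_on {0..} (\<lambda>t. w t \<omega>)) \<and>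
     (\<forall>s t. 0 \<le> s \<and> s < t \<longrightarrow>
        distributed M lborel (\<lambda>\<omega>. w t \<omega> - w s \<omega>) (normal_density 0 (sqrt (t - s)))) \<and>
     (\<forall>s t. 0 \<le> s \<and> s \<le> t \<longrightarrow>
        (\<forall>E \<in> sets (F s). \<forall>S \<in> sets borel.
           measure M (E \<inter> {\<omega> \<in> space M. w t \<omega> - w s \<omega> \<in> S})
             = measure M E * measure M {\<omega> \<in> space M. w t \<omega> - w s \<omega> \<in> S}))"

definition independent_processes :: "'w measure \<Rightarrow> (nat \<Rightarrow> real \<Rightarrow> 'w \<Rightarrow> real) \<Rightarrow> bool" where
  "independent_processes M w \<longleftrightarrow>
     prob_space.indep_vars M (\<lambda>_. PiM {0..} (\<lambda>_. borel)) (\<lambda>k \<omega>. \<lambda>t\<in>{0..}. w k t \<omega>) UNIV"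

definition predictable_algebra :: "'w measure \<Rightarrow> (real \<Rightarrow> 'w measure) \<Rightarrow> (real \<times> 'w) measure" where
  "predictable_algebra M F = sigma ({0..} \<times> space M)
     ({{0} \<times> E | E. E \<in> sets (F 0)} \<union> {{s<..t} \<times> E | s t E. 0 \<le> s \<and> s \<le> t \<and> E \<in> sets (F s)})"

text \<open>In the last clause the two sides of the weak equation are linked by \<open>sums\<close>, so convergence
  of the series defining \<open>\<langle>GW\<^sub>t, \<phi>\<rangle>\<close> is part of the requirement.\<close>

definition OU_process ::
  "(real^2) set \<Rightarrow> L2field set \<Rightarrow> (L2field \<Rightarrow> L2field) \<Rightarrow> (nat \<Rightarrow> L2field) \<Rightarrow> (L2field \<Rightarrow> L2field)
     \<Rightarrow> 'w measure \<Rightarrow> (real \<Rightarrow> 'w measure) \<Rightarrow> (nat \<Rightarrow> real \<Rightarrow> 'w \<Rightarrow> real)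
     \<Rightarrow> (real \<Rightarrow> 'w \<Rightarrow> L2field) \<Rightarrow> bool" where
  "OU_process D DA A e G M F w Z \<longleftrightarrow>
     (\<lambda>(t, \<omega>). Z t \<omega>) \<in> borel_measurable (predictable_algebra M F) \<and>
     (\<forall>t\<ge>0. \<forall>\<omega>\<in>space M. Z t \<omega> \<in> space_H D) \<and>
     (AE \<omega> in M. \<forall>T>0. set_integrable lborel {0..T} (\<lambda>t. norm (Z t \<omega>))) \<and>
     (AE \<omega> in M. \<forall>\<phi>\<in>DA. \<forall>t\<ge>0.
        (\<lambda>k. w k t \<omega> * inner (G (e k)) \<phi>) sums
          (inner (Z t \<omega>) \<phi> + (LINT s:{0..t}|lborel. inner (Z s \<omega>) (A \<phi>))))"

definition bounded_linear_on_H :: "(real^2) set \<Rightarrow> (L2field \<Rightarrow> L2field) \<Rightarrow> bool" where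
  "bounded_linear_on_H D G \<longleftrightarrow>
     G ` space_H D \<subseteq> space_H D \<and>
     (\<forall>x \<in> space_H D. \<forall>y \<in> space_H D. G (x + y) = G x + G y) \<and>
     (\<forall>x \<in> space_H D. \<forall>c. G (c *\<^sub>R x) = c *\<^sub>R G x) \<and>
     (\<exists>C. \<forall>x \<in> space_H D. norm (G x) \<le> C * norm x)"

end

theory Submission
  imports Defs
begin

text \<open>
  Along one trajectory \<open>z\<close> of the Ornstein-Uhlenbeck process the claim is deterministic. Write
  \<open>|y|_s\<close> for the norm of \<open>A^s y\<close>, and \<open>u = v + z\<close>. With \<open>\<sigma> = \<epsilon>/2\<close> the trajectory is continuous into
  \<open>D(A^{1/4+\<sigma>})\<close>, hence bounded there by some \<open>Z\<close>; every constant below is built from \<open>Z\<close>, the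
  horizon, the exponents, a bound on the initial datum, the least eigenvalue and a bound for \<open>b\<close>, so
  none depends on the dimension \<open>n\<close>.

  Two facts about \<open>b\<close> carry the proof: its boundedness on \<open>D(A^{1/4}) \<times> D(A^{1/4}) \<times> V\<close>, and
  \<open>b(x,y,y) = 0\<close>. The second is an integration by parts for solenoidal test fields
  (\<open>b_form_test_zero\<close>), extended by density (\<open>b_zero\<close>). Density in the norm of \<open>V\<close> is usable because
  \<open>|\<phi>|_{1/2}\<close> is the gradient norm of a test field \<open>\<phi>\<close> (\<open>norm_half_test\<close>, Green's formula).
  Being skew in its last two arguments, the form \<open>b(u,\<cdot>,\<cdot>)\<close> is bounded with the exponent pairs
  \<open>(1/4,1/2)\<close> and \<open>(1/2,1/4)\<close>, and therefore with all pairs in between (\<open>b_interpolated\<close>).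

  The problem is critical. Testing with \<open>v\<close> bounds \<open>v\<close> in \<open>L^\<infinity>(H)\<close> and in \<open>L^2(V)\<close>, hence \<open>|v|_{1/4}\<close> in
  \<open>L^4\<close> in time; the mild formulation in \<open>D(A^{1/4})\<close> has the kernel \<open>(t-s)^{-3/4}\<close>, which just
  fails to lie in \<open>L^{4/3}\<close>, so the quadratic term cannot be closed directly. A small gain comes from testing
  with \<open>A^{2\<sigma>} v\<close>: the intermediate bound gives
  \<open>|b(u,y,A^{2\<sigma>} v)| \<le> C |u|_{1/4} |y|_{1/4+\<sigma>} |v|_{1/2+\<sigma>}\<close>. For \<open>y = z\<close> the middle factor is at most \<open>Z\<close>,
  and this is what the regularity of \<open>z\<close> beyond \<open>D(A^{1/4})\<close> is for; for \<open>y = v\<close> it is interpolated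
  between \<open>|v|_\<sigma>\<close> and \<open>|v|_{1/2+\<sigma>}\<close>, and the dissipation absorbs the product up to the factor
  \<open>|u|_{1/4}^4\<close>, whose time integral the first energy estimate controls. So \<open>v\<close> is bounded in
  \<open>L^\<infinity>(D(A^\<sigma>))\<close> and in \<open>L^2(D(A^{1/2+\<sigma>}))\<close> (\<open>spacetime_bound\<close>). Now \<open>|v|_{1/4}^{1+\<delta>}\<close> with \<open>\<delta> = 2\<sigma>\<close> is integrable
  against \<open>(t-s)^{-3/4}\<close>, and the supremum \<open>Y\<close> of \<open>|v|_{1/4}\<close> satisfies \<open>Y \<le> K + L Y^{1-\<delta>}\<close>, which
  bounds it (\<open>quarter_bound\<close>). With \<open>|u|_{1/4}\<close> bounded, the mild formulation in \<open>D(A^\<gamma>)\<close> has the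
  integrable kernel \<open>(t-s)^{-(\<gamma>+1/2)}\<close>, because \<open>\<gamma> < 1/2\<close> (\<open>power_bound\<close>).

  No time integral is formed. An integral bound on a dissipation \<open>X\<close> is recorded as
  \<open>X \<le> M - \<Theta>'\<close> with \<open>0 \<le> \<Theta> \<le> M\<close>, and functions of time are compared through their derivatives
  (\<open>derivative_comparison\<close>).
\<close>

section \<open>The Hilbert space of square-integrable fields\<close>

lemma rep_L2field_ae_eq: "ae_eq (rep_L2field u) (rep_L2field u)"
  using Quotient_L2field unfolding Quotient_def by blast

lemma rep_L2field_abs: "ae_eq f f \<Longrightarrow> ae_eq (rep_L2field (abs_L2field f)) f"
  using Quotient_L2field unfolding Quotient_def by metis

lemma abs_L2field_rep [simp]: "abs_L2field (rep_L2field u) = u"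
  using Quotient_L2field unfolding Quotient_def by blast

lemma abs_L2field_eq: "ae_eq f g \<Longrightarrow> abs_L2field f = abs_L2field g"
  using Quotient_L2field unfolding Quotient_def by metis

lemma ae_eq_refl: "ae_eq f f \<longleftrightarrow> sq_integrable f"
  by (simp add: ae_eq_def)

lemma sq_integrable_rep: "sq_integrable (rep_L2field u)"
  using rep_L2field_ae_eq by (simp add: ae_eq_refl)

lemma borel_measurable_rep [measurable]: "rep_L2field u \<in> borel_measurable borel"
  using sq_integrable_rep by (simp add: sq_integrable_def)

lemma AE_rep_abs: "sq_integrable f \<Longrightarrow> AE p in lborel. rep_L2field (abs_L2field f) p = f p"
  using rep_L2field_abs[of f] by (simp add: ae_eq_refl ae_eq_def)

lemma L2field_eqI: "AE p in lborel. rep_L2field u p = rep_L2field v p \<Longrightarrow> u = v"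
  using abs_L2field_eq[of "rep_L2field u" "rep_L2field v"] by (simp add: ae_eq_def sq_integrable_rep)

lemma AE_rep_add: "AE p in lborel. rep_L2field (u + v) p = rep_L2field u p + rep_L2field v p"
proof -
  have "u + v = abs_L2field (\<lambda>p. rep_L2field u p + rep_L2field v p)"
    using plus_L2field.abs_eq[OF rep_L2field_ae_eq rep_L2field_ae_eq, of u v] by simp
  then show ?thesis
    using AE_rep_abs[OF sq_integrable_add[OF sq_integrable_rep[of u] sq_integrable_rep[of v]]] by simp
qed

lemma AE_rep_scaleR: "AE p in lborel. rep_L2field (c *\<^sub>R u) p = c *\<^sub>R rep_L2field u p"
proof -
  have "c *\<^sub>R u = abs_L2field (\<lambda>p. c *\<^sub>R rep_L2field u p)"
    using scaleR_L2field.abs_eq[OF rep_L2field_ae_eq, of c u] by simp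
  then show ?thesis
    using AE_rep_abs[OF sq_integrable_scaleR[OF sq_integrable_rep[of u]]] by simp
qed

lemma AE_rep_diff: "AE p in lborel. rep_L2field (u - v) p = rep_L2field u p - rep_L2field v p"
proof -
  have "u - v = u + (-1) *\<^sub>R v" by simp
  then have "AE p in lborel. rep_L2field (u - v) p = rep_L2field u p + rep_L2field ((-1) *\<^sub>R v) p"
    using AE_rep_add[of u "(-1) *\<^sub>R v"] by simp
  with AE_rep_scaleR[of "-1" v] show ?thesis by eventually_elim simp
qed

lemma inner_L2field_eq: "inner u v = (LINT p|lborel. rep_L2field u p \<bullet> rep_L2field v p)"
  by (simp add: inner_L2field.rep_eq)

lemma inner_abs_L2field:
  assumes "sq_integrable f" "sq_integrable g"
  shows "inner (abs_L2field f) (abs_L2field g) = (LINT p|lborel. f p \<bullet> g p)"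
  using assms by (simp add: inner_L2field.abs_eq ae_eq_refl)

lemma norm_L2field_sq: "(norm u)\<^sup>2 = (LINT p|lborel. (norm (rep_L2field u p))\<^sup>2)"
  by (simp add: power2_norm_eq_inner inner_L2field_eq)

lemma nn_norm_L2field_sq: "ennreal ((norm u)\<^sup>2) = (\<integral>\<^sup>+p. ennreal ((norm (rep_L2field u p))\<^sup>2) \<partial>lborel)"
  using sq_integrable_rep[of u] unfolding norm_L2field_sq sq_integrable_def
  by (simp add: nn_integral_eq_integral)

text \<open>Riesz-Fischer. The series of the squared increments, weighted by \<open>2^n\<close>, has a finite integral. So almost
  everywhere the increments are at most a constant times \<open>2^{-n/2}\<close>, and the representatives
  converge pointwise; Fatou's lemma turns this into convergence in norm.\<close>

lemma L2field_fast_Cauchy_converges: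
  fixes X :: "nat \<Rightarrow> L2field"
  assumes fast: "\<And>n. norm (X (Suc n) - X n) \<le> (1/2)^n" and C: "Cauchy X"
  shows "convergent X"
proof -
  define f where "f n = rep_L2field (X n)" for n
  have [measurable]: "f n \<in> borel_measurable borel" for n by (simp add: f_def)
  let ?d = "\<lambda>n p. f (Suc n) p - f n p"
  have diff: "(\<integral>\<^sup>+p. ennreal ((norm (f m p - f n p))\<^sup>2) \<partial>lborel) = ennreal ((norm (X m - X n))\<^sup>2)" for m n
    unfolding nn_norm_L2field_sq
    by (rule nn_integral_cong_AE, use AE_rep_diff[of "X m" "X n"] in eventually_elim) (simp add: f_def)
  have "(\<integral>\<^sup>+p. (\<Sum>n. ennreal (2^n * (norm (?d n p))\<^sup>2)) \<partial>lborel) 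
      = (\<Sum>n. \<integral>\<^sup>+p. ennreal (2^n) * ennreal ((norm (?d n p))\<^sup>2) \<partial>lborel)"
    by (subst nn_integral_suminf) (auto simp: ennreal_mult)
  also have "\<dots> = (\<Sum>n. ennreal (2^n * (norm (X (Suc n) - X n))\<^sup>2))"
    by (subst nn_integral_cmult) (auto simp: diff ennreal_mult)
  also have "\<dots> \<le> (\<Sum>n. ennreal ((1/2)^n))"
  proof (intro suminf_le ennreal_leI)
    fix n
    have "(norm (X (Suc n) - X n))\<^sup>2 \<le> ((1/2)^n)\<^sup>2" by (intro power_mono fast) auto
    then have "2^n * (norm (X (Suc n) - X n))\<^sup>2 \<le> 2^n * ((1/2)^n)\<^sup>2" by simp
    also have "\<dots> = (1/2)^n"
      by (simp add: power2_eq_square mult.assoc[symmetric] power_mult_distrib[symmetric])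
    finally show "2^n * (norm (X (Suc n) - X n))\<^sup>2 \<le> (1/2)^n" .
  qed auto
  also have "\<dots> = ennreal (\<Sum>n. (1/2)^n)"
    by (intro suminf_ennreal2) (auto simp: summable_geometric)
  also have "\<dots> < \<infinity>" by simp
  finally have "(\<integral>\<^sup>+p. (\<Sum>n. ennreal (2^n * (norm (?d n p))\<^sup>2)) \<partial>lborel) \<noteq> \<infinity>"
    by (rule less_imp_neq)
  then have "AE p in lborel. (\<Sum>n. ennreal (2^n * (norm (?d n p))\<^sup>2)) \<noteq> \<infinity>"
    by (intro nn_integral_PInf_AE) auto
  then have conv: "AE p in lborel. convergent (\<lambda>n. f n p)"
  proof eventually_elim
    fix p assume fin: "(\<Sum>n. ennreal (2^n * (norm (?d n p))\<^sup>2)) \<noteq> \<infinity>"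
    have "summable (\<lambda>n. 2^n * (norm (?d n p))\<^sup>2)"
      using fin by (intro summable_suminf_not_top) auto
    then have "(\<lambda>n. 2^n * (norm (?d n p))\<^sup>2) \<longlonglongrightarrow> 0" by (rule summable_LIMSEQ_zero)
    then obtain C where C: "\<And>n. norm (2^n * (norm (?d n p))\<^sup>2) \<le> C"
      using convergent_imp_Bseq[of "\<lambda>n. 2^n * (norm (?d n p))\<^sup>2"] unfolding Bseq_def convergent_def by blast
    have b: "norm (?d n p) \<le> sqrt C * sqrt (1/2)^n" for n
    proof (rule power2_le_imp_le)
      have "C \<ge> 0" using C[of 0] norm_ge_zero order_trans by blast
      have "(norm (?d n p))\<^sup>2 \<le> C * (1/2)^n"
        using C[of n] by (simp add: power_divide field_simps)
      also have "\<dots> = (sqrt C * sqrt (1/2)^n)\<^sup>2"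
      proof -
        have "(sqrt (1/2)^n)\<^sup>2 = ((sqrt (1/2))\<^sup>2)^n"
          by (simp only: power_mult[symmetric] mult.commute)
        then show ?thesis using \<open>C \<ge> 0\<close> by (simp add: power_mult_distrib)
      qed
      finally show "(norm (?d n p))\<^sup>2 \<le> (sqrt C * sqrt (1/2)^n)\<^sup>2" .
      show "0 \<le> sqrt C * sqrt (1/2)^n" using \<open>C \<ge> 0\<close> by simp
    qed
    have "sqrt (1/2) < sqrt 1" by (subst real_sqrt_less_iff) simp
    then have "summable (\<lambda>n. sqrt C * sqrt (1/2)^n)"
      by (intro summable_mult summable_geometric) simp
    then have "summable (\<lambda>n. ?d n p)"
      by (rule summable_comparison_test'[where N = 0]) (use b in auto)
    then have "convergent (\<lambda>n. \<Sum>i<n. ?d i p)" by (simp add: summable_iff_convergent)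
    then have "convergent (\<lambda>n. f n p - f 0 p)" by (subst (asm) sum_lessThan_telescope)
    then show "convergent (\<lambda>n. f n p)" by (simp add: convergent_diff_const_right_iff)
  qed
  define g where "g p = lim (\<lambda>n. f n p)" for p
  have [measurable]: "g \<in> borel_measurable borel"
    unfolding g_def by measurable
  have lim: "AE p in lborel. (\<lambda>n. f n p) \<longlonglongrightarrow> g p"
    using conv by eventually_elim (simp add: g_def convergent_LIMSEQ_iff)
  have gm: "(\<integral>\<^sup>+p. ennreal ((norm (g p - f m p))\<^sup>2) \<partial>lborel) \<le> ennreal (\<epsilon>\<^sup>2)"
    if "\<And>n. n \<ge> m \<Longrightarrow> norm (X n - X m) \<le> \<epsilon>" for m \<epsilon>
  proof -
    have "(\<integral>\<^sup>+p. ennreal ((norm (g p - f m p))\<^sup>2) \<partial>lborel)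
        = (\<integral>\<^sup>+p. liminf (\<lambda>n. ennreal ((norm (f n p - f m p))\<^sup>2)) \<partial>lborel)"
    proof (rule nn_integral_cong_AE, use lim in eventually_elim)
      case (elim p)
      have "(\<lambda>n. ennreal ((norm (f n p - f m p))\<^sup>2)) \<longlonglongrightarrow> ennreal ((norm (g p - f m p))\<^sup>2)"
        by (intro tendsto_intros tendsto_ennrealI elim)
      then show ?case by (intro lim_imp_Liminf[symmetric]) auto
    qed
    also have "\<dots> \<le> liminf (\<lambda>n. \<integral>\<^sup>+p. ennreal ((norm (f n p - f m p))\<^sup>2) \<partial>lborel)"
      by (rule nn_integral_liminf) auto
    also have "\<dots> \<le> limsup (\<lambda>n. \<integral>\<^sup>+p. ennreal ((norm (f n p - f m p))\<^sup>2) \<partial>lborel)"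
      by (intro Liminf_le_Limsup) auto
    also have "\<dots> \<le> ennreal (\<epsilon>\<^sup>2)"
      unfolding diff
      by (intro Limsup_bounded eventually_sequentiallyI[of m] ennreal_leI power_mono that) auto
    finally show ?thesis .
  qed
  have sq: "sq_integrable g"
  proof -
    obtain m where m: "\<And>n. n \<ge> m \<Longrightarrow> norm (X n - X m) \<le> 1"
      using C[unfolded Cauchy_def, rule_format, of 1] by (simp add: dist_norm) (meson less_imp_le order_refl)
    have "sq_integrable (\<lambda>p. g p - f m p)"
      unfolding sq_integrable_def using order.strict_trans1[OF gm[OF m], of \<infinity>]
      by (auto intro!: integrableI_bounded)
    then have "sq_integrable (\<lambda>p. (g p - f m p) + f m p)"
      by (rule sq_integrable_add) (simp add: f_def sq_integrable_rep)
    then show ?thesis by simp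
  qed
  have "X \<longlonglongrightarrow> abs_L2field g"
  proof (rule LIMSEQ_I)
    fix r :: real assume "r > 0"
    then obtain M where M: "\<And>m n. m \<ge> M \<Longrightarrow> n \<ge> M \<Longrightarrow> norm (X n - X m) < r/2"
      using C[unfolded Cauchy_def, rule_format, of "r/2"] by (auto simp: dist_norm)
    show "\<exists>no. \<forall>n\<ge>no. norm (X n - abs_L2field g) < r"
    proof (intro exI allI impI)
      fix m assume "m \<ge> M"
      have "ennreal ((norm (abs_L2field g - X m))\<^sup>2) = (\<integral>\<^sup>+p. ennreal ((norm (g p - f m p))\<^sup>2) \<partial>lborel)"
        unfolding nn_norm_L2field_sq
        by (rule nn_integral_cong_AE, use AE_rep_diff[of "abs_L2field g" "X m"] AE_rep_abs[OF sq] in eventually_elim)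
           (simp add: f_def)
      also have "\<dots> \<le> ennreal ((r/2)\<^sup>2)"
        by (rule gm) (use M \<open>m \<ge> M\<close> in \<open>auto simp: less_imp_le\<close>)
      finally have "(norm (abs_L2field g - X m))\<^sup>2 \<le> (r/2)\<^sup>2" by simp
      then have "norm (abs_L2field g - X m) \<le> r/2" 
        using \<open>r > 0\<close> by (auto intro: power2_le_imp_le[of _ "r/2"])
      then show "norm (X m - abs_L2field g) < r" using \<open>r > 0\<close> by (simp add: norm_minus_commute)
    qed
  qed
  then show ?thesis by (auto simp: convergent_def)
qed

text \<open>Completeness is what makes an orthogonal series with square-summable coefficients converge,
  and so lets membership in \<open>D(A^\<alpha>)\<close> be read off the coefficients.\<close>

instance L2field :: banach
proof
  fix X :: "nat \<Rightarrow> L2field" assume C: "Cauchy X"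
  have "\<exists>N. \<forall>m\<ge>N. \<forall>n\<ge>N. norm (X m - X n) \<le> (1/2)^k" for k
    using C[unfolded Cauchy_def, rule_format, of "(1/2)^k"] by (simp add: dist_norm) (meson less_imp_le)
  then obtain N where N: "\<And>k m n. m \<ge> N k \<Longrightarrow> n \<ge> N k \<Longrightarrow> norm (X m - X n) \<le> (1/2)^k"
    by metis
  \<comment> \<open>The summand \<open>k\<close> makes the subsequence strictly increasing.\<close>
  define r where "r k = (\<Sum>i\<le>k. N i) + k" for k
  have r: "r k \<ge> N k" "r (Suc k) \<ge> N k" for k
    by (auto simp: r_def lessThan_Suc_atMost[symmetric])
  have "strict_mono r" by (intro strict_monoI_Suc) (simp add: r_def)
  have "convergent (X \<circ> r)"
  proof (rule L2field_fast_Cauchy_converges)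
    show "norm ((X \<circ> r) (Suc n) - (X \<circ> r) n) \<le> (1/2)^n" for n
      using N r by simp
    show "Cauchy (X \<circ> r)" using Cauchy_subseq_Cauchy C \<open>strict_mono r\<close> by blast
  qed
  then show "convergent X"
    using Cauchy_converges_subseq[OF C \<open>strict_mono r\<close>] by (auto simp: convergent_def o_def)
qed

section \<open>Orthonormal expansions\<close>

lemma orthonormal_inner_sum:
  fixes e :: "nat \<Rightarrow> 'a::real_inner"
  assumes "\<And>j k. inner (e j) (e k) = (if j = k then 1 else 0)" and "finite F"
  shows "inner (\<Sum>k\<in>F. c k *\<^sub>R e k) (e j) = (if j \<in> F then c j else 0)"
proof -
  have "inner (\<Sum>k\<in>F. c k *\<^sub>R e k) (e j) = (\<Sum>k\<in>F. if k = j then c k else 0)"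
    by (simp add: inner_sum_left assms(1) if_distrib cong: if_cong)
  then show ?thesis using assms(2) by simp
qed

lemma orthonormal_norm_sum:
  fixes e :: "nat \<Rightarrow> 'a::real_inner"
  assumes "\<And>j k. inner (e j) (e k) = (if j = k then 1 else 0)" and "finite F"
  shows "(norm (\<Sum>k\<in>F. c k *\<^sub>R e k))\<^sup>2 = (\<Sum>k\<in>F. (c k)\<^sup>2)"
proof -
  have "(norm (\<Sum>k\<in>F. c k *\<^sub>R e k))\<^sup>2 = (\<Sum>j\<in>F. c j * inner (\<Sum>k\<in>F. c k *\<^sub>R e k) (e j))"
    by (simp add: power2_norm_eq_inner inner_sum_right)
  also have "\<dots> = (\<Sum>j\<in>F. (c j)\<^sup>2)"
    using assms by (intro sum.cong) (auto simp: orthonormal_inner_sum power2_eq_square)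
  finally show ?thesis .
qed

lemma orthonormal_series:
  fixes e :: "nat \<Rightarrow> 'a::{real_inner, banach}"
  assumes on: "\<And>j k. inner (e j) (e k) = (if j = k then 1 else 0)"
    and c: "summable (\<lambda>k. (c k)\<^sup>2)"
  shows "summable (\<lambda>k. c k *\<^sub>R e k)" "inner (\<Sum>k. c k *\<^sub>R e k) (e j) = c j"
proof -
  show s: "summable (\<lambda>k. c k *\<^sub>R e k)"
    unfolding summable_Cauchy
  proof (intro allI impI)
    fix r :: real assume "r > 0"
    then obtain N where N: "\<And>m n. m \<ge> N \<Longrightarrow> norm (\<Sum>k=m..<n. (c k)\<^sup>2) < r\<^sup>2"
      using c unfolding summable_Cauchy by (meson zero_less_power)
    show "\<exists>N. \<forall>m\<ge>N. \<forall>n. norm (\<Sum>k=m..<n. c k *\<^sub>R e k) < r"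
    proof (intro exI allI impI)
      fix m n assume "m \<ge> N"
      have "(norm (\<Sum>k=m..<n. c k *\<^sub>R e k))\<^sup>2 < r\<^sup>2"
        using N[OF \<open>m \<ge> N\<close>, of n] by (subst orthonormal_norm_sum[OF on]) auto
      then show "norm (\<Sum>k=m..<n. c k *\<^sub>R e k) < r"
        using \<open>r > 0\<close> by (auto intro: power2_less_imp_less[of _ r])
    qed
  qed
  have "(\<lambda>n. inner (\<Sum>k<n. c k *\<^sub>R e k) (e j)) \<longlonglongrightarrow> inner (\<Sum>k. c k *\<^sub>R e k) (e j)"
    by (intro tendsto_intros summable_LIMSEQ s)
  moreover have "(\<lambda>n. inner (\<Sum>k<n. c k *\<^sub>R e k) (e j)) \<longlonglongrightarrow> c j"
    by (intro tendsto_eventually eventually_sequentiallyI[of "Suc j"])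
       (simp add: orthonormal_inner_sum[OF on])
  ultimately show "inner (\<Sum>k. c k *\<^sub>R e k) (e j) = c j" by (rule LIMSEQ_unique)
qed

lemma Bessel_inequality:
  fixes e :: "nat \<Rightarrow> 'a::real_inner"
  assumes on: "\<And>j k. inner (e j) (e k) = (if j = k then 1 else 0)" and "finite F"
  shows "(\<Sum>k\<in>F. (inner x (e k))\<^sup>2) \<le> (norm x)\<^sup>2"
proof -
  let ?s = "\<Sum>k\<in>F. inner x (e k) *\<^sub>R e k"
  have "0 \<le> inner (x - ?s) (x - ?s)" by simp
  also have "\<dots> = (norm x)\<^sup>2 - 2 * inner x ?s + (norm ?s)\<^sup>2"
    by (simp add: inner_diff_left inner_diff_right power2_norm_eq_inner inner_commute)
  also have "inner x ?s = (\<Sum>k\<in>F. (inner x (e k))\<^sup>2)"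
    by (simp add: inner_sum_right power2_eq_square)
  also have "(norm ?s)\<^sup>2 = (\<Sum>k\<in>F. (inner x (e k))\<^sup>2)"
    by (rule orthonormal_norm_sum[OF assms])
  finally show ?thesis by simp
qed

lemma orthonormal_coeffs_summable:
  fixes e :: "nat \<Rightarrow> 'a::real_inner"
  assumes on: "\<And>j k. inner (e j) (e k) = (if j = k then 1 else 0)"
  shows "summable (\<lambda>k. (inner x (e k))\<^sup>2)"
  by (rule summableI_nonneg_bounded[where x = "(norm x)\<^sup>2"]) (auto intro: Bessel_inequality[OF on])

text \<open>The defect \<open>x - s\<close> of the Fourier series is orthogonal to every basis vector, hence to the closed span,
  which contains both \<open>x\<close> and \<open>s\<close>; so it is orthogonal to itself.\<close>

lemma orthonormal_expansion:
  fixes e :: "nat \<Rightarrow> 'a::{real_inner, banach}"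
  assumes on: "\<And>j k. inner (e j) (e k) = (if j = k then 1 else 0)"
    and x: "x \<in> closure (span (range e))"
  shows "(\<lambda>k. inner x (e k) *\<^sub>R e k) sums x"
proof -
  note ser = orthonormal_series[OF on orthonormal_coeffs_summable[OF on], of x]
  define s where "s = (\<Sum>k. inner x (e k) *\<^sub>R e k)"
  have sums: "(\<lambda>k. inner x (e k) *\<^sub>R e k) sums s"
    unfolding s_def using ser(1) by (rule summable_sums)
  have "closure (span (range e)) \<subseteq> {y. inner (x - s) y = 0}"
  proof (intro closure_minimal span_minimal)
    show "range e \<subseteq> {y. inner (x - s) y = 0}"
      using ser(2) by (auto simp: inner_diff_left s_def)
    show "subspace {y. inner (x - s) y = 0}" by (simp add: subspace_hyperplane)
    show "closed {y. inner (x - s) y = 0}" by (rule closed_hyperplane)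
  qed
  moreover have "s \<in> closure (span (range e))"
  proof (rule closed_sequentially)
    show "closed (closure (span (range e)))" by simp
    show "(\<lambda>n. \<Sum>k<n. inner x (e k) *\<^sub>R e k) \<longlonglongrightarrow> s" using sums by (simp add: sums_def)
    show "(\<Sum>k<n. inner x (e k) *\<^sub>R e k) \<in> closure (span (range e))" for n
      by (intro subsetD[OF closure_subset] span_sum span_scale span_base) auto
  qed
  ultimately have "inner (x - s) x = 0" "inner (x - s) s = 0" using x by auto
  then have "inner (x - s) (x - s) = 0" by (simp add: inner_diff_right)
  then show ?thesis using sums by simp
qed

lemma Parseval:
  fixes e :: "nat \<Rightarrow> 'a::{real_inner, banach}"
  assumes on: "\<And>j k. inner (e j) (e k) = (if j = k then 1 else 0)"
    and x: "x \<in> closure (span (range e))"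
  shows "(\<lambda>k. inner x (e k) * inner y (e k)) sums inner x y"
proof -
  have "(\<lambda>n. inner y (\<Sum>k<n. inner x (e k) *\<^sub>R e k)) \<longlonglongrightarrow> inner y x"
    using orthonormal_expansion[OF assms] unfolding sums_def by (intro tendsto_intros)
  then show ?thesis by (simp add: sums_def inner_sum_right inner_commute[of x y])
qed

section \<open>Fractional powers through eigenfunction coefficients\<close>

text \<open>The part of the Stokes setting that the powers \<open>A^\<alpha>\<close> depend on: they are diagonal in the
  eigenbasis, and for \<open>\<alpha> \<ge> 0\<close> their inverses are bounded because the eigenvalues stay above \<open>lam 0\<close>.\<close>

locale spectral_setting =
  fixes D :: "(real^2) set" and e :: "nat \<Rightarrow> L2field" and lam :: "nat \<Rightarrow> real"
  assumes orthonormal: "\<And>j k. inner (e j) (e k) = (if j = k then 1 else 0)"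
    and lam0_pos: "0 < lam 0" and lam0_le: "\<And>k. lam 0 \<le> lam k"
    and subspace_H: "subspace (space_H D)"
    and e_in_H: "\<And>k. e k \<in> space_H D"
    and e_complete: "space_H D \<subseteq> closure (span (range e))"
begin

abbreviation coef :: "L2field \<Rightarrow> nat \<Rightarrow> real" where "coef x k \<equiv> inner x (e k)"
abbreviation npow :: "real \<Rightarrow> L2field \<Rightarrow> L2field" where "npow \<equiv> neg_pow e lam"
abbreviation Dom :: "real \<Rightarrow> L2field set" where "Dom \<equiv> dom_pow D e lam"
abbreviation Apow :: "real \<Rightarrow> L2field \<Rightarrow> L2field" where "Apow \<equiv> A_pow D e lam"

lemma lam_pos: "0 < lam k"
  using lam0_pos lam0_le[of k] by linarith

lemma H_expansion: "x \<in> space_H D \<Longrightarrow> (\<lambda>k. coef x k *\<^sub>R e k) sums x"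
  by (rule orthonormal_expansion[OF orthonormal]) (use e_complete in auto)

lemma H_eqI: "x \<in> space_H D \<Longrightarrow> y \<in> space_H D \<Longrightarrow> (\<And>k. coef x k = coef y k) \<Longrightarrow> x = y"
  using H_expansion[of x] H_expansion[of y] by (simp add: sums_unique2)

lemma H_Parseval: "x \<in> space_H D \<Longrightarrow> (\<lambda>k. (coef x k)\<^sup>2) sums (norm x)\<^sup>2"
  using Parseval[OF orthonormal, of x x] e_complete
  by (auto simp: power2_norm_eq_inner simp flip: power2_eq_square)

lemma series_in_H:
  assumes "summable (\<lambda>k. (c k)\<^sup>2)"
  shows "(\<Sum>k. c k *\<^sub>R e k) \<in> space_H D"
proof (rule closed_sequentially)
  show "closed (space_H D)" by (simp add: space_H_def)
  show "(\<lambda>n. \<Sum>k<n. c k *\<^sub>R e k) \<longlonglongrightarrow> (\<Sum>k. c k *\<^sub>R e k)"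
    by (intro summable_LIMSEQ orthonormal_series(1)[OF orthonormal assms])
  show "(\<Sum>k<n. c k *\<^sub>R e k) \<in> space_H D" for n
    by (intro subspace_sum subspace_H subspace_scale e_in_H)
qed

lemma powr_lam_le: "\<alpha> \<le> \<beta> \<Longrightarrow> lam k powr \<alpha> \<le> lam 0 powr (\<alpha> - \<beta>) * lam k powr \<beta>"
proof -
  assume "\<alpha> \<le> \<beta>"
  have "lam k powr (\<alpha> - \<beta>) \<le> lam 0 powr (\<alpha> - \<beta>)"
    using \<open>\<alpha> \<le> \<beta>\<close> lam0_le lam0_pos by (intro powr_mono2') auto
  then have "lam k powr (\<alpha> - \<beta>) * lam k powr \<beta> \<le> lam 0 powr (\<alpha> - \<beta>) * lam k powr \<beta>"
    by (intro mult_right_mono) auto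
  then show ?thesis using lam_pos[of k] by (simp flip: powr_add)
qed

lemma npow_props:
  assumes x: "x \<in> space_H D" and "0 \<le> \<alpha>"
  shows "npow \<alpha> x \<in> space_H D" "coef (npow \<alpha> x) k = lam k powr (- \<alpha>) * coef x k"
proof -
  have "summable (\<lambda>k. (lam k powr (- \<alpha>) * coef x k)\<^sup>2)"
  proof (rule summable_comparison_test'[where N = 0])
    show "summable (\<lambda>k. (lam 0 powr (- \<alpha>))\<^sup>2 * (coef x k)\<^sup>2)"
      using orthonormal_coeffs_summable[OF orthonormal] by (intro summable_mult)
    have "lam k powr (- \<alpha>) \<le> lam 0 powr (- \<alpha>)" for k
      using \<open>0 \<le> \<alpha>\<close> lam0_le lam0_pos by (intro powr_mono2') auto
    then show "norm ((lam n powr (- \<alpha>) * coef x n)\<^sup>2) \<le> (lam 0 powr (- \<alpha>))\<^sup>2 * (coef x n)\<^sup>2" for n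
      by (auto simp: power_mult_distrib intro!: mult_right_mono power_mono)
  qed
  then show "npow \<alpha> x \<in> space_H D" "coef (npow \<alpha> x) k = lam k powr (- \<alpha>) * coef x k"
    unfolding neg_pow_def by (rule series_in_H, rule orthonormal_series(2)[OF orthonormal])
qed

text \<open>The range of the diagonal operator \<open>A^{-\<alpha>}\<close> is found by dividing coefficients: the candidate
  preimage is the series with coefficients \<open>\<lambda>_k^\<alpha> y_k\<close>, which converges exactly when they are
  square-summable.\<close>

lemma Dom_iff:
  assumes "0 \<le> \<alpha>"
  shows "y \<in> Dom \<alpha> \<longleftrightarrow> y \<in> space_H D \<and> summable (\<lambda>k. (lam k powr \<alpha> * coef y k)\<^sup>2)"
proof safe
  assume "y \<in> Dom \<alpha>"
  then obtain x where x: "x \<in> space_H D" "y = npow \<alpha> x" by (auto simp: dom_pow_def)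
  show "y \<in> space_H D" using npow_props x assms by auto
  have "lam k powr \<alpha> * coef y k = coef x k" for k
    using npow_props(2)[OF x(1) assms, of k] lam_pos[of k] x(2) by (simp add: powr_minus field_simps)
  then show "summable (\<lambda>k. (lam k powr \<alpha> * coef y k)\<^sup>2)"
    using orthonormal_coeffs_summable[OF orthonormal, of x] by simp
next
  assume y: "y \<in> space_H D" and s: "summable (\<lambda>k. (lam k powr \<alpha> * coef y k)\<^sup>2)"
  define x where "x = (\<Sum>k. (lam k powr \<alpha> * coef y k) *\<^sub>R e k)"
  have x: "x \<in> space_H D" unfolding x_def by (rule series_in_H[OF s])
  have "coef x k = lam k powr \<alpha> * coef y k" for k
    unfolding x_def by (rule orthonormal_series(2)[OF orthonormal s])
  moreover have "lam k powr (- \<alpha>) * (lam k powr \<alpha> * coef y k) = coef y k" for k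
    using lam_pos[of k] by (simp add: powr_minus)
  ultimately have "npow \<alpha> x = y"
    using npow_props[OF x assms] y by (intro H_eqI) auto
  then show "y \<in> Dom \<alpha>" using x by (auto simp: dom_pow_def)
qed

lemma Dom_in_H: "0 \<le> \<alpha> \<Longrightarrow> y \<in> Dom \<alpha> \<Longrightarrow> y \<in> space_H D"
  by (simp add: Dom_iff)

lemma Apow_props:
  assumes "0 \<le> \<alpha>" and y: "y \<in> Dom \<alpha>"
  shows "Apow \<alpha> y \<in> space_H D" "coef (Apow \<alpha> y) k = lam k powr \<alpha> * coef y k"
proof -
  have y': "y \<in> npow \<alpha> ` space_H D" using y by (simp add: dom_pow_def)
  show H: "Apow \<alpha> y \<in> space_H D"
    unfolding A_pow_def by (rule inv_into_into[OF y'])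
  have "npow \<alpha> (Apow \<alpha> y) = y"
    unfolding A_pow_def by (rule f_inv_into_f[OF y'])
  then show "coef (Apow \<alpha> y) k = lam k powr \<alpha> * coef y k"
    using npow_props(2)[OF H assms(1), of k] lam_pos[of k] by (simp add: powr_minus field_simps)
qed

lemma norm_Apow_sums:
  assumes "0 \<le> \<alpha>" "y \<in> Dom \<alpha>"
  shows "(\<lambda>k. lam k powr (2 * \<alpha>) * (coef y k)\<^sup>2) sums (norm (Apow \<alpha> y))\<^sup>2"
proof -
  have "(lam k powr \<alpha> * coef y k)\<^sup>2 = lam k powr (2 * \<alpha>) * (coef y k)\<^sup>2" for k
    using lam_pos[of k] by (simp add: power_mult_distrib powr_power mult.commute)
  then show ?thesis using H_Parseval[OF Apow_props(1)[OF assms]] Apow_props(2)[OF assms] by simp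
qed

lemma subspace_Dom:
  assumes "0 \<le> \<alpha>" shows "subspace (Dom \<alpha>)"
proof (rule subspaceI)
  show "0 \<in> Dom \<alpha>" using assms by (simp add: Dom_iff subspace_0[OF subspace_H])
  show "c *\<^sub>R x \<in> Dom \<alpha>" if "x \<in> Dom \<alpha>" for x c
  proof -
    have "summable (\<lambda>k. c\<^sup>2 * (lam k powr \<alpha> * coef x k)\<^sup>2)"
      using that assms by (intro summable_mult) (simp add: Dom_iff)
    also have "(\<lambda>k. c\<^sup>2 * (lam k powr \<alpha> * coef x k)\<^sup>2) = (\<lambda>k. (lam k powr \<alpha> * coef (c *\<^sub>R x) k)\<^sup>2)"
      by (auto simp: power_mult_distrib)
    finally show ?thesis using that assms by (simp add: Dom_iff subspace_scale[OF subspace_H])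
  qed
  show "x + y \<in> Dom \<alpha>" if "x \<in> Dom \<alpha>" "y \<in> Dom \<alpha>" for x y
  proof -
    have "summable (\<lambda>k. (lam k powr \<alpha> * coef (x + y) k)\<^sup>2)"
    proof (rule summable_comparison_test'[where N = 0])
      show "summable (\<lambda>k. 2 * (lam k powr \<alpha> * coef x k)\<^sup>2 + 2 * (lam k powr \<alpha> * coef y k)\<^sup>2)"
        using that assms by (intro summable_add summable_mult) (simp_all add: Dom_iff)
      have "(lam k powr \<alpha> * coef (x + y) k)\<^sup>2
          = (lam k powr \<alpha> * coef x k + lam k powr \<alpha> * coef y k)\<^sup>2" for k
        by (simp add: inner_add_left algebra_simps)
      moreover have "(a + b)\<^sup>2 \<le> 2 * a\<^sup>2 + 2 * b\<^sup>2" for a b :: real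
        using zero_le_power2[of "a - b"] by (simp add: power2_sum power2_diff)
      ultimately show "norm ((lam k powr \<alpha> * coef (x + y) k)\<^sup>2)
          \<le> 2 * (lam k powr \<alpha> * coef x k)\<^sup>2 + 2 * (lam k powr \<alpha> * coef y k)\<^sup>2" for k
        by simp
    qed
    then show ?thesis using that assms by (simp add: Dom_iff subspace_add[OF subspace_H])
  qed
qed

lemma
  assumes "0 \<le> \<alpha>" "x \<in> Dom \<alpha>" "y \<in> Dom \<alpha>"
  shows Apow_add: "Apow \<alpha> (x + y) = Apow \<alpha> x + Apow \<alpha> y"
    and Apow_diff: "Apow \<alpha> (x - y) = Apow \<alpha> x - Apow \<alpha> y"
proof -
  note sub = subspace_Dom[OF assms(1)]
  show "Apow \<alpha> (x + y) = Apow \<alpha> x + Apow \<alpha> y"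
    using assms subspace_add[OF sub assms(2,3)]
    by (intro H_eqI) (auto simp: Apow_props inner_add_left algebra_simps intro: subspace_add[OF subspace_H])
  show "Apow \<alpha> (x - y) = Apow \<alpha> x - Apow \<alpha> y"
    using assms subspace_diff[OF sub assms(2,3)]
    by (intro H_eqI) (auto simp: Apow_props inner_diff_left algebra_simps intro: subspace_diff[OF subspace_H])
qed

lemma Dom_mono:
  assumes "0 \<le> \<alpha>" "\<alpha> \<le> \<beta>" "y \<in> Dom \<beta>"
  shows "y \<in> Dom \<alpha>" "norm (Apow \<alpha> y) \<le> lam 0 powr (\<alpha> - \<beta>) * norm (Apow \<beta> y)"
proof -
  have "0 \<le> \<beta>" using assms by simp
  have le: "\<bar>lam k powr \<alpha> * coef y k\<bar> \<le> lam 0 powr (\<alpha> - \<beta>) * \<bar>lam k powr \<beta> * coef y k\<bar>" for k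
    using mult_right_mono[OF powr_lam_le[OF assms(2), of k], of "\<bar>coef y k\<bar>"]
    by (simp add: abs_mult mult_ac)
  have le2: "(lam k powr \<alpha> * coef y k)\<^sup>2 \<le> (lam 0 powr (\<alpha> - \<beta>))\<^sup>2 * (lam k powr \<beta> * coef y k)\<^sup>2" for k
    using power_mono[OF le[of k], of 2] by (simp add: power_mult_distrib)
  have s: "summable (\<lambda>k. (lam 0 powr (\<alpha> - \<beta>))\<^sup>2 * (lam k powr \<beta> * coef y k)\<^sup>2)"
    using assms \<open>0 \<le> \<beta>\<close> by (intro summable_mult) (simp add: Dom_iff)
  have "summable (\<lambda>k. (lam k powr \<alpha> * coef y k)\<^sup>2)"
    by (rule summable_comparison_test'[where N = 0, OF s]) (use le2 in simp)
  then show y: "y \<in> Dom \<alpha>" using assms \<open>0 \<le> \<beta>\<close> by (simp add: Dom_iff)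
  have a: "(\<lambda>k. (lam k powr \<alpha> * coef y k)\<^sup>2) sums (norm (Apow \<alpha> y))\<^sup>2"
    using H_Parseval[OF Apow_props(1)[OF assms(1) y]] by (simp add: Apow_props[OF assms(1) y])
  have b: "(\<lambda>k. (lam k powr \<beta> * coef y k)\<^sup>2) sums (norm (Apow \<beta> y))\<^sup>2"
    using H_Parseval[OF Apow_props(1)[OF \<open>0 \<le> \<beta>\<close> assms(3)]] by (simp add: Apow_props[OF \<open>0 \<le> \<beta>\<close> assms(3)])
  have "(norm (Apow \<alpha> y))\<^sup>2 \<le> (lam 0 powr (\<alpha> - \<beta>))\<^sup>2 * (norm (Apow \<beta> y))\<^sup>2"
    by (rule sums_le[OF le2 a sums_mult[OF b]])
  then have "(norm (Apow \<alpha> y))\<^sup>2 \<le> (lam 0 powr (\<alpha> - \<beta>) * norm (Apow \<beta> y))\<^sup>2"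
    by (simp add: power_mult_distrib)
  then show "norm (Apow \<alpha> y) \<le> lam 0 powr (\<alpha> - \<beta>) * norm (Apow \<beta> y)"
    by (rule power2_le_imp_le) simp
qed

lemma span_e_Dom:
  assumes "0 \<le> \<alpha>" shows "span (range e) \<subseteq> Dom \<alpha>"
proof (rule span_minimal[OF _ subspace_Dom[OF assms]])
  have "summable (\<lambda>k. (lam k powr \<alpha> * coef (e j) k)\<^sup>2)" for j
    by (rule summable_finite[of "{j}"]) (auto simp: orthonormal)
  then show "range e \<subseteq> Dom \<alpha>" using assms by (auto simp: Dom_iff e_in_H)
qed

lemma coef_span_eq_0: "y \<in> span (e ` {..<n}) \<Longrightarrow> n \<le> k \<Longrightarrow> coef y k = 0"
proof (induction rule: span_induct_alt)
  case (step c x y)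
  then show ?case by (auto simp: inner_add_left orthonormal)
qed simp

lemma span_first_subset: "span (e ` {..<n}) \<subseteq> span (range e)"
  by (intro span_mono) auto

lemma norm_Apow_span:
  assumes "0 \<le> \<alpha>" "y \<in> span (e ` {..<n})"
  shows "(norm (Apow \<alpha> y))\<^sup>2 = (\<Sum>k<n. lam k powr (2 * \<alpha>) * (coef y k)\<^sup>2)"
proof -
  have "y \<in> Dom \<alpha>" using span_e_Dom[OF assms(1)] span_first_subset assms(2) by blast
  from norm_Apow_sums[OF assms(1) this]
  show ?thesis
    by (rule sums_unique2[OF _ sums_finite]) (auto simp: coef_span_eq_0[OF assms(2)])
qed

lemma span_expansion: "y \<in> span (e ` {..<n}) \<Longrightarrow> y = (\<Sum>k<n. coef y k *\<^sub>R e k)"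
proof -
  assume y: "y \<in> span (e ` {..<n})"
  then have "y \<in> space_H D" using span_e_Dom[of 0] span_first_subset Dom_in_H by blast
  from H_expansion[OF this] show ?thesis
    by (rule sums_unique2[OF _ sums_finite]) (auto simp: coef_span_eq_0[OF y])
qed

lemma coef_proj_n: "coef (proj_n e n y) k = (if k < n then coef y k else 0)"
  by (simp add: proj_n_def orthonormal_inner_sum[OF orthonormal])

lemma proj_n_in_span: "proj_n e n y \<in> span (e ` {..<n})"
  unfolding proj_n_def by (intro span_sum span_scale span_base) auto

lemma norm_Apow_proj_n_le:
  assumes "0 \<le> \<alpha>" "y \<in> Dom \<alpha>"
  shows "norm (Apow \<alpha> (proj_n e n y)) \<le> norm (Apow \<alpha> y)"
proof (rule power2_le_imp_le)
  have "(norm (Apow \<alpha> (proj_n e n y)))\<^sup>2 = (\<Sum>k<n. lam k powr (2 * \<alpha>) * (coef y k)\<^sup>2)"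
    using norm_Apow_span[OF assms(1) proj_n_in_span, of n y] by (simp add: coef_proj_n)
  also have "\<dots> \<le> (norm (Apow \<alpha> y))\<^sup>2"
    using norm_Apow_sums[OF assms] sum_le_suminf[of "\<lambda>k. lam k powr (2 * \<alpha>) * (coef y k)\<^sup>2" "{..<n}"]
    by (auto simp: sums_iff)
  finally show "(norm (Apow \<alpha> (proj_n e n y)))\<^sup>2 \<le> (norm (Apow \<alpha> y))\<^sup>2" .
qed simp

text \<open>Spectral truncation commutes with \<open>A^\<alpha>\<close>. This makes the span of the eigenfunctions dense in every
  \<open>D(A^\<alpha>)\<close> with respect to its own norm.\<close>

lemma Apow_proj_n_tendsto:
  assumes "0 \<le> \<alpha>" "y \<in> Dom \<alpha>"
  shows "(\<lambda>n. norm (Apow \<alpha> (y - proj_n e n y))) \<longlonglongrightarrow> 0"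
proof -
  have P: "proj_n e n y \<in> Dom \<alpha>" for n
    using span_e_Dom[OF assms(1)] span_first_subset proj_n_in_span by blast
  have "Apow \<alpha> (proj_n e n y) = (\<Sum>k<n. coef (Apow \<alpha> y) k *\<^sub>R e k)" for n
    by (rule H_eqI) (auto simp: Apow_props[OF assms(1) P] Apow_props[OF assms] coef_proj_n
        orthonormal_inner_sum[OF orthonormal] intro!: subspace_sum subspace_H subspace_scale e_in_H)
  then have "(\<lambda>n. Apow \<alpha> (proj_n e n y)) \<longlonglongrightarrow> Apow \<alpha> y"
    using H_expansion[OF Apow_props(1)[OF assms]] by (simp add: sums_def)
  then have "(\<lambda>n. norm (Apow \<alpha> y - Apow \<alpha> (proj_n e n y))) \<longlonglongrightarrow> norm (Apow \<alpha> y - Apow \<alpha> y)"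
    by (intro tendsto_intros)
  then show ?thesis by (simp add: Apow_diff[OF assms P])
qed

end

section \<open>Interpolation of bilinear forms on a weighted sequence scale\<close>

lemma sum_geometric_int_le:
  fixes J :: "int set" and \<rho> :: real
  assumes "finite J" and \<rho>: "0 \<le> \<rho>" "\<rho> < 1"
  shows "(\<Sum>l\<in>J. \<rho> ^ nat \<bar>j - l\<bar>) \<le> 2 / (1 - \<rho>)"
proof -
  have half: "(\<Sum>l\<in>I. \<rho> ^ nat \<bar>j - l\<bar>) \<le> 1 / (1 - \<rho>)"
    if "finite I" "inj_on (\<lambda>l. nat \<bar>j - l\<bar>) I" for I
  proof -
    have "(\<Sum>l\<in>I. \<rho> ^ nat \<bar>j - l\<bar>) = (\<Sum>m\<in>(\<lambda>l. nat \<bar>j - l\<bar>) ` I. \<rho> ^ m)"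
      using that by (simp add: sum.reindex)
    also have "\<dots> \<le> (\<Sum>m. \<rho> ^ m)"
      using \<rho> that by (intro sum_le_suminf summable_geometric) auto
    also have "\<dots> = 1 / (1 - \<rho>)" using \<rho> by (intro suminf_geometric) auto
    finally show ?thesis .
  qed
  have "(\<Sum>l\<in>J. \<rho> ^ nat \<bar>j - l\<bar>)
      = (\<Sum>l\<in>{l\<in>J. l \<le> j}. \<rho> ^ nat \<bar>j - l\<bar>) + (\<Sum>l\<in>{l\<in>J. \<not> l \<le> j}. \<rho> ^ nat \<bar>j - l\<bar>)"
    by (subst sum.union_disjoint[symmetric]) (use assms in \<open>auto intro!: sum.cong\<close>)
  also have "\<dots> \<le> 1 / (1 - \<rho>) + 1 / (1 - \<rho>)"
    by (intro add_mono half) (use assms in \<open>auto simp: inj_on_def\<close>)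
  finally show ?thesis by simp
qed

text \<open>Schur's test for a kernel that decays geometrically off the diagonal: Cauchy-Schwarz with the
  kernel split evenly between the two factors, then summation of rows and of columns.\<close>

lemma schur_geometric:
  fixes J :: "int set" and \<rho> :: real and a b :: "int \<Rightarrow> real"
  assumes J: "finite J" and \<rho>: "0 \<le> \<rho>" "\<rho> < 1"
  shows "(\<Sum>j\<in>J. \<Sum>l\<in>J. \<rho> ^ nat \<bar>j - l\<bar> * (a j * b l))
     \<le> 2 / (1 - \<rho>) * (sqrt (\<Sum>j\<in>J. (a j)\<^sup>2) * sqrt (\<Sum>l\<in>J. (b l)\<^sup>2))"
proof -
  let ?K = "2 / (1 - \<rho>)"
  let ?w = "\<lambda>j l. sqrt (\<rho> ^ nat \<bar>j - l\<bar>)"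
  let ?S = "\<Sum>j\<in>J. \<Sum>l\<in>J. \<rho> ^ nat \<bar>j - l\<bar> * (a j * b l)"
  have w: "?w j l * ?w j l = \<rho> ^ nat \<bar>j - l\<bar>" "(?w j l)\<^sup>2 = \<rho> ^ nat \<bar>j - l\<bar>" for j l
    using \<rho> by auto
  have "?S = (\<Sum>(j,l)\<in>J \<times> J. (?w j l * a j) * (?w j l * b l))"
    unfolding sum.cartesian_product[symmetric]
  proof (intro sum.cong refl)
    fix j l
    have "(?w j l * a j) * (?w j l * b l) = (?w j l * ?w j l) * (a j * b l)" by (simp only: mult_ac)
    then show "\<rho> ^ nat \<bar>j - l\<bar> * (a j * b l) = (?w j l * a j) * (?w j l * b l)" by (simp only: w(1))
  qed
  then have "?S\<^sup>2 \<le> (\<Sum>(j,l)\<in>J \<times> J. (?w j l * a j)\<^sup>2) * (\<Sum>(j,l)\<in>J \<times> J. (?w j l * b l)\<^sup>2)"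
    using Cauchy_Schwarz_ineq_sum[of "\<lambda>(j,l). ?w j l * a j" "\<lambda>(j,l). ?w j l * b l" "J \<times> J"]
    by (simp add: case_prod_unfold)
  also have "(\<Sum>(j,l)\<in>J \<times> J. (?w j l * a j)\<^sup>2) = (\<Sum>j\<in>J. (a j)\<^sup>2 * (\<Sum>l\<in>J. \<rho> ^ nat \<bar>j - l\<bar>))"
    unfolding sum.cartesian_product[symmetric] by (simp add: power_mult_distrib w sum_distrib_left mult_ac)
  also have "(\<Sum>(j,l)\<in>J \<times> J. (?w j l * b l)\<^sup>2) = (\<Sum>l\<in>J. (b l)\<^sup>2 * (\<Sum>j\<in>J. \<rho> ^ nat \<bar>l - j\<bar>))"
    unfolding sum.cartesian_product[symmetric]
    by (subst sum.swap) (simp add: power_mult_distrib w sum_distrib_left mult_ac abs_minus_commute)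
  also have "(\<Sum>j\<in>J. (a j)\<^sup>2 * (\<Sum>l\<in>J. \<rho> ^ nat \<bar>j - l\<bar>)) * (\<Sum>l\<in>J. (b l)\<^sup>2 * (\<Sum>j\<in>J. \<rho> ^ nat \<bar>l - j\<bar>))
      \<le> (\<Sum>j\<in>J. (a j)\<^sup>2 * ?K) * (\<Sum>l\<in>J. (b l)\<^sup>2 * ?K)"
    using \<rho> by (intro mult_mono sum_mono mult_left_mono sum_geometric_int_le J \<rho>)
       (auto intro!: sum_nonneg mult_nonneg_nonneg)
  also have "\<dots> = (?K * (sqrt (\<Sum>j\<in>J. (a j)\<^sup>2) * sqrt (\<Sum>l\<in>J. (b l)\<^sup>2)))\<^sup>2"
  proof -
    have "(\<Sum>j\<in>J. (a j)\<^sup>2 * ?K) = ?K * (\<Sum>j\<in>J. (a j)\<^sup>2)" for a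
      by (simp only: sum_distrib_left mult.commute)
    then show ?thesis
      by (simp only: power_mult_distrib real_sqrt_pow2 sum_nonneg zero_le_power2 power2_eq_square[of ?K] mult_ac)
  qed
  finally show ?thesis
    by (rule power2_le_imp_le) (use \<rho> in \<open>auto intro!: mult_nonneg_nonneg divide_nonneg_nonneg sum_nonneg\<close>)
qed

text \<open>The norm of \<open>A^s y\<close> in terms of the first \<open>n\<close> coefficients of \<open>y\<close>; all estimates for Galerkin
  solutions are made on this scale of finite-dimensional norms.\<close>

definition wnorm :: "(nat \<Rightarrow> real) \<Rightarrow> nat \<Rightarrow> real \<Rightarrow> (nat \<Rightarrow> real) \<Rightarrow> real" where
  "wnorm lam n s a = sqrt (\<Sum>k<n. lam k powr (2 * s) * (a k)\<^sup>2)"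

lemma wnorm_nonneg [simp]: "0 \<le> wnorm lam n s a"
  by (auto simp: wnorm_def intro!: sum_nonneg)

lemma wnorm_sq: "(wnorm lam n s a)\<^sup>2 = (\<Sum>k<n. lam k powr (2 * s) * (a k)\<^sup>2)"
  by (auto simp: wnorm_def intro!: sum_nonneg)

lemma wnorm_le:
  assumes "0 \<le> c" and "\<And>k. k < n \<Longrightarrow> a k \<noteq> 0 \<Longrightarrow> lam k > 0 \<and> lam k powr (s - t) \<le> c"
  shows "wnorm lam n s a \<le> c * wnorm lam n t a"
proof (rule power2_le_imp_le)
  have "lam k powr (2 * s) * (a k)\<^sup>2 \<le> c\<^sup>2 * (lam k powr (2 * t) * (a k)\<^sup>2)" if "k < n" for k
  proof (cases "a k = 0")
    case False
    with assms that have l: "lam k > 0" "lam k powr (s - t) \<le> c" by auto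
    have "lam k powr (2 * s) = (lam k powr (s - t))\<^sup>2 * lam k powr (2 * t)"
      using l by (simp add: powr_power algebra_simps flip: powr_add)
    also have "\<dots> \<le> c\<^sup>2 * lam k powr (2 * t)"
      using l by (intro mult_right_mono power_mono) auto
    finally show ?thesis by (simp add: mult_right_mono flip: mult.assoc)
  qed simp
  then show "(wnorm lam n s a)\<^sup>2 \<le> (c * wnorm lam n t a)\<^sup>2"
    unfolding power_mult_distrib wnorm_sq sum_distrib_left by (intro sum_mono) auto
  show "0 \<le> c * wnorm lam n t a" using assms by simp
qed

lemma sum_swap4:
  "(\<Sum>i\<in>A. \<Sum>k\<in>B. \<Sum>j\<in>C. \<Sum>l\<in>E. f i k j l) = (\<Sum>j\<in>C. \<Sum>l\<in>E. \<Sum>i\<in>A. \<Sum>k\<in>B. f i k j l)"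
proof -
  have "(\<Sum>i\<in>A. \<Sum>k\<in>B. \<Sum>j\<in>C. \<Sum>l\<in>E. f i k j l) = (\<Sum>i\<in>A. \<Sum>j\<in>C. \<Sum>k\<in>B. \<Sum>l\<in>E. f i k j l)"
    by (intro sum.cong refl sum.swap)
  also have "\<dots> = (\<Sum>j\<in>C. \<Sum>i\<in>A. \<Sum>k\<in>B. \<Sum>l\<in>E. f i k j l)" by (rule sum.swap)
  also have "\<dots> = (\<Sum>j\<in>C. \<Sum>i\<in>A. \<Sum>l\<in>E. \<Sum>k\<in>B. f i k j l)"
    by (intro sum.cong refl sum.swap)
  also have "\<dots> = (\<Sum>j\<in>C. \<Sum>l\<in>E. \<Sum>i\<in>A. \<Sum>k\<in>B. f i k j l)"
    by (intro sum.cong refl sum.swap)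
  finally show ?thesis .
qed

text \<open>Both arguments are cut into dyadic spectral blocks. On a pair of blocks at levels \<open>j\<close> and \<open>l\<close> the powers of
  \<open>\<lambda>\<close> are comparable to \<open>2^j\<close> and \<open>2^l\<close>. Passing from either of the two given bounds to the intermediate norms
  therefore costs a power of \<open>2\<close>, and the cheaper of the two decays geometrically in
  \<open>|j - l|\<close>. Schur's test sums the blocks without any loss in the exponents. This matters because the
  estimate is applied in a scale-critical situation, where an arbitrarily small loss could not be absorbed.\<close>

theorem bilinear_interpolation:
  fixes lam :: "nat \<Rightarrow> real" and m :: "nat \<Rightarrow> nat \<Rightarrow> real"
  assumes lam: "\<And>k. 0 < lam k" and \<sigma>: "0 < \<sigma>" "\<sigma> < 1/4" and "0 \<le> M"
  defines "\<rho> \<equiv> 2 powr (- min \<sigma> (1/4 - \<sigma>))"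
  assumes b1: "\<And>y w. \<bar>\<Sum>i<n. \<Sum>k<n. m i k * y i * w k\<bar> \<le> M * wnorm lam n (1/4) y * wnorm lam n (1/2) w"
    and b2: "\<And>y w. \<bar>\<Sum>i<n. \<Sum>k<n. m i k * y i * w k\<bar> \<le> M * wnorm lam n (1/2) y * wnorm lam n (1/4) w"
  shows "\<bar>\<Sum>i<n. \<Sum>k<n. m i k * y i * w k\<bar>
     \<le> 4 / (1 - \<rho>) * M * wnorm lam n (1/4 + \<sigma>) y * wnorm lam n (1/2 - \<sigma>) w"
proof -
  define B where "B y w = (\<Sum>i<n. \<Sum>k<n. m i k * y i * w k)" for y w :: "nat \<Rightarrow> real"
  \<comment> \<open>the dyadic block to which \<open>\<lambda>_k\<close> belongs\<close>
  define ix where "ix k = \<lfloor>log 2 (lam k)\<rfloor>" for k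
  define J where "J = ix ` {..<n}"
  define blk where "blk y j k = (if ix k = j then y k else 0)" for y :: "nat \<Rightarrow> real" and j k
  have [simp]: "finite J" by (simp add: J_def)
  have \<rho>: "0 \<le> \<rho>" "\<rho> < 1"
  proof -
    have "0 < min \<sigma> (1/4 - \<sigma>)" using \<sigma> by simp
    then have "2 powr (- min \<sigma> (1/4 - \<sigma>)) < (2::real) powr 0" by (intro powr_less_mono) auto
    then show "0 \<le> \<rho>" "\<rho> < 1" by (auto simp: \<rho>_def)
  qed
  have ix: "2 powr (real_of_int j) \<le> lam k" "lam k \<le> 2 powr (real_of_int j + 1)" if "ix k = j" for k j
  proof -
    have "real_of_int j \<le> log 2 (lam k)" "log 2 (lam k) \<le> real_of_int j + 1"
      using that unfolding ix_def by linarith+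
    then show "2 powr (real_of_int j) \<le> lam k" "lam k \<le> 2 powr (real_of_int j + 1)"
      using lam[of k] by (simp_all add: powr_le_iff le_powr_iff)
  qed
  have up: "wnorm lam n s (blk y j) \<le> 2 powr ((real_of_int j + 1) * (s - t)) * wnorm lam n t (blk y j)"
    if "t \<le> s" for s t y j
  proof (rule wnorm_le)
    fix k assume "blk y j k \<noteq> 0"
    then have "ix k = j" by (auto simp: blk_def split: if_splits)
    have "lam k powr (s - t) \<le> (2 powr (real_of_int j + 1)) powr (s - t)"
      using that ix[OF \<open>ix k = j\<close>] lam[of k] by (intro powr_mono2) auto
    then show "0 < lam k \<and> lam k powr (s - t) \<le> 2 powr ((real_of_int j + 1) * (s - t))"
      using lam by (simp add: powr_powr)
  qed simp
  have down: "wnorm lam n s (blk y j) \<le> 2 powr (real_of_int j * (s - t)) * wnorm lam n t (blk y j)"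
    if "s \<le> t" for s t y j
  proof (rule wnorm_le)
    fix k assume "blk y j k \<noteq> 0"
    then have "ix k = j" by (auto simp: blk_def split: if_splits)
    have "lam k powr (s - t) \<le> (2 powr (real_of_int j)) powr (s - t)"
      using that ix[OF \<open>ix k = j\<close>] lam[of k] by (intro powr_mono2') auto
    then show "0 < lam k \<and> lam k powr (s - t) \<le> 2 powr (real_of_int j * (s - t))"
      using lam by (simp add: powr_powr)
  qed simp
  let ?\<alpha> = "\<lambda>j. wnorm lam n (1/4 + \<sigma>) (blk y j)" and ?\<omega> = "\<lambda>l. wnorm lam n (1/2 - \<sigma>) (blk w l)"
  have block: "\<bar>B (blk y j) (blk w l)\<bar> \<le> 2 * M * (\<rho> ^ nat \<bar>j - l\<bar> * (?\<alpha> j * ?\<omega> l))" for j l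
  proof -
    have decay: "2 powr p * 2 powr q \<le> 2 * \<rho> ^ nat \<bar>j - l\<bar>"
      if "p + q \<le> 1 - min \<sigma> (1/4 - \<sigma>) * real_of_int \<bar>j - l\<bar>" for p q
    proof -
      have "2 powr p * 2 powr q \<le> 2 powr (1 + - min \<sigma> (1/4 - \<sigma>) * real (nat \<bar>j - l\<bar>))"
        unfolding powr_add[symmetric] using that by (intro powr_mono) auto
      also have "\<dots> = 2 * \<rho> ^ nat \<bar>j - l\<bar>"
      proof -
        have "\<rho> ^ N = 2 powr (- min \<sigma> (1/4 - \<sigma>) * real N)" for N
          by (simp add: \<rho>_def powr_power mult.commute)
        then show ?thesis by (simp only: powr_add powr_one)
      qed
      finally show ?thesis .
    qed
    show ?thesis
    proof (cases "l \<le> j")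
      case True
      have "\<bar>B (blk y j) (blk w l)\<bar> \<le> M * wnorm lam n (1/4) (blk y j) * wnorm lam n (1/2) (blk w l)"
        unfolding B_def by (rule b1)
      also have "\<dots> \<le> M * (2 powr (real_of_int j * (1/4 - (1/4 + \<sigma>))) * ?\<alpha> j)
          * (2 powr ((real_of_int l + 1) * (1/2 - (1/2 - \<sigma>))) * ?\<omega> l)"
        using \<sigma> \<open>0 \<le> M\<close> by (intro mult_mono mult_left_mono up down mult_nonneg_nonneg) auto
      also have "\<dots> = M * (?\<alpha> j * ?\<omega> l) * (2 powr (- real_of_int j * \<sigma>) * 2 powr ((real_of_int l + 1) * \<sigma>))"
        by simp
      also have "\<dots> \<le> M * (?\<alpha> j * ?\<omega> l) * (2 * \<rho> ^ nat \<bar>j - l\<bar>)"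
      proof (intro mult_left_mono decay)
        have "min \<sigma> (1/4 - \<sigma>) * real_of_int \<bar>j - l\<bar> \<le> \<sigma> * real_of_int \<bar>j - l\<bar>"
          by (intro mult_right_mono) auto
        then show "- real_of_int j * \<sigma> + (real_of_int l + 1) * \<sigma> \<le> 1 - min \<sigma> (1/4 - \<sigma>) * real_of_int \<bar>j - l\<bar>"
          using True \<sigma> by (simp add: algebra_simps)
      qed (use \<open>0 \<le> M\<close> in auto)
      finally show ?thesis by (simp add: mult_ac)
    next
      case False
      have "\<bar>B (blk y j) (blk w l)\<bar> \<le> M * wnorm lam n (1/2) (blk y j) * wnorm lam n (1/4) (blk w l)"
        unfolding B_def by (rule b2)
      also have "\<dots> \<le> M * (2 powr ((real_of_int j + 1) * (1/2 - (1/4 + \<sigma>))) * ?\<alpha> j)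
          * (2 powr (real_of_int l * (1/4 - (1/2 - \<sigma>))) * ?\<omega> l)"
        using \<sigma> \<open>0 \<le> M\<close> by (intro mult_mono mult_left_mono up down mult_nonneg_nonneg) auto
      also have "\<dots> = M * (?\<alpha> j * ?\<omega> l)
          * (2 powr ((real_of_int j + 1) * (1/2 - (1/4 + \<sigma>))) * 2 powr (real_of_int l * (1/4 - (1/2 - \<sigma>))))"
        by (simp only: mult_ac)
      also have "\<dots> \<le> M * (?\<alpha> j * ?\<omega> l) * (2 * \<rho> ^ nat \<bar>j - l\<bar>)"
      proof (intro mult_left_mono decay)
        have "min \<sigma> (1/4 - \<sigma>) * real_of_int \<bar>j - l\<bar> \<le> (1/4 - \<sigma>) * real_of_int \<bar>j - l\<bar>"
          by (intro mult_right_mono) auto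
        then show "(real_of_int j + 1) * (1/2 - (1/4 + \<sigma>)) + real_of_int l * (1/4 - (1/2 - \<sigma>))
            \<le> 1 - min \<sigma> (1/4 - \<sigma>) * real_of_int \<bar>j - l\<bar>"
          using False \<sigma> by (simp add: algebra_simps add_divide_distrib diff_divide_distrib)
      qed (use \<open>0 \<le> M\<close> in auto)
      finally show ?thesis by (simp add: mult_ac)
    qed
  qed
  have sq: "(\<Sum>j\<in>J. (wnorm lam n s (blk z j))\<^sup>2) = (wnorm lam n s z)\<^sup>2" for s z
  proof -
    have "(\<Sum>j\<in>J. (wnorm lam n s (blk z j))\<^sup>2)
        = (\<Sum>j\<in>J. \<Sum>k\<in>{k \<in> {..<n}. ix k = j}. lam k powr (2 * s) * (z k)\<^sup>2)"
      unfolding wnorm_sq by (intro sum.cong refl sum.mono_neutral_cong_right) (auto simp: blk_def)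
    also have "\<dots> = (wnorm lam n s z)\<^sup>2"
      unfolding wnorm_sq by (rule sum.group) (auto simp: J_def)
    finally show ?thesis .
  qed
  have split: "(\<Sum>j\<in>J. blk z j k) = z k" if "k < n" for z k
    using that by (simp add: blk_def J_def)
  have "B y w = (\<Sum>i<n. \<Sum>k<n. m i k * (\<Sum>j\<in>J. blk y j i) * (\<Sum>l\<in>J. blk w l k))"
    unfolding B_def by (intro sum.cong refl) (simp add: split)
  also have "\<dots> = (\<Sum>i<n. \<Sum>k<n. \<Sum>j\<in>J. \<Sum>l\<in>J. m i k * blk y j i * blk w l k)"
    by (simp only: mult.assoc sum_product) (simp only: sum_distrib_left)
  also have "\<dots> = (\<Sum>j\<in>J. \<Sum>l\<in>J. B (blk y j) (blk w l))"
    unfolding B_def by (rule sum_swap4)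
  finally have "\<bar>B y w\<bar> \<le> (\<Sum>j\<in>J. \<Sum>l\<in>J. \<bar>B (blk y j) (blk w l)\<bar>)"
    by (auto intro!: order.trans[OF sum_abs] sum_mono)
  also have "\<dots> \<le> (\<Sum>j\<in>J. \<Sum>l\<in>J. 2 * M * (\<rho> ^ nat \<bar>j - l\<bar> * (?\<alpha> j * ?\<omega> l)))"
    by (intro sum_mono block)
  also have "\<dots> = 2 * M * (\<Sum>j\<in>J. \<Sum>l\<in>J. \<rho> ^ nat \<bar>j - l\<bar> * (?\<alpha> j * ?\<omega> l))"
    by (simp add: sum_distrib_left)
  also have "\<dots> \<le> 2 * M * (2 / (1 - \<rho>) * (sqrt (\<Sum>j\<in>J. (?\<alpha> j)\<^sup>2) * sqrt (\<Sum>l\<in>J. (?\<omega> l)\<^sup>2)))"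
    using \<open>0 \<le> M\<close> \<rho> by (intro mult_left_mono schur_geometric) auto
  also have "\<dots> = 4 / (1 - \<rho>) * M * wnorm lam n (1/4 + \<sigma>) y * wnorm lam n (1/2 - \<sigma>) w"
    unfolding sq by simp
  finally show ?thesis unfolding B_def .
qed

section \<open>Smooth functions of compact support\<close>

lemma classical_partial_eq: "(f has_derivative f') (at p) \<Longrightarrow> classical_partial i f p = f' (axis i 1)"
  unfolding classical_partial_def by (simp add: frechet_derivative_at[symmetric])

lemma differentiable_imp_has_derivative:
  "f differentiable (at p) \<Longrightarrow> (f has_derivative frechet_derivative f (at p)) (at p)"
  by (simp add: frechet_derivative_works)

lemma C_k_Suc_imp_C_k: "C_k (Suc k) f \<Longrightarrow> C_k k f"
proof (induction k arbitrary: f)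
  case 0
  then show ?case
    by (auto intro!: continuous_at_imp_continuous_on differentiable_imp_continuous_within)
qed simp

lemma C_k_const: "C_k k (\<lambda>_. c)"
proof (induction k arbitrary: c)
  case (Suc k)
  have "classical_partial i (\<lambda>_. c) = (\<lambda>_. 0)" for i
    by (rule ext, subst classical_partial_eq[OF has_derivative_const]) simp
  then show ?case using Suc by simp
qed simp

lemma C_k_add: "C_k k f \<Longrightarrow> C_k k g \<Longrightarrow> C_k k (\<lambda>p. f p + g p)"
proof (induction k arbitrary: f g)
  case (Suc k)
  have "classical_partial i (\<lambda>p. f p + g p) = (\<lambda>p. classical_partial i f p + classical_partial i g p)" for i
  proof
    fix p
    have "((\<lambda>p. f p + g p) has_derivative (\<lambda>v. frechet_derivative f (at p) v + frechet_derivative g (at p) v)) (at p)"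
      using Suc.prems by (intro has_derivative_add differentiable_imp_has_derivative) auto
    then show "classical_partial i (\<lambda>p. f p + g p) p = classical_partial i f p + classical_partial i g p"
      by (subst classical_partial_eq) (auto simp: classical_partial_def)
  qed
  then show ?case using Suc by auto
qed (auto intro: continuous_intros)

lemma classical_partial_bilinear:
  assumes "bounded_bilinear pr" "f differentiable (at p)" "g differentiable (at p)"
  shows "classical_partial i (\<lambda>p. pr (f p) (g p)) p = pr (f p) (classical_partial i g p) + pr (classical_partial i f p) (g p)"
proof -
  have "((\<lambda>p. pr (f p) (g p)) has_derivative
      (\<lambda>v. pr (f p) (frechet_derivative g (at p) v) + pr (frechet_derivative f (at p) v) (g p))) (at p)"
    using assms by (intro bounded_bilinear.FDERIV differentiable_imp_has_derivative)
  then show ?thesis by (subst classical_partial_eq) (auto simp: classical_partial_def)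
qed

text \<open>One induction serves scalar multiples, inner products and products of functions.\<close>

lemma C_k_bilinear:
  assumes pr: "bounded_bilinear pr"
  shows "C_k k f \<Longrightarrow> C_k k g \<Longrightarrow> C_k k (\<lambda>p. pr (f p) (g p))"
proof (induction k arbitrary: f g)
  case 0
  then show ?case by (auto intro: bounded_bilinear.continuous_on[OF pr])
next
  case (Suc k)
  have d: "f differentiable (at p)" "g differentiable (at p)" for p using Suc.prems by auto
  have eq: "classical_partial i (\<lambda>p. pr (f p) (g p))
      = (\<lambda>p. pr (f p) (classical_partial i g p) + pr (classical_partial i f p) (g p))" for i
    by (rule ext) (rule classical_partial_bilinear[OF pr d])
  have "(\<lambda>p. pr (f p) (g p)) differentiable (at p)" for p
    using bounded_bilinear.FDERIV[OF pr differentiable_imp_has_derivative[OF d(1)] differentiable_imp_has_derivative[OF d(2)]]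
    unfolding differentiable_def by blast
  moreover have "C_k k (classical_partial i (\<lambda>p. pr (f p) (g p)))" for i
    unfolding eq using Suc.prems by (intro C_k_add Suc.IH) (auto intro: C_k_Suc_imp_C_k)
  ultimately show ?case by simp
qed

lemma C_k_linear:
  assumes T: "bounded_linear T"
  shows "C_k k f \<Longrightarrow> C_k k (\<lambda>p. T (f p))"
proof (induction k arbitrary: f)
  case 0
  then show ?case by (auto intro: bounded_linear.continuous_on[OF T])
next
  case (Suc k)
  have hd: "((\<lambda>p. T (f p)) has_derivative (\<lambda>v. T (frechet_derivative f (at p) v))) (at p)" for p
    using Suc.prems by (intro bounded_linear.has_derivative[OF T] differentiable_imp_has_derivative) auto
  have "classical_partial i (\<lambda>p. T (f p)) = (\<lambda>p. T (classical_partial i f p))" for i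
    by (rule ext) (simp add: classical_partial_eq[OF hd] classical_partial_def)
  then show ?case using Suc hd by (auto simp: differentiable_def)
qed

lemma C_k_prod: 
  fixes f :: "'i \<Rightarrow> real^2 \<Rightarrow> real"
  assumes "\<And>i. i \<in> I \<Longrightarrow> C_k k (f i)" shows "C_k k (\<lambda>p. \<Prod>i\<in>I. f i p)"
  using assms
  by (induction I rule: infinite_finite_induct)
     (auto intro: C_k_const C_k_bilinear[OF bounded_bilinear_mult])

text \<open>The classical smooth function \<open>exp (-1/x)\<close> that is flat at 0, multiplied by \<open>x^{-m}\<close>. The family
  over all \<open>m\<close> is closed under differentiation up to linear combinations, so a single induction
  yields all derivatives.\<close>

definition flat :: "nat \<Rightarrow> real \<Rightarrow> real" where
  "flat m x = (if 0 < x then inverse x ^ m * exp (- inverse x) else 0)"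

lemma flat_tendsto_0: "(flat m \<longlongrightarrow> 0) (at 0)"
proof -
  have "((\<lambda>y. y ^ m / exp y) \<longlongrightarrow> (0::real)) at_top" by (rule tendsto_power_div_exp_0)
  moreover have "\<forall>\<^sub>F y::real in at_top. y ^ m / exp y = flat m (inverse y)"
    using eventually_gt_at_top[of 0] by eventually_elim (simp add: flat_def exp_minus divide_inverse)
  ultimately have "((\<lambda>y. flat m (inverse y)) \<longlongrightarrow> 0) at_top"
    by (rule Lim_transform_eventually)
  then have "(flat m \<longlongrightarrow> 0) (at_right 0)" by (simp add: filterlim_at_right_to_top)
  moreover have "(flat m \<longlongrightarrow> 0) (at_left 0)"
    by (rule tendsto_eventually) (auto simp: flat_def eventually_at_left_field intro: exI[of _ "-1"])
  ultimately show ?thesis by (simp add: filterlim_split_at)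
qed

lemma flat_has_derivative:
  "(flat m has_real_derivative flat (m + 2) x - real m * flat (m + 1) x) (at x)"
proof -
  consider "x < 0" | "x = 0" | "0 < x" by linarith
  then show ?thesis
  proof cases
    case 1
    have "((\<lambda>_. 0) has_real_derivative 0) (at x)" by simp
    then have "(flat m has_real_derivative 0) (at x)"
      by (rule DERIV_cong_ev[THEN iffD1, rotated -1])
         (use 1 in \<open>auto simp: flat_def intro!: eventually_mono[OF eventually_nhds_in_open[of "{..<0}"]]\<close>)
    then show ?thesis using 1 by (simp add: flat_def)
  next
    case 2
    have "(flat m y - flat m 0) / (y - 0) = flat (m + 1) y" if "y \<noteq> 0" for y
      using that by (simp add: flat_def divide_inverse)
    then have "((\<lambda>y. (flat m y - flat m 0) / (y - 0)) \<longlongrightarrow> 0) (at 0)"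
      by (intro Lim_transform_eventually[OF flat_tendsto_0[of "m + 1"]])
         (auto simp: eventually_at_filter)
    then show ?thesis using 2 by (simp add: has_field_derivative_iff flat_def)
  next
    case 3
    have "((\<lambda>x. inverse x ^ m * exp (- inverse x)) has_real_derivative
        flat (m + 2) x - real m * flat (m + 1) x) (at x)"
      using 3 by (auto intro!: derivative_eq_intros simp: flat_def power2_eq_square field_simps)
         (cases m; simp add: field_simps)
    then show ?thesis
      by (rule DERIV_cong_ev[THEN iffD1, rotated -1])
         (use 3 in \<open>auto simp: flat_def intro!: eventually_mono[OF eventually_nhds_in_open[of "{0<..}"]]\<close>)
  qed
qed

lemma C_k_flat: "C_k k (\<lambda>p::real^2. flat m (c * p $ i + d))"
proof (induction k arbitrary: m)
  case 0
  have "isCont (flat m) x" for x using flat_has_derivative DERIV_isCont by blast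
  then have "continuous_on UNIV (flat m)" by (intro continuous_at_imp_continuous_on) auto
  then have "continuous_on UNIV (\<lambda>p::real^2. flat m (c * p $ i + d))"
    by (rule continuous_on_compose2) (auto intro!: continuous_intros)
  then show ?case by simp
next
  case (Suc k)
  let ?F = "\<lambda>p::real^2. flat m (c * p $ i + d)"
  let ?G = "\<lambda>p::real^2. flat (m + 2) (c * p $ i + d) + (- real m) *\<^sub>R flat (m + 1) (c * p $ i + d)"
  have hd: "(?F has_derivative (\<lambda>v. (c * v $ i) * ?G p)) (at p)" for p
  proof -
    have "((\<lambda>p::real^2. c * p $ i + d) has_derivative (\<lambda>v. c * v $ i)) (at p)"
      by (auto intro!: derivative_eq_intros bounded_linear_imp_has_derivative bounded_linear_vec_nth)
    from DERIV_compose_FDERIV[OF flat_has_derivative this]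
    show ?thesis by simp
  qed
  have "classical_partial j ?F = (\<lambda>p. (c * axis j 1 $ i) *\<^sub>R ?G p)" for j
    by (rule ext) (simp add: classical_partial_eq[OF hd])
  moreover have "C_k k (\<lambda>p. a *\<^sub>R ?G p)" for a
    by (intro C_k_linear[OF bounded_linear_scaleR_right] C_k_add Suc.IH)
  ultimately show ?case using hd by (auto simp: differentiable_def)
qed

lemma classical_partial_zero_outside:
  assumes "closed K" "\<And>p. p \<notin> K \<Longrightarrow> f p = 0" "p \<notin> K"
  shows "classical_partial i f p = 0"
proof -
  have "((\<lambda>_. 0) has_derivative (\<lambda>_. 0)) (at p)" by simp
  then have "(f has_derivative (\<lambda>_. 0)) (at p)"
    by (rule has_derivative_transform_within_open[of _ _ _ _ "- K"]) (use assms in auto)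
  then show ?thesis by (simp add: classical_partial_eq)
qed

lemma test_functionI:
  assumes "\<And>k. C_k k f" "compact K" "K \<subseteq> D" "\<And>p. p \<notin> K \<Longrightarrow> f p = 0"
  shows "test_function D f"
  using assms unfolding test_function_def by blast

lemma test_function_C_k: "test_function D f \<Longrightarrow> C_k k f"
  by (simp add: test_function_def)

lemma test_function_support:
  assumes "test_function D f"
  obtains K where "compact K" "K \<subseteq> D" "\<And>p. p \<notin> K \<Longrightarrow> f p = 0"
  using assms unfolding test_function_def by blast

lemma test_function_zero_outside: "test_function D f \<Longrightarrow> p \<notin> D \<Longrightarrow> f p = 0"
  by (meson test_function_support subsetD)

lemma test_function_differentiable: "test_function D f \<Longrightarrow> f differentiable (at p)"
  using test_function_C_k[of D f "Suc 0"] by simp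

lemma test_function_partial: "test_function D f \<Longrightarrow> test_function D (classical_partial i f)"
proof -
  assume f: "test_function D f"
  then obtain K where K: "compact K" "K \<subseteq> D" "\<And>p. p \<notin> K \<Longrightarrow> f p = 0" by (rule test_function_support) blast
  have "C_k k (classical_partial i f)" for k
    using test_function_C_k[OF f, of "Suc k"] by simp
  then show ?thesis
    by (rule test_functionI[OF _ K(1,2)]) (use K in \<open>auto intro: classical_partial_zero_outside compact_imp_closed\<close>)
qed

lemma test_function_bilinear:
  assumes pr: "bounded_bilinear pr" and f: "test_function D f" and g: "\<And>k. C_k k g"
  shows "test_function D (\<lambda>p. pr (f p) (g p))"
proof -
  obtain K where K: "compact K" "K \<subseteq> D" "\<And>p. p \<notin> K \<Longrightarrow> f p = 0" using f by (rule test_function_support) blast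
  show ?thesis
    by (rule test_functionI[OF _ K(1,2)])
       (use K f g in \<open>auto intro: C_k_bilinear[OF pr] test_function_C_k simp: bounded_bilinear.zero_left[OF pr]\<close>)
qed

lemma test_function_linear:
  assumes T: "bounded_linear T" and f: "test_function D f"
  shows "test_function D (\<lambda>p. T (f p))"
proof -
  obtain K where K: "compact K" "K \<subseteq> D" "\<And>p. p \<notin> K \<Longrightarrow> f p = 0" using f by (rule test_function_support) blast
  show ?thesis
    by (rule test_functionI[OF _ K(1,2)])
       (use K f in \<open>auto intro: C_k_linear[OF T] test_function_C_k simp: linear_0[OF bounded_linear.linear[OF T]]\<close>)
qed

lemma test_function_add:
  assumes "test_function D f" "test_function D g"
  shows "test_function D (\<lambda>p. f p + g p)"
proof -
  obtain K where K: "compact K" "K \<subseteq> D" "\<And>p. p \<notin> K \<Longrightarrow> f p = 0" using assms(1) by (rule test_function_support) blast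
  obtain L where L: "compact L" "L \<subseteq> D" "\<And>p. p \<notin> L \<Longrightarrow> g p = 0" using assms(2) by (rule test_function_support) blast
  show ?thesis
    by (rule test_functionI[of _ "K \<union> L"]) (use K L assms in \<open>auto intro: C_k_add test_function_C_k\<close>)
qed

lemma integrable_compact_support:
  fixes f :: "real^2 \<Rightarrow> 'b::{banach, second_countable_topology}"
  assumes "continuous_on UNIV f" "compact K" "\<And>p. p \<notin> K \<Longrightarrow> f p = 0"
  shows "integrable lborel f"
proof -
  have "integrable lborel (\<lambda>p. indicat_real K p *\<^sub>R f p)"
    using assms(1,2) by (intro borel_integrable_compact) (auto intro: continuous_on_subset)
  also have "(\<lambda>p. indicat_real K p *\<^sub>R f p) = f" using assms(3) by (auto simp: indicator_def)
  finally show ?thesis .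
qed

lemma test_function_continuous: "test_function D f \<Longrightarrow> continuous_on UNIV f"
  using test_function_C_k[of D f 0] by simp

lemma test_function_integrable:
  fixes f :: "real^2 \<Rightarrow> 'b::{banach, second_countable_topology}"
  shows "test_function D f \<Longrightarrow> integrable lborel f"
  by (rule test_function_support[of D f], assumption)
     (rule integrable_compact_support, auto intro: test_function_continuous)

lemma test_function_sq_integrable:
  assumes "test_function D f" shows "sq_integrable f"
proof -
  have "test_function D (\<lambda>p. f p \<bullet> f p)"
    by (rule test_function_bilinear[OF bounded_bilinear_inner assms test_function_C_k[OF assms]])
  from test_function_integrable[OF this]
  have "integrable lborel (\<lambda>p. (norm (f p))\<^sup>2)" by (simp add: power2_norm_eq_inner)
  moreover have "f \<in> borel_measurable lborel"
    using test_function_continuous[OF assms] by (simp add: borel_measurable_continuous_onI)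
  ultimately show ?thesis by (simp add: sq_integrable_def)
qed

text \<open>Translation invariance of Lebesgue measure makes the integrals of all difference quotients vanish. The quotients
  are dominated by a multiple of the indicator of the compact set that the support sweeps out
  under shifts of length at most 1.\<close>

lemma integral_classical_partial:
  fixes f :: "real^2 \<Rightarrow> 'b::{banach, second_countable_topology}"
  assumes f: "test_function D f"
  shows "(LINT p|lborel. classical_partial i f p) = 0"
proof -
  obtain K where K: "compact K" "\<And>p. p \<notin> K \<Longrightarrow> f p = 0" using f by (rule test_function_support) blast
  let ?e = "axis i 1 :: real^2"
  let ?d = "classical_partial i f"
  \<comment> \<open>outside \<open>L\<close> no shift by at most 1 in direction \<open>i\<close> meets the support\<close>
  define L where "L = (\<lambda>(p, t). p - t *\<^sub>R ?e) ` (K \<times> {0..1::real})"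
  have "compact L" unfolding L_def
    by (intro compact_continuous_image compact_Times K) (auto simp: case_prod_unfold intro!: continuous_intros)
  have line: "((\<lambda>t. f (p + t *\<^sub>R ?e)) has_vector_derivative ?d (p + t *\<^sub>R ?e)) (at t within S)" for p t S
  proof -
    have "((\<lambda>t. p + t *\<^sub>R ?e) has_derivative (\<lambda>s. s *\<^sub>R ?e)) (at t within S)"
      by (auto intro!: derivative_eq_intros)
    moreover have hd: "(f has_derivative frechet_derivative f (at (p + t *\<^sub>R ?e))) (at (p + t *\<^sub>R ?e))"
      by (intro differentiable_imp_has_derivative test_function_differentiable[OF f])
    ultimately have "((\<lambda>t. f (p + t *\<^sub>R ?e)) has_derivative (\<lambda>s. frechet_derivative f (at (p + t *\<^sub>R ?e)) (s *\<^sub>R ?e))) (at t within S)"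
      by (rule has_derivative_compose)
    then show ?thesis
      unfolding has_vector_derivative_def classical_partial_def
      by (simp add: linear_cmul[OF has_derivative_linear[OF hd]])
  qed
  have dtest: "test_function D ?d" by (rule test_function_partial[OF f])
  then obtain K' where K': "compact K'" "\<And>p. p \<notin> K' \<Longrightarrow> ?d p = 0" by (rule test_function_support) blast
  have "bounded (?d ` K')"
    by (intro compact_imp_bounded compact_continuous_image K' continuous_on_subset[OF test_function_continuous[OF dtest]]) auto
  then obtain M where M: "0 < M" "\<And>p. p \<in> K' \<Longrightarrow> norm (?d p) \<le> M" unfolding bounded_pos by auto
  then have M': "norm (?d p) \<le> M" for p using K'(2)[of p] by (cases "p \<in> K'") auto
  define h where "h n = inverse (real (Suc n))" for n
  have h: "0 < h n" "h n \<le> 1" "h \<longlonglongrightarrow> 0" for n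
    unfolding h_def using LIMSEQ_inverse_real_of_nat by (auto simp: field_simps)
  let ?q = "\<lambda>n p. (1 / h n) *\<^sub>R (f (p + h n *\<^sub>R ?e) - f p)"
  have cont: "continuous_on UNIV f" by (rule test_function_continuous[OF f])
  then have [measurable]: "f \<in> borel_measurable borel" by (simp add: borel_measurable_continuous_onI)
  have [measurable]: "?d \<in> borel_measurable borel"
    using test_function_continuous[OF dtest] by (simp add: borel_measurable_continuous_onI)
  have int: "integrable lborel f" by (rule test_function_integrable[OF f])
  have shift: "integrable lborel (\<lambda>p. f (p + c)) \<and> (LINT p|lborel. f (p + c)) = (LINT p|lborel. f p)" for c
  proof -
    have "integrable (distr lborel borel ((+) c)) f" "(LINT p|distr lborel borel ((+) c). f p) = (LINT p|lborel. f p)"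
      using int by (simp_all add: lborel_distr_plus)
    then show ?thesis by (simp add: integrable_distr_eq integral_distr add.commute)
  qed
  have "(LINT p|lborel. ?q n p) = 0" for n
    using shift[of "h n *\<^sub>R ?e"] int by simp
  moreover have "(\<lambda>n. LINT p|lborel. ?q n p) \<longlonglongrightarrow> (LINT p|lborel. ?d p)"
  proof (rule integral_dominated_convergence)
    show "integrable lborel (\<lambda>p. M * indicat_real L p)"
      using borel_integrable_compact[OF \<open>compact L\<close>, of "\<lambda>_. M"] by (simp add: mult.commute)
    show "AE p in lborel. (\<lambda>n. ?q n p) \<longlonglongrightarrow> ?d p"
    proof (rule AE_I2)
      fix p
      have "((\<lambda>t. norm (f (p + t *\<^sub>R ?e) - f p - t *\<^sub>R ?d p) / norm t) \<longlongrightarrow> 0) (at 0)"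
        using line[of p 0 UNIV] unfolding has_vector_derivative_def has_derivative_iff_norm by simp
      then have "(\<lambda>n. norm (f (p + h n *\<^sub>R ?e) - f p - h n *\<^sub>R ?d p) / norm (h n)) \<longlonglongrightarrow> 0"
        by (rule filterlim_compose) (use h(3) less_imp_neq[OF h(1), symmetric] in \<open>auto simp: filterlim_at\<close>)
      also have "(\<lambda>n. norm (f (p + h n *\<^sub>R ?e) - f p - h n *\<^sub>R ?d p) / norm (h n)) = (\<lambda>n. norm (?q n p - ?d p))"
      proof
        fix n
        have "?q n p - ?d p = (1 / h n) *\<^sub>R (f (p + h n *\<^sub>R ?e) - f p - h n *\<^sub>R ?d p)"
          using h(1)[of n] by (simp add: scaleR_diff_right)
        then show "norm (f (p + h n *\<^sub>R ?e) - f p - h n *\<^sub>R ?d p) / norm (h n) = norm (?q n p - ?d p)"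
          using h(1)[of n] by simp
      qed
      finally show "(\<lambda>n. ?q n p) \<longlonglongrightarrow> ?d p"
        by (simp add: LIM_zero_cancel tendsto_norm_zero_iff)
    qed
    show "AE p in lborel. norm (?q n p) \<le> M * indicat_real L p" for n
    proof (rule AE_I2)
      fix p
      show "norm (?q n p) \<le> M * indicat_real L p"
      proof (cases "p \<in> L")
        case True
        have "norm (f (p + h n *\<^sub>R ?e) - f (p + 0 *\<^sub>R ?e)) \<le> M * norm (h n - 0)"
          by (rule differentiable_bound[OF _ line[unfolded has_vector_derivative_def], of UNIV])
             (auto intro!: onorm_le mult_left_mono simp: M' mult.commute[of M])
        then show ?thesis using True h(1)[of n] unfolding norm_scaleR by (simp add: field_simps)
      next
        case False
        have "p + t *\<^sub>R ?e \<notin> K" if "0 \<le> t" "t \<le> 1" for t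
        proof
          assume "p + t *\<^sub>R ?e \<in> K"
          then have "(\<lambda>(p, t). p - t *\<^sub>R ?e) (p + t *\<^sub>R ?e, t) \<in> L"
            unfolding L_def using that by (intro imageI) auto
          then show False using False by simp
        qed
        from K(2)[OF this[of 0]] K(2)[OF this[of "h n"]] show ?thesis
          using False h(1,2)[of n] by (simp add: less_imp_le)
      qed
    qed
  qed auto
  ultimately have "(\<lambda>n. 0) \<longlonglongrightarrow> (LINT p|lborel. ?d p)" by (simp only:)
  then show ?thesis by (simp add: LIMSEQ_const_iff)
qed

section \<open>Test functions determine square-integrable fields\<close>

lemma sq_integrable_scaleR_fun:
  fixes \<phi> :: "real^2 \<Rightarrow> real"
  assumes g: "sq_integrable g" and [measurable]: "\<phi> \<in> borel_measurable borel"
    and i: "integrable lborel (\<lambda>p. (\<phi> p)\<^sup>2)"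
  shows "integrable lborel (\<lambda>p. \<phi> p *\<^sub>R g p)"
proof (rule Bochner_Integration.integrable_bound)
  have [measurable]: "g \<in> borel_measurable borel" using g by (simp add: sq_integrable_def)
  show "integrable lborel (\<lambda>p. (\<phi> p)\<^sup>2 + (norm (g p))\<^sup>2)"
    using i g by (simp add: sq_integrable_def)
  show "(\<lambda>p. \<phi> p *\<^sub>R g p) \<in> borel_measurable lborel" by measurable
  show "AE p in lborel. norm (\<phi> p *\<^sub>R g p) \<le> norm ((\<phi> p)\<^sup>2 + (norm (g p))\<^sup>2)"
  proof (rule AE_I2)
    fix p
    have "0 \<le> (\<bar>\<phi> p\<bar> - norm (g p))\<^sup>2" "0 \<le> \<bar>\<phi> p\<bar> * norm (g p)" by auto
    then have "\<bar>\<phi> p\<bar> * norm (g p) \<le> (\<phi> p)\<^sup>2 + (norm (g p))\<^sup>2"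
      unfolding power2_diff power2_abs by linarith
    then show "norm (\<phi> p *\<^sub>R g p) \<le> norm ((\<phi> p)\<^sup>2 + (norm (g p))\<^sup>2)" by simp
  qed
qed

lemma test_function_power2_integrable:
  fixes \<phi> :: "real^2 \<Rightarrow> real"
  assumes "test_function D \<phi>" shows "integrable lborel (\<lambda>p. (\<phi> p)\<^sup>2)"
  using test_function_integrable[OF test_function_bilinear[OF bounded_bilinear_mult assms test_function_C_k[OF assms]]]
  by (simp add: power2_eq_square)

lemma test_function_scaleR_integrable:
  fixes \<phi> :: "real^2 \<Rightarrow> real"
  assumes "sq_integrable g" "test_function D \<phi>"
  shows "integrable lborel (\<lambda>p. \<phi> p *\<^sub>R g p)"
  using assms test_function_continuous[OF assms(2)]
  by (intro sq_integrable_scaleR_fun test_function_power2_integrable) (auto intro: borel_measurable_continuous_onI)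

lemma set_integral_test:
  fixes \<phi> :: "real^2 \<Rightarrow> real"
  assumes "test_function D \<phi>"
  shows "(LINT p:D|lborel. \<phi> p *\<^sub>R g p) = (LINT p|lborel. \<phi> p *\<^sub>R g p)"
proof -
  have "indicat_real D p *\<^sub>R (\<phi> p *\<^sub>R g p) = \<phi> p *\<^sub>R g p" for p
    by (cases "p \<in> D") (simp_all add: test_function_zero_outside[OF assms])
  then show ?thesis by (simp only: set_lebesgue_integral_def)
qed

text \<open>A smooth function with values in \<open>[0,1)\<close> that is positive exactly on the open box. Writing
  the arguments as affine functions \<open>c * x + d\<close> matches \<open>C_k_flat\<close>.\<close>

definition box_bump :: "real^2 \<Rightarrow> real^2 \<Rightarrow> real^2 \<Rightarrow> real" where
  "box_bump a b p = (\<Prod>i\<in>UNIV. flat 0 (1 * p $ i + (- a $ i)) * flat 0 ((-1) * p $ i + b $ i))"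

lemma flat_0_bounds: "0 \<le> flat 0 x" "flat 0 x < 1" "0 < flat 0 x \<longleftrightarrow> 0 < x"
  by (auto simp: flat_def)

lemma C_k_box_bump: "C_k k (box_bump a b)"
  unfolding box_bump_def[abs_def]
  by (intro C_k_prod C_k_bilinear[OF bounded_bilinear_mult] C_k_flat)

lemma box_bump_bounds: "0 \<le> box_bump a b p" "box_bump a b p < 1"
proof -
  show "0 \<le> box_bump a b p" unfolding box_bump_def
    by (intro prod_nonneg mult_nonneg_nonneg flat_0_bounds)
  have *: "flat 0 x * flat 0 y < 1 \<and> 0 \<le> flat 0 x * flat 0 y" for x y
    using mult_strict_mono[of "flat 0 x" 1 "flat 0 y" 1] flat_0_bounds[of x] flat_0_bounds[of y] by auto
  show "box_bump a b p < 1" unfolding box_bump_def UNIV_2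
    using mult_strict_mono[OF *[THEN conjunct1] *[THEN conjunct1] zero_less_one] * by (simp add: mult_strict_mono)
qed

lemma box_bump_pos_iff: "0 < box_bump a b p \<longleftrightarrow> p \<in> box a b"
proof -
  have "0 < box_bump a b p \<longleftrightarrow> (\<forall>i. 0 < flat 0 (1 * p $ i + (- a $ i)) * flat 0 ((-1) * p $ i + b $ i))"
    unfolding box_bump_def
    using prod_pos[of UNIV "\<lambda>i. flat 0 (1 * p $ i + (- a $ i)) * flat 0 ((-1) * p $ i + b $ i)"]
    by (auto simp: less_le prod_nonneg flat_0_bounds)
  also have "\<dots> \<longleftrightarrow> (\<forall>i. 0 < flat 0 (1 * p $ i + (- a $ i)) \<and> 0 < flat 0 ((-1) * p $ i + b $ i))"
    using flat_0_bounds(1) by (metis mult_pos_pos mult_zero_left mult_zero_right order_le_less)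
  also have "\<dots> \<longleftrightarrow> p \<in> box a b"
    unfolding flat_0_bounds(3) by (auto simp: mem_box_cart)
  finally show ?thesis .
qed

text \<open>The test functions \<open>1 - (1 - \<psi>)^m\<close>, with \<open>\<psi>\<close> the bump of the box, increase to the indicator
  function of the box.\<close>

lemma box_integral_zero:
  assumes g: "sq_integrable g"
    and ortho: "\<And>\<phi> :: real^2 \<Rightarrow> real. test_function D \<phi> \<Longrightarrow> (LINT p|lborel. \<phi> p *\<^sub>R g p) = 0"
    and ab: "cbox a b \<subseteq> D"
  shows "(LINT p:box a b|lborel. g p) = 0"
proof -
  define \<phi> where "\<phi> m p = 1 - (1 - box_bump a b p) ^ m" for m p
  have zero: "\<phi> m p = 0" if "p \<notin> box a b" for m p
    using that box_bump_pos_iff[of a b p] box_bump_bounds(1)[of a b p] by (auto simp: \<phi>_def)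
  have pow: "C_k k (\<lambda>p. (1 + (-1) *\<^sub>R box_bump a b p) ^ m)" for k m
  proof (induction m)
    case (Suc m)
    show ?case unfolding power_Suc
      by (intro C_k_bilinear[OF bounded_bilinear_mult] Suc.IH C_k_add C_k_const
          C_k_linear[OF bounded_linear_scaleR_right] C_k_box_bump)
  qed (simp add: C_k_const)
  have "C_k k (\<lambda>p. 1 + (-1) *\<^sub>R ((1 + (-1) *\<^sub>R box_bump a b p) ^ m))" for k m
    by (intro C_k_add C_k_const C_k_linear[OF bounded_linear_scaleR_right] pow)
  then have C: "C_k k (\<phi> m)" for k m by (simp add: \<phi>_def[abs_def])
  have test: "test_function D (\<phi> m)" for m
    by (rule test_functionI[OF C compact_cbox ab]) (use zero box_subset_cbox in blast)
  have [measurable]: "g \<in> borel_measurable borel" using g by (simp add: sq_integrable_def)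
  have [measurable]: "\<phi> m \<in> borel_measurable borel" for m
    using C[of 0 m] by (auto intro: borel_measurable_continuous_onI)
  have bounds: "0 \<le> \<phi> m p" "\<phi> m p \<le> 1" for m p
    unfolding \<phi>_def using box_bump_bounds[of a b p] by (auto intro: power_le_one)
  have "(\<lambda>m. LINT p|lborel. \<phi> m p *\<^sub>R g p) \<longlonglongrightarrow> (LINT p|lborel. indicat_real (box a b) p *\<^sub>R g p)"
  proof (rule integral_dominated_convergence)
    have "integrable lborel (\<lambda>p. indicat_real (box a b) p *\<^sub>R g p)"
    proof (rule sq_integrable_scaleR_fun[OF g])
      have "(\<lambda>p. (indicat_real (box a b) p)\<^sup>2) = indicat_real (box a b)" by (auto simp: indicator_def)
      then show "integrable lborel (\<lambda>p. (indicat_real (box a b) p)\<^sup>2)"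
        by (simp add: emeasure_lborel_box_eq)
    qed auto
    then show "integrable lborel (\<lambda>p. norm (indicat_real (box a b) p *\<^sub>R g p))" by (rule integrable_norm)
    show "AE p in lborel. (\<lambda>m. \<phi> m p *\<^sub>R g p) \<longlonglongrightarrow> indicat_real (box a b) p *\<^sub>R g p"
    proof (rule AE_I2)
      fix p
      have "(\<lambda>m. \<phi> m p) \<longlonglongrightarrow> indicat_real (box a b) p"
      proof (cases "p \<in> box a b")
        case True
        have "(\<lambda>m. 1 - (1 - box_bump a b p) ^ m) \<longlonglongrightarrow> 1 - 0"
          by (intro tendsto_intros LIMSEQ_realpow_zero)
             (use True box_bump_pos_iff[of a b p] box_bump_bounds[of a b p] in auto)
        then show ?thesis using True by (simp add: \<phi>_def)
      qed (simp add: zero)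
      then show "(\<lambda>m. \<phi> m p *\<^sub>R g p) \<longlonglongrightarrow> indicat_real (box a b) p *\<^sub>R g p"
        by (intro tendsto_intros)
    qed
    show "AE p in lborel. norm (\<phi> m p *\<^sub>R g p) \<le> norm (indicat_real (box a b) p *\<^sub>R g p)" for m
      by (rule AE_I2) (use bounds zero in \<open>auto simp: indicator_def intro!: mult_left_le_one_le\<close>)
  qed auto
  moreover have "(LINT p|lborel. \<phi> m p *\<^sub>R g p) = 0" for m by (rule ortho[OF test])
  ultimately show ?thesis
    unfolding set_lebesgue_integral_def by (simp add: LIMSEQ_const_iff)
qed

text \<open>Boxes form an intersection-stable generator of the Borel sets, and the sets on which the
  integral of \<open>f\<close> vanishes form a Dynkin system.\<close>

lemma AE_zero_if_box_integrals_zero: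
  fixes f :: "real^2 \<Rightarrow> 'b::{banach, second_countable_topology}"
  assumes f: "integrable lborel f" and total: "(LINT p|lborel. f p) = 0"
    and boxes: "\<And>a b. (LINT p:box a b|lborel. f p) = 0"
  shows "AE p in lborel. f p = 0"
proof (rule sigma_finite_measure.density_unique_banach[OF sigma_finite_lborel f])
  have int: "set_integrable lborel S f" if "S \<in> sets borel" for S
    using integrable_mult_indicator[of S lborel f] f that by (simp add: set_integrable_def)
  fix S :: "(real^2) set" assume "S \<in> sets lborel"
  then have S: "S \<in> sigma_sets UNIV (range (\<lambda>(a, b). box a b))"
    by (simp add: borel_eq_box)
  have "Int_stable (range (\<lambda>(a, b). box a b :: (real^2) set))"
    by (auto simp: Int_stable_def box_Int_box)
  moreover have "range (\<lambda>(a, b). box a b :: (real^2) set) \<subseteq> Pow UNIV" by simp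
  ultimately have "(LINT p:S|lborel. f p) = 0" using S
  proof (induction rule: sigma_sets_induct_disjoint)
    case (basic A)
    then show ?case using boxes by auto
  next
    case empty
    show ?case by (simp add: set_lebesgue_integral_def)
  next
    case (compl A)
    then have A: "A \<in> sets borel" by (simp add: borel_eq_box)
    have "(LINT p:A \<union> (UNIV - A)|lborel. f p) = (LINT p:A|lborel. f p) + (LINT p:UNIV - A|lborel. f p)"
      by (rule set_integral_Un) (use A int in auto)
    then show ?case using compl total by (simp add: set_lebesgue_integral_def)
  next
    case (union A)
    then have A: "A i \<in> sets borel" for i by (auto simp: borel_eq_box)
    have "(LINT p:(\<Union>i. A i)|lborel. f p) = (\<Sum>i. LINT p:A i|lborel. f p)"
      by (rule lebesgue_integral_countable_add)
         (use A int union in \<open>auto simp: disjoint_family_on_def\<close>)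
    then show ?case using union by simp
  qed
  then show "(LINT p:S|lborel. f p) = (LINT p:S|lborel. 0)" by (simp add: set_lebesgue_integral_def)
qed simp

text \<open>The fundamental lemma of the calculus of variations. It makes weak derivatives unique, so that
  the descriptions by \<open>THE\<close> denote what they should.\<close>

lemma AE_zero_if_orthogonal_to_tests:
  assumes "open D" and g: "sq_integrable g"
    and ortho: "\<And>\<phi> :: real^2 \<Rightarrow> real. test_function D \<phi> \<Longrightarrow> (LINT p|lborel. \<phi> p *\<^sub>R g p) = 0"
  shows "AE p in lborel. p \<in> D \<longrightarrow> g p = 0"
proof -
  have [measurable]: "g \<in> borel_measurable borel" using g by (simp add: sq_integrable_def)
  have cube: "AE p in lborel. p \<in> cbox c d \<longrightarrow> g p = 0" if cd: "cbox c d \<subseteq> D" for c d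
  proof -
    \<comment> \<open>Inside an open box with closure in \<open>D\<close> every sub-box is admissible.\<close>
    let ?f = "\<lambda>p. indicat_real (box c d) p *\<^sub>R g p"
    have sub: "(LINT p:box a b|lborel. ?f p) = 0" for a b
    proof -
      obtain a' b' where ab': "box a b \<inter> box c d = box a' b'" using box_Int_box by blast
      obtain a'' b'' where ab'': "box a' b' = box a'' b''" "cbox a'' b'' \<subseteq> D"
      proof (cases "box a' b' = {}")
        case True
        moreover have "box (1::real^2) 0 = {} \<and> cbox (1::real^2) 0 = {}" by (auto simp: interval_eq_empty_cart)
        ultimately show ?thesis using that[of 1 0] by simp
      next
        case False
        then have "cbox a' b' \<subseteq> cbox c d"
          using ab' by (metis Int_lower2 box_subset_cbox closure_box closure_minimal closed_cbox order.trans)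
        then show ?thesis using that[of a' b'] cd by auto
      qed
      have "(LINT p:box a b|lborel. ?f p) = (LINT p:box a b \<inter> box c d|lborel. g p)"
        unfolding set_lebesgue_integral_def
        by (intro Bochner_Integration.integral_cong refl) (auto simp: indicator_def)
      also have "\<dots> = 0" unfolding ab' ab''(1) by (rule box_integral_zero[OF g ortho ab''(2)])
      finally show ?thesis .
    qed
    have "integrable lborel ?f"
    proof (rule sq_integrable_scaleR_fun[OF g])
      have "(\<lambda>p. (indicat_real (box c d) p)\<^sup>2) = indicat_real (box c d)" by (auto simp: indicator_def)
      then show "integrable lborel (\<lambda>p. (indicat_real (box c d) p)\<^sup>2)"
        by (simp add: emeasure_lborel_box_eq)
    qed auto
    moreover have "(LINT p|lborel. ?f p) = 0"
      using box_integral_zero[OF g ortho cd] by (simp add: set_lebesgue_integral_def)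
    ultimately have "AE p in lborel. ?f p = 0"
      using sub by (rule AE_zero_if_box_integrals_zero)
    moreover have "AE p in lborel. p \<notin> cbox c d - box c d"
    proof (rule AE_not_in)
      have "negligible (cbox c d - box c d)" by (rule negligible_frontier_interval)
      then show "cbox c d - box c d \<in> null_sets lborel"
        by (simp add: negligible_iff_null_sets null_sets_completion_iff)
    qed
    ultimately show ?thesis by eventually_elim (auto simp: indicator_def split: if_splits)
  qed
  obtain \<D> where \<D>: "countable \<D>" "\<And>X. X \<in> \<D> \<Longrightarrow> \<exists>a b. X = cbox a b" "\<Union>\<D> = D"
    using open_countable_Union_open_cbox[OF \<open>open D\<close>] by metis
  have "AE p in lborel. p \<in> X \<longrightarrow> g p = 0" if X: "X \<in> \<D>" for X
    using \<D>(2)[OF X] X \<D>(3) cube by blast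
  then have "AE p in lborel. \<forall>X\<in>\<D>. p \<in> X \<longrightarrow> g p = 0"
    by (intro AE_ball_countable[THEN iffD2, OF \<D>(1)] ballI)
  then show ?thesis by eventually_elim (use \<D>(3) in auto)
qed

section \<open>Weak derivatives and solenoidal test fields\<close>

lemma test_function_rep_integrable:
  fixes \<phi> :: "real^2 \<Rightarrow> real"
  assumes "test_function D \<phi>"
  shows "integrable lborel (\<lambda>p. \<phi> p *\<^sub>R rep_L2field u p)"
  by (rule test_function_scaleR_integrable[OF sq_integrable_rep assms])

text \<open>A field in \<open>L^2\<close> is determined on \<open>D\<close> by these vectors, and weak derivatives become linear
  identities between them.\<close>

definition pairing :: "(real^2 \<Rightarrow> real) \<Rightarrow> L2field \<Rightarrow> real^2" where
  "pairing \<phi> u = (LINT p|lborel. \<phi> p *\<^sub>R rep_L2field u p)"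

lemma is_weak_partial_iff:
  "is_weak_partial D i u g \<longleftrightarrow>
     (\<forall>\<phi>. test_function D \<phi> \<longrightarrow> pairing (classical_partial i \<phi>) u = - pairing \<phi> g)"
  by (simp add: is_weak_partial_def pairing_def set_integral_test test_function_partial)

lemma pairing_linear:
  assumes "test_function D \<phi>"
  shows "pairing \<phi> (u + v) = pairing \<phi> u + pairing \<phi> v"
    and "pairing \<phi> (c *\<^sub>R u) = c *\<^sub>R pairing \<phi> u"
proof -
  have [measurable]: "\<phi> \<in> borel_measurable borel"
    using test_function_continuous[OF assms] by (rule borel_measurable_continuous_onI)
  have "pairing \<phi> (u + v) = (LINT p|lborel. \<phi> p *\<^sub>R rep_L2field u p + \<phi> p *\<^sub>R rep_L2field v p)"
    unfolding pairing_def
    by (intro integral_cong_AE; (measurable)?)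
       (use AE_rep_add[of u v] in eventually_elim, simp add: scaleR_add_right)
  then show "pairing \<phi> (u + v) = pairing \<phi> u + pairing \<phi> v"
    by (simp add: pairing_def test_function_rep_integrable[OF assms])
  have "pairing \<phi> (c *\<^sub>R u) = (LINT p|lborel. c *\<^sub>R (\<phi> p *\<^sub>R rep_L2field u p))"
    unfolding pairing_def
    by (intro integral_cong_AE; (measurable)?)
       (use AE_rep_scaleR[of c u] in eventually_elim, simp)
  then show "pairing \<phi> (c *\<^sub>R u) = c *\<^sub>R pairing \<phi> u"
    using integral_scaleR_right[where c = c and M = lborel and f = "\<lambda>p. \<phi> p *\<^sub>R rep_L2field u p"] test_function_rep_integrable[OF assms]
    by (simp only: pairing_def)
qed

lemma pairing_abs:
  assumes "test_function D \<phi>" "sq_integrable f"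
  shows "pairing \<phi> (abs_L2field f) = (LINT p|lborel. \<phi> p *\<^sub>R f p)"
proof -
  have [measurable]: "\<phi> \<in> borel_measurable borel" "f \<in> borel_measurable borel"
    using test_function_continuous[OF assms(1)] assms(2)
    by (auto intro: borel_measurable_continuous_onI simp: sq_integrable_def)
  show ?thesis unfolding pairing_def
    by (intro integral_cong_AE; (measurable)?)
       (use AE_rep_abs[OF assms(2)] in eventually_elim, simp)
qed

lemma L2_on_subspace: "subspace (L2_on D)"
proof (rule subspaceI)
  show "0 \<in> L2_on D" unfolding L2_on_def mem_Collect_eq
    using AE_rep_abs[OF sq_integrable_zero] unfolding zero_L2field_def by eventually_elim simp
  show "u + v \<in> L2_on D" if "u \<in> L2_on D" "v \<in> L2_on D" for u v
    using that AE_rep_add[of u v] unfolding L2_on_def mem_Collect_eq by eventually_elim simp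
  show "c *\<^sub>R u \<in> L2_on D" if "u \<in> L2_on D" for u c
    using that AE_rep_scaleR[of c u] unfolding L2_on_def mem_Collect_eq by eventually_elim simp
qed

lemma L2_on_eqI:
  assumes "open D" "u \<in> L2_on D" "v \<in> L2_on D"
    and eq: "\<And>\<phi> :: real^2 \<Rightarrow> real. test_function D \<phi> \<Longrightarrow> pairing \<phi> u = pairing \<phi> v"
  shows "u = v"
proof (rule L2field_eqI)
  let ?w = "u + (-1) *\<^sub>R v"
  have "AE p in lborel. p \<in> D \<longrightarrow> rep_L2field ?w p = 0"
    by (rule AE_zero_if_orthogonal_to_tests[OF \<open>open D\<close> sq_integrable_rep])
       (simp only: pairing_def[symmetric] pairing_linear, simp add: eq)
  moreover have "AE p in lborel. p \<notin> D \<longrightarrow> rep_L2field u p = 0" "AE p in lborel. p \<notin> D \<longrightarrow> rep_L2field v p = 0"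
    using assms by (auto simp: L2_on_def)
  moreover note AE_rep_add[of u "(-1) *\<^sub>R v"] AE_rep_scaleR[of "-1" v]
  ultimately show "AE p in lborel. rep_L2field u p = rep_L2field v p"
    by eventually_elim auto
qed

lemma weak_partial_eqI:
  assumes "open D" "g \<in> L2_on D" "is_weak_partial D i u g"
  shows "weak_partial D i u = g"
  unfolding weak_partial_def
proof (rule the_equality)
  fix h assume h: "h \<in> L2_on D \<and> is_weak_partial D i u h"
  show "h = g"
  proof (rule L2_on_eqI[OF \<open>open D\<close>])
    fix \<phi> :: "real^2 \<Rightarrow> real" assume "test_function D \<phi>"
    then have "- pairing \<phi> h = - pairing \<phi> g"
      using h assms(3) unfolding is_weak_partial_iff by metis
    then show "pairing \<phi> h = pairing \<phi> g" by simp
  qed (use h assms in auto)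
qed (use assms in auto)

lemma weak_partial_H1:
  assumes "open D" "u \<in> H1 D"
  shows "weak_partial D i u \<in> L2_on D" "is_weak_partial D i u (weak_partial D i u)"
proof -
  obtain g where g: "g \<in> L2_on D" "is_weak_partial D i u g" using assms(2) by (auto simp: H1_def)
  then show "weak_partial D i u \<in> L2_on D" "is_weak_partial D i u (weak_partial D i u)"
    using weak_partial_eqI[OF \<open>open D\<close> g] by auto
qed

lemma H1_linear:
  assumes D: "open D" and u: "u \<in> H1 D" and v: "v \<in> H1 D"
  shows "u + v \<in> H1 D" "weak_partial D i (u + v) = weak_partial D i u + weak_partial D i v"
    and "c *\<^sub>R u \<in> H1 D" "weak_partial D i (c *\<^sub>R u) = c *\<^sub>R weak_partial D i u"
proof -
  note wu = weak_partial_H1[OF D u] and wv = weak_partial_H1[OF D v]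
  have a: "weak_partial D i u + weak_partial D i v \<in> L2_on D"
    "is_weak_partial D i (u + v) (weak_partial D i u + weak_partial D i v)" for i
    using wu wv subspace_add[OF L2_on_subspace]
    by (auto simp: is_weak_partial_iff pairing_linear[OF test_function_partial] pairing_linear)
  have b: "c *\<^sub>R weak_partial D i u \<in> L2_on D" "is_weak_partial D i (c *\<^sub>R u) (c *\<^sub>R weak_partial D i u)" for i
    using wu subspace_scale[OF L2_on_subspace]
    by (auto simp: is_weak_partial_iff pairing_linear[OF test_function_partial] pairing_linear)
  show "u + v \<in> H1 D" "c *\<^sub>R u \<in> H1 D"
    using a b u v subspace_add[OF L2_on_subspace] subspace_scale[OF L2_on_subspace]
    unfolding H1_def by blast+
  show "weak_partial D i (u + v) = weak_partial D i u + weak_partial D i v"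
    "weak_partial D i (c *\<^sub>R u) = c *\<^sub>R weak_partial D i u"
    by (intro weak_partial_eqI D a b)+
qed

lemma H1_diff:
  assumes D: "open D" and u: "u \<in> H1 D" and v: "v \<in> H1 D"
  shows "u - v \<in> H1 D" "weak_partial D i (u - v) = weak_partial D i u - weak_partial D i v"
  using H1_linear(1,2)[OF D u, of "(-1) *\<^sub>R v"] H1_linear(3)[OF D v v, of "-1"]
    H1_linear(4)[OF D v v, where c = "-1" and i = i] by auto

lemma V_norm_L2: "V_norm D u = L2_set (\<lambda>j. norm (weak_partial D j u)) UNIV"
  by (simp add: V_norm_def L2_set_def)

lemma V_norm_triangle:
  assumes D: "open D" and u: "u \<in> H1 D" and v: "v \<in> H1 D"
  shows "V_norm D (u + v) \<le> V_norm D u + V_norm D v"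
proof -
  have "V_norm D (u + v) \<le> L2_set (\<lambda>j. norm (weak_partial D j u) + norm (weak_partial D j v)) UNIV"
    unfolding V_norm_L2 H1_linear(2)[OF D u v] by (intro L2_set_mono norm_triangle_ineq) auto
  also have "\<dots> \<le> V_norm D u + V_norm D v"
    unfolding V_norm_L2 by (rule L2_set_triangle_ineq)
  finally show ?thesis .
qed

lemma V_norm_le_H1_norm: "V_norm D u \<le> H1_norm D u" and norm_le_H1_norm: "norm u \<le> H1_norm D u"
proof -
  show "V_norm D u \<le> H1_norm D u" by (simp add: V_norm_def H1_norm_def)
  have "norm u = sqrt ((norm u)\<^sup>2)" by simp
  also have "\<dots> \<le> H1_norm D u" unfolding H1_norm_def by (intro real_sqrt_le_mono) (simp add: sum_nonneg)
  finally show "norm u \<le> H1_norm D u" .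
qed

lemma test_class_L2_on: "test_function D f \<Longrightarrow> abs_L2field f \<in> L2_on D"
  unfolding L2_on_def mem_Collect_eq
  using AE_rep_abs[OF test_function_sq_integrable]
  by (rule AE_mp) (auto simp: test_function_zero_outside)

lemma integration_by_parts:
  fixes f :: "real^2 \<Rightarrow> 'a::real_normed_vector" and g :: "real^2 \<Rightarrow> 'b::real_normed_vector"
    and pr :: "'a \<Rightarrow> 'b \<Rightarrow> 'c::{banach, second_countable_topology}"
  assumes pr: "bounded_bilinear pr" and f: "test_function D f" and g: "\<And>k. C_k k g"
  shows "(LINT p|lborel. pr (classical_partial i f p) (g p)) = - (LINT p|lborel. pr (f p) (classical_partial i g p))"
proof -
  have g': "C_k k (classical_partial i g)" "g differentiable (at p)" for k p
    using g[of "Suc k"] g[of "Suc 0"] by auto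
  have "0 = (LINT p|lborel. classical_partial i (\<lambda>p. pr (f p) (g p)) p)"
    by (simp add: integral_classical_partial[OF test_function_bilinear[OF pr f g]])
  also have "\<dots> = (LINT p|lborel. pr (f p) (classical_partial i g p) + pr (classical_partial i f p) (g p))"
    by (simp add: classical_partial_bilinear[OF pr test_function_differentiable[OF f] g'(2)])
  also have "\<dots> = (LINT p|lborel. pr (f p) (classical_partial i g p)) + (LINT p|lborel. pr (classical_partial i f p) (g p))"
    by (intro Bochner_Integration.integral_add
        test_function_integrable[OF test_function_bilinear[OF pr f g'(1)]]
        test_function_integrable[OF test_function_bilinear[OF pr test_function_partial[OF f] g]])
  finally show ?thesis by (simp add: eq_neg_iff_add_eq_0 add.commute)
qed

lemma weak_partial_test:
  assumes D: "open D" and f: "test_function D f"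
  shows "weak_partial D i (abs_L2field f) = abs_L2field (classical_partial i f)"
    and "abs_L2field f \<in> H1 D"
proof -
  have w: "is_weak_partial D i (abs_L2field f) (abs_L2field (classical_partial i f))" for i
    unfolding is_weak_partial_iff
  proof (intro allI impI)
    fix \<phi> :: "real^2 \<Rightarrow> real" assume \<phi>: "test_function D \<phi>"
    show "pairing (classical_partial i \<phi>) (abs_L2field f) = - pairing \<phi> (abs_L2field (classical_partial i f))"
      using integration_by_parts[OF bounded_bilinear_scaleR \<phi> test_function_C_k[OF f]]
      by (simp add: pairing_abs[OF test_function_partial[OF \<phi>] test_function_sq_integrable[OF f]]
          pairing_abs[OF \<phi> test_function_sq_integrable[OF test_function_partial[OF f]]])
  qed
  show "weak_partial D i (abs_L2field f) = abs_L2field (classical_partial i f)"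
    by (intro weak_partial_eqI D test_class_L2_on test_function_partial f w)
  show "abs_L2field f \<in> H1 D"
    unfolding H1_def using w test_class_L2_on f test_function_partial by blast
qed

lemma abs_L2field_add:
  "sq_integrable f \<Longrightarrow> sq_integrable g \<Longrightarrow> abs_L2field f + abs_L2field g = abs_L2field (\<lambda>p. f p + g p)"
  by (simp add: plus_L2field.abs_eq ae_eq_refl)

lemma abs_L2field_scaleR: "sq_integrable f \<Longrightarrow> c *\<^sub>R abs_L2field f = abs_L2field (\<lambda>p. c *\<^sub>R f p)"
  by (simp add: scaleR_L2field.abs_eq ae_eq_refl)

lemma divergence_linear:
  assumes "test_function D f" "test_function D g"
  shows "divergence (\<lambda>p. f p + g p) p = divergence f p + divergence g p"
    and "divergence (\<lambda>p. c *\<^sub>R f p) p = c * divergence f p"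
proof -
  have hf: "(f has_derivative frechet_derivative f (at p)) (at p)" and hg: "(g has_derivative frechet_derivative g (at p)) (at p)"
    using assms by (auto intro: differentiable_imp_has_derivative test_function_differentiable)
  have "classical_partial i (\<lambda>p. f p + g p) p = classical_partial i f p + classical_partial i g p" for i
    by (subst classical_partial_eq[OF has_derivative_add[OF hf hg]]) (simp add: classical_partial_def)
  then show "divergence (\<lambda>p. f p + g p) p = divergence f p + divergence g p"
    by (simp add: divergence_def sum.distrib)
  have "classical_partial i (\<lambda>p. c *\<^sub>R f p) p = c *\<^sub>R classical_partial i f p" for i
    by (subst classical_partial_eq[OF has_derivative_scaleR_right[OF hf]]) (simp add: classical_partial_def)
  then show "divergence (\<lambda>p. c *\<^sub>R f p) p = c * divergence f p"
    by (simp add: divergence_def sum_distrib_left)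
qed

lemma subspace_solenoidal_tests: "subspace (solenoidal_tests D)"
proof (rule subspaceI)
  have "test_function D (\<lambda>_. 0 :: real^2)"
    by (rule test_functionI[of _ "{}"]) (auto intro: C_k_const)
  moreover have "divergence (\<lambda>_. 0) p = 0" for p
    unfolding divergence_def by (simp add: classical_partial_eq[OF has_derivative_const])
  ultimately show "0 \<in> solenoidal_tests D"
    unfolding solenoidal_tests_def zero_L2field_def by blast
  fix u assume "u \<in> solenoidal_tests D"
  then obtain f where f: "u = abs_L2field f" "test_function D f" "\<And>p. divergence f p = 0"
    by (auto simp: solenoidal_tests_def)
  {
    fix v assume "v \<in> solenoidal_tests D"
    then obtain g where g: "v = abs_L2field g" "test_function D g" "\<And>p. divergence g p = 0"
      by (auto simp: solenoidal_tests_def)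
    have "u + v = abs_L2field (\<lambda>p. f p + g p)"
      using f g by (simp add: abs_L2field_add abs_L2field_scaleR test_function_sq_integrable)
    then show "u + v \<in> solenoidal_tests D"
      using f g test_function_add[OF f(2) g(2)] divergence_linear(1)[OF f(2) g(2)]
      unfolding solenoidal_tests_def by auto
  }
  fix c
  have "c *\<^sub>R u = abs_L2field (\<lambda>p. c *\<^sub>R f p)"
    using f by (simp add: abs_L2field_add abs_L2field_scaleR test_function_sq_integrable)
  then show "c *\<^sub>R u \<in> solenoidal_tests D"
    using f test_function_linear[OF bounded_linear_scaleR_right f(2), of c] divergence_linear(2)[OF f(2) f(2)]
    unfolding solenoidal_tests_def by auto
qed

lemma subspace_closure:
  fixes S :: "'a::real_normed_vector set"
  assumes "subspace S" shows "subspace (closure S)"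
proof (rule subspaceI)
  show "0 \<in> closure S" using subspace_0[OF assms] closure_subset by blast
  fix x assume "x \<in> closure S"
  then obtain X where X: "\<And>n. X n \<in> S" "X \<longlonglongrightarrow> x" by (auto simp: closure_sequential)
  {
    fix y assume "y \<in> closure S"
    then obtain Y where Y: "\<And>n. Y n \<in> S" "Y \<longlonglongrightarrow> y" by (auto simp: closure_sequential)
    show "x + y \<in> closure S"
      unfolding closure_sequential
      using X Y subspace_add[OF assms] by (intro exI[of _ "\<lambda>n. X n + Y n"]) (auto intro: tendsto_add)
  }
  show "c *\<^sub>R x \<in> closure S" for c
    unfolding closure_sequential
    using X subspace_scale[OF assms] by (intro exI[of _ "\<lambda>n. c *\<^sub>R X n"]) (auto intro: tendsto_scaleR)
qed

lemma subspace_space_H: "subspace (space_H D)"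
  unfolding space_H_def by (rule subspace_closure[OF subspace_solenoidal_tests])

lemma solenoidal_tests_H1: "open D \<Longrightarrow> solenoidal_tests D \<subseteq> H1 D"
  by (auto simp: solenoidal_tests_def intro: weak_partial_test(2))

lemma solenoidal_tests_space_V: 
  assumes "open D" shows "solenoidal_tests D \<subseteq> space_V D"
proof
  fix u assume u: "u \<in> solenoidal_tests D"
  then have "u \<in> H1 D" using solenoidal_tests_H1[OF assms] by auto
  then have "weak_partial D i (u - u) = 0" for i using H1_diff(2)[OF assms \<open>u \<in> H1 D\<close> \<open>u \<in> H1 D\<close>] by simp
  then have "H1_norm D (u - u) = 0" by (simp add: H1_norm_def)
  then show "u \<in> space_V D" using u \<open>u \<in> H1 D\<close> by (force simp: space_V_def)
qed

lemma solenoidal_tests_space_H2: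
  assumes "open D" shows "solenoidal_tests D \<subseteq> space_H2 D"
proof
  fix u assume u: "u \<in> solenoidal_tests D"
  then obtain f where f: "u = abs_L2field f" "test_function D f" by (auto simp: solenoidal_tests_def)
  have H1: "u \<in> H1 D" "weak_partial D i u \<in> H1 D" for i
    using f by (simp_all add: weak_partial_test[OF assms] test_function_partial)
  then have "u \<in> H2 D" by (simp add: H2_def)
  have w0: "weak_partial D i (u - u) = 0" for i using H1_diff(2)[OF assms H1(1) H1(1)] by simp
  moreover have "weak_partial D i 0 = 0" for i using w0 by simp
  ultimately have "H2_norm D (u - u) = 0" by (simp add: H2_norm_def H1_norm_def)
  then show "u \<in> space_H2 D" using u \<open>u \<in> H2 D\<close> unfolding space_H2_def
    by (intro CollectI conjI allI impI bexI[of _ u]) auto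
qed

text \<open>Green's formula, the boundary terms being absent because the support is compact.\<close>

lemma inner_laplacian_test:
  assumes D: "open D" and f: "test_function D f"
  shows "inner (- weak_laplacian D (abs_L2field f)) (abs_L2field f) = (V_norm D (abs_L2field f))\<^sup>2"
proof -
  let ?d = "\<lambda>i. classical_partial i f"
  have d: "test_function D (?d i)" for i by (rule test_function_partial[OF f])
  have "inner (abs_L2field (classical_partial i (?d i))) (abs_L2field f) = - (norm (abs_L2field (?d i)))\<^sup>2" for i
    using integration_by_parts[OF bounded_bilinear_inner d[of i] test_function_C_k[OF f], of i]
    unfolding power2_norm_eq_inner
      inner_abs_L2field[OF test_function_sq_integrable[OF d] test_function_sq_integrable[OF d]]
      inner_abs_L2field[OF test_function_sq_integrable[OF test_function_partial[OF d]] test_function_sq_integrable[OF f]]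
    by simp
  then have "inner (- weak_laplacian D (abs_L2field f)) (abs_L2field f) = (\<Sum>i\<in>UNIV. (norm (abs_L2field (?d i)))\<^sup>2)"
    unfolding weak_laplacian_def weak_partial_test(1)[OF D f] weak_partial_test(1)[OF D d]
    by (simp add: inner_sum_left sum_negf)
  also have "\<dots> = (V_norm D (abs_L2field f))\<^sup>2"
    unfolding V_norm_def weak_partial_test(1)[OF D f] by (simp add: sum_nonneg)
  finally show ?thesis .
qed

text \<open>The integrand is half the derivative of \<open>|y|^2\<close> along \<open>x\<close>. Integration by parts moves the derivative
  to \<open>x\<close>, where it becomes the divergence.\<close>

lemma b_form_test_zero:
  assumes D: "open D" and x: "x \<in> solenoidal_tests D" and y: "y \<in> solenoidal_tests D"
  shows "b_form D x y y = 0"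
proof -
  obtain f where f: "x = abs_L2field f" "test_function D f" "\<And>p. divergence f p = 0"
    using x by (auto simp: solenoidal_tests_def)
  obtain g where g: "y = abs_L2field g" "test_function D g"
    using y by (auto simp: solenoidal_tests_def)
  have comp: "bounded_linear (\<lambda>v::real^2. v $ i)" for i by (rule bounded_linear_vec_nth)
  have part_comp: "classical_partial i (\<lambda>p. h p $ j) p = classical_partial i h p $ j" if "test_function D h" for h :: "real^2 \<Rightarrow> real^2" and i j p
    by (subst classical_partial_eq[OF bounded_linear.has_derivative[OF comp differentiable_imp_has_derivative[OF test_function_differentiable[OF that]]]])
       (simp add: classical_partial_def)
  define q where "q p = inner (g p) (g p)" for p
  have qC: "C_k k q" for k
    unfolding q_def[abs_def] by (intro C_k_bilinear[OF bounded_bilinear_inner] test_function_C_k[OF g(2)])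
  have q': "classical_partial i q p = 2 * (\<Sum>j\<in>UNIV. g p $ j * classical_partial i g p $ j)" for i p
    unfolding q_def[abs_def] 
    by (subst classical_partial_bilinear[OF bounded_bilinear_inner test_function_differentiable[OF g(2)] test_function_differentiable[OF g(2)]])
       (simp add: inner_vec_def inner_commute mult.commute)
  have summand: "(LINT p:D|lborel. rep_L2field y p $ j * rep_L2field x p $ i * rep_L2field (weak_partial D i y) p $ j)
      = (LINT p|lborel. g p $ j * f p $ i * classical_partial i g p $ j)" for i j
  proof -
    have [measurable]: "f \<in> borel_measurable borel" "g \<in> borel_measurable borel" "classical_partial i g \<in> borel_measurable borel"
      using test_function_continuous[OF f(2)] test_function_continuous[OF g(2)] test_function_continuous[OF test_function_partial[OF g(2)]]
      by (auto intro: borel_measurable_continuous_onI)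
    have [measurable]: "D \<in> sets borel" using D by auto
    have [measurable]: "(\<lambda>v::real^2. v $ k) \<in> borel_measurable borel" for k
      by (intro borel_measurable_continuous_onI continuous_intros)
    have [measurable]: "(\<lambda>p. h p $ k) \<in> borel_measurable borel" if [measurable]: "h \<in> borel_measurable borel" for h :: "real^2 \<Rightarrow> real^2" and k
      by measurable
    show ?thesis unfolding set_lebesgue_integral_def g(1) f(1) weak_partial_test(1)[OF D g(2)]
    proof (rule integral_cong_AE)
      show "AE p in lborel. indicat_real D p *\<^sub>R (rep_L2field (abs_L2field g) p $ j * rep_L2field (abs_L2field f) p $ i *
                rep_L2field (abs_L2field (classical_partial i g)) p $ j)
          = g p $ j * f p $ i * classical_partial i g p $ j"
        using AE_rep_abs[OF test_function_sq_integrable[OF g(2)]] AE_rep_abs[OF test_function_sq_integrable[OF f(2)]]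
          AE_rep_abs[OF test_function_sq_integrable[OF test_function_partial[OF g(2)]], of i]
      proof eventually_elim
        case (elim p)
        then show ?case by (cases "p \<in> D") (simp_all add: test_function_zero_outside[OF g(2)])
      qed
    qed measurable
  qed
  have testf: "test_function D (\<lambda>p. f p $ i)" for i by (rule test_function_linear[OF comp f(2)])
  have testg: "test_function D (\<lambda>p. g p $ i)" for i by (rule test_function_linear[OF comp g(2)])
  have testg': "test_function D (\<lambda>p. classical_partial i g p $ j)" for i j
    by (rule test_function_linear[OF comp test_function_partial[OF g(2)]])
  have int: "integrable lborel (\<lambda>p. g p $ j * f p $ i * classical_partial i g p $ j)" for i j
    by (intro test_function_integrable[of D] test_function_bilinear[OF bounded_bilinear_mult] testg
        test_function_C_k[OF testf] test_function_C_k[OF testg'])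
  have "b_form D x y y = (\<Sum>i\<in>UNIV. \<Sum>j\<in>UNIV. LINT p|lborel. g p $ j * f p $ i * classical_partial i g p $ j)"
    unfolding b_form_def summand ..
  also have "\<dots> = (\<Sum>i\<in>UNIV. 1/2 * (LINT p|lborel. f p $ i * classical_partial i q p))"
  proof (intro sum.cong refl)
    fix i
    have "(\<Sum>j\<in>UNIV. LINT p|lborel. g p $ j * f p $ i * classical_partial i g p $ j)
        = (LINT p|lborel. (\<Sum>j\<in>UNIV. g p $ j * f p $ i * classical_partial i g p $ j))"
      by (simp add: int)
    also have "\<dots> = (LINT p|lborel. 1/2 * (f p $ i * classical_partial i q p))"
      unfolding q' by (intro Bochner_Integration.integral_cong refl) (simp add: sum_distrib_left mult_ac)
    finally show "(\<Sum>j\<in>UNIV. LINT p|lborel. g p $ j * f p $ i * classical_partial i g p $ j)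
        = 1/2 * (LINT p|lborel. f p $ i * classical_partial i q p)" by simp
  qed
  also have "\<dots> = (\<Sum>i\<in>UNIV. - (1/2) * (LINT p|lborel. classical_partial i (\<lambda>p. f p $ i) p * q p))"
    using integration_by_parts[OF bounded_bilinear_mult testf qC] by (intro sum.cong refl) simp
  also have "\<dots> = - (1/2) * (LINT p|lborel. (\<Sum>i\<in>UNIV. classical_partial i (\<lambda>p. f p $ i) p * q p))"
    unfolding sum_distrib_left[symmetric]
    by (subst Bochner_Integration.integral_sum)
       (auto intro!: test_function_integrable test_function_bilinear[OF bounded_bilinear_mult] test_function_partial testf qC)
  also have "\<dots> = 0"
    using f(3) by (simp add: part_comp[OF f(2)] divergence_def sum_distrib_right[symmetric])
  finally show ?thesis .
qed

section \<open>The trilinear form on the energy space\<close>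

locale stokes_flow =
  fixes D :: "(real^2) set" and DA :: "L2field set" and A :: "L2field \<Rightarrow> L2field"
    and e :: "nat \<Rightarrow> L2field" and lam :: "nat \<Rightarrow> real"
    and b :: "L2field \<Rightarrow> L2field \<Rightarrow> L2field \<Rightarrow> real"
  assumes open_D: "open D" and stokes: "stokes_setting D DA A e lam"
    and ext: "bounded_extension D e lam b"

sublocale stokes_flow \<subseteq> spectral_setting D e lam
proof
  have es: "eigensystem D DA A e lam" using stokes by (simp add: stokes_setting_def)
  show "inner (e j) (e k) = (if j = k then 1 else 0)" for j k using es by (simp add: eigensystem_def)
  show "0 < lam 0" using es by (simp add: eigensystem_def)
  show "lam 0 \<le> lam k" for k using es by (simp add: eigensystem_def incseq_def)
  show "subspace (space_H D)" by (rule subspace_space_H)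
  show "e k \<in> space_H D" for k
    using es stokes by (auto simp: eigensystem_def stokes_setting_def stokes_operator_def)
  show "space_H D \<subseteq> closure (span (range e))" using es by (simp add: eigensystem_def)
qed

context stokes_flow
begin

lemma lam_mono: "i \<le> j \<Longrightarrow> lam i \<le> lam j"
  using stokes by (simp add: stokes_setting_def eigensystem_def incseq_def)

lemma V_eq: "space_V D = Dom (1/2)"
  using stokes by (simp add: stokes_setting_def)

lemma subspace_DA: "subspace DA" and e_in_DA: "e k \<in> DA" and A_e: "A (e k) = lam k *\<^sub>R e k"
  and A_symmetric: "x \<in> DA \<Longrightarrow> y \<in> DA \<Longrightarrow> inner (A x) y = inner x (A y)"
  and A_in_H: "x \<in> DA \<Longrightarrow> A x \<in> space_H D"
  and H2_DA: "space_H2 D \<subseteq> DA"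
  and A_H2: "x \<in> space_H2 D \<Longrightarrow> A x = leray D (- weak_laplacian D x)"
proof -
  have so: "stokes_operator D DA A" and es: "eigensystem D DA A e lam"
    using stokes by (simp_all add: stokes_setting_def)
  show "subspace DA" "x \<in> DA \<Longrightarrow> y \<in> DA \<Longrightarrow> inner (A x) y = inner x (A y)"
    "space_H2 D \<subseteq> DA" "x \<in> space_H2 D \<Longrightarrow> A x = leray D (- weak_laplacian D x)"
    using so by (simp_all add: stokes_operator_def)
  show "x \<in> DA \<Longrightarrow> A x \<in> space_H D"
    using so by (auto simp: stokes_operator_def)
  show "e k \<in> DA" "A (e k) = lam k *\<^sub>R e k"
    using es by (simp_all add: eigensystem_def)
qed

lemma coef_A: "x \<in> DA \<Longrightarrow> coef (A x) k = lam k * coef x k"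
  using A_symmetric[OF _ e_in_DA] by (simp add: A_e)

lemma span_e_DA: "span (e ` {..<n}) \<subseteq> DA"
  by (intro span_minimal subspace_DA) (auto intro: e_in_DA)

text \<open>The projection is the Fourier series in the eigenbasis; orthogonality determines it.\<close>

lemma leray_props:
  shows "leray D u \<in> space_H D" "h \<in> space_H D \<Longrightarrow> inner (leray D u) h = inner u h"
proof -
  note s = orthonormal_coeffs_summable[OF orthonormal, of u]
  define w where "w = (\<Sum>k. coef u k *\<^sub>R e k)"
  have w: "w \<in> space_H D" unfolding w_def by (rule series_in_H[OF s])
  have "closure (span (range e)) \<subseteq> {h. inner (u - w) h = 0}"
  proof (intro closure_minimal span_minimal)
    show "range e \<subseteq> {h. inner (u - w) h = 0}"
      using orthonormal_series(2)[OF orthonormal s] by (auto simp: inner_diff_left w_def)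
  qed (auto intro: subspace_hyperplane closed_hyperplane)
  then have wo: "inner (u - w) h = 0" if "h \<in> space_H D" for h using e_complete that by blast
  have "leray D u = w"
    unfolding leray_def
  proof (rule the_equality)
    fix w' assume w': "w' \<in> space_H D \<and> (\<forall>h\<in>space_H D. inner (u - w') h = 0)"
    have "inner (w - w') h = 0" if "h \<in> space_H D" for h
      using wo[OF that] w' that by (simp add: inner_diff_left)
    then have "inner (w - w') (w - w') = 0" using w w' subspace_diff[OF subspace_H] by blast
    then show "w' = w" by simp
  qed (use w wo in auto)
  then show "leray D u \<in> space_H D" "h \<in> space_H D \<Longrightarrow> inner (leray D u) h = inner u h"
    using w wo by (simp_all add: inner_diff_left)
qed

lemma solenoidal_tests_H: "solenoidal_tests D \<subseteq> space_H D"
  by (simp add: space_H_def closure_subset)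

text \<open>For a solenoidal test field \<open>A u\<close> is the projected Laplacian, and pairing it with \<open>u\<close> itself removes
  the projection. Parseval evaluates \<open>\<langle>A u, u\<rangle>\<close> spectrally and Green's formula evaluates it by the
  gradient.\<close>

lemma norm_half_test:
  assumes u: "u \<in> solenoidal_tests D"
  shows "norm (Apow (1/2) u) = V_norm D u"
proof -
  have DA: "u \<in> DA" and H: "u \<in> space_H D" and V: "u \<in> Dom (1/2)"
    using u solenoidal_tests_space_H2[OF open_D] H2_DA solenoidal_tests_H solenoidal_tests_space_V[OF open_D] V_eq by auto
  obtain f where f: "u = abs_L2field f" "test_function D f" using u by (auto simp: solenoidal_tests_def)
  have "inner (A u) u = inner (- weak_laplacian D u) u"
    using u solenoidal_tests_space_H2[OF open_D] H by (simp add: A_H2[OF subsetD] leray_props(2))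
  also have "\<dots> = (V_norm D u)\<^sup>2" unfolding f(1) by (rule inner_laplacian_test[OF open_D f(2)])
  finally have "(\<lambda>k. coef (A u) k * coef u k) sums (V_norm D u)\<^sup>2"
    using Parseval[OF orthonormal, of "A u" u] A_in_H[OF DA] e_complete by auto
  moreover have "coef (A u) k * coef u k = lam k powr (2 * (1/2)) * (coef u k)\<^sup>2" for k
    using lam_pos[of k] by (simp add: coef_A[OF DA] power2_eq_square)
  ultimately have "(norm (Apow (1/2) u))\<^sup>2 = (V_norm D u)\<^sup>2"
    using norm_Apow_sums[OF _ V] by (simp add: sums_unique2)
  moreover have "0 \<le> V_norm D u" by (simp add: V_norm_def sum_nonneg)
  ultimately show ?thesis using power2_eq_iff_nonneg[of "norm (Apow (1/2) u)" "V_norm D u"] by simp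
qed

lemma wnorm_eq_L2: "wnorm lam n s a = L2_set (\<lambda>k. lam k powr s * a k) {..<n}"
proof -
  have "lam k powr (2 * s) * (a k)\<^sup>2 = (lam k powr s * a k)\<^sup>2" for k
    using lam_pos[of k] by (simp add: power_mult_distrib powr_power mult.commute)
  then show ?thesis by (simp add: wnorm_def L2_set_def)
qed

lemma wnorm_coef_add: "wnorm lam n s (coef (x + y)) \<le> wnorm lam n s (coef x) + wnorm lam n s (coef y)"
proof -
  have "wnorm lam n s (coef (x + y)) = L2_set (\<lambda>k. lam k powr s * coef x k + lam k powr s * coef y k) {..<n}"
    by (simp add: wnorm_eq_L2 inner_add_left distrib_left)
  then show ?thesis unfolding wnorm_eq_L2 using L2_set_triangle_ineq by simp
qed

lemma wnorm_coef_le_norm: "0 \<le> s \<Longrightarrow> wnorm lam n s (coef x) \<le> lam n powr s * norm x"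
proof (rule power2_le_imp_le)
  assume "0 \<le> s"
  have "(wnorm lam n s (coef x))\<^sup>2 \<le> (\<Sum>k<n. lam n powr (2 * s) * (coef x k)\<^sup>2)"
    unfolding wnorm_sq using lam_mono lam_pos \<open>0 \<le> s\<close>
    by (intro sum_mono mult_right_mono powr_mono2) (auto simp: less_imp_le)
  also have "\<dots> \<le> lam n powr (2 * s) * (norm x)\<^sup>2"
    unfolding sum_distrib_left[symmetric] by (intro mult_left_mono Bessel_inequality orthonormal) auto
  also have "\<dots> = (lam n powr s * norm x)\<^sup>2"
    using lam_pos[of n] by (simp add: power_mult_distrib powr_power mult.commute)
  finally show "(wnorm lam n s (coef x))\<^sup>2 \<le> (lam n powr s * norm x)\<^sup>2" .
qed simp

lemma wnorm_le_norm_Apow: "0 \<le> s \<Longrightarrow> x \<in> Dom s \<Longrightarrow> wnorm lam n s (coef x) \<le> norm (Apow s x)"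
proof -
  assume "0 \<le> s" "x \<in> Dom s"
  have "(wnorm lam n s (coef x))\<^sup>2 = (norm (Apow s (proj_n e n x)))\<^sup>2"
    using norm_Apow_span[OF \<open>0 \<le> s\<close> proj_n_in_span, of n x] by (simp add: coef_proj_n wnorm_sq)
  then have "wnorm lam n s (coef x) = norm (Apow s (proj_n e n x))"
    by (simp add: power2_eq_iff_nonneg)
  then show ?thesis using norm_Apow_proj_n_le[OF \<open>0 \<le> s\<close> \<open>x \<in> Dom s\<close>] by simp
qed

lemma norm_Apow_le_wnorm_bound:
  assumes "0 \<le> s" "x \<in> Dom s" "\<And>n. wnorm lam n s (coef x) \<le> c"
  shows "norm (Apow s x) \<le> c"
proof -
  have c: "0 \<le> c" using assms(3)[of 0] wnorm_nonneg order_trans by blast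
  have "(\<Sum>k<n. lam k powr (2 * s) * (coef x k)\<^sup>2) \<le> c\<^sup>2" for n
    unfolding wnorm_sq[symmetric] by (intro power_mono assms) auto
  then have "(norm (Apow s x))\<^sup>2 \<le> c\<^sup>2"
    using norm_Apow_sums[OF assms(1,2)] suminf_le_const[of "\<lambda>k. lam k powr (2 * s) * (coef x k)\<^sup>2" "c\<^sup>2"]
    by (simp add: sums_iff)
  then show ?thesis using c by (rule power2_le_imp_le)
qed

text \<open>The closure that defines \<open>V\<close> is taken in the Sobolev norm, while the estimates use \<open>A^{1/2}\<close>. On differences of
  test fields the two agree, and lower semicontinuity carries the bound over to the limit: on
  finitely many coefficients the norm of \<open>A^{1/2}\<close> is dominated by the \<open>L^2\<close> norm, so \<open>u\<close> may be
  replaced there by another test field at a cost as small as desired.\<close>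

lemma V_approx:
  assumes u: "u \<in> space_V D" and "\<delta> > 0"
  shows "\<exists>\<phi>\<in>solenoidal_tests D. norm (Apow (1/2) (u - \<phi>)) \<le> \<delta> \<and> V_norm D (u - \<phi>) \<le> \<delta>"
proof -
  have uH1: "u \<in> H1 D" using u by (simp add: space_V_def)
  obtain \<phi> where \<phi>: "\<phi> \<in> solenoidal_tests D" "H1_norm D (u - \<phi>) < \<delta>"
    using u \<open>\<delta> > 0\<close> unfolding space_V_def by blast
  have \<phi>H1: "\<phi> \<in> H1 D" using \<phi> solenoidal_tests_H1[OF open_D] by auto
  have "u - \<phi> \<in> Dom (1/2)"
    using u \<phi>(1) solenoidal_tests_space_V[OF open_D] subspace_diff[OF subspace_Dom] unfolding V_eq by auto
  moreover have "wnorm lam n (1/2) (coef (u - \<phi>)) \<le> \<delta>" for n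
  proof (rule field_le_epsilon)
    fix \<eta> :: real assume "\<eta> > 0"
    \<comment> \<open>One share \<open>\<theta>\<close> pays for the gradient norm, and \<open>lam n powr (1/2) * \<theta>\<close> for the coefficients.\<close>
    define \<theta> where "\<theta> = \<eta> / (1 + lam n powr (1/2))"
    have \<theta>: "\<theta> > 0" "\<theta> * (1 + lam n powr (1/2)) = \<eta>"
      using \<open>\<eta> > 0\<close> by (auto simp: \<theta>_def field_simps add_pos_nonneg add_nonneg_eq_0_iff)
    obtain \<psi> where \<psi>: "\<psi> \<in> solenoidal_tests D" "H1_norm D (u - \<psi>) < \<theta>"
      using u \<theta>(1) unfolding space_V_def by blast
    have \<psi>H1: "\<psi> \<in> H1 D" using \<psi> solenoidal_tests_H1[OF open_D] by auto
    have d: "\<psi> - \<phi> \<in> solenoidal_tests D" using \<psi> \<phi> subspace_diff[OF subspace_solenoidal_tests] by blast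
    have "wnorm lam n (1/2) (coef (u - \<phi>)) \<le> wnorm lam n (1/2) (coef (u - \<psi>)) + wnorm lam n (1/2) (coef (\<psi> - \<phi>))"
      using wnorm_coef_add[of n "1/2" "u - \<psi>" "\<psi> - \<phi>"] by simp
    moreover have "wnorm lam n (1/2) (coef (u - \<psi>)) \<le> lam n powr (1/2) * \<theta>"
    proof (rule order.trans)
      show "wnorm lam n (1/2) (coef (u - \<psi>)) \<le> lam n powr (1/2) * norm (u - \<psi>)"
        by (rule wnorm_coef_le_norm) simp
      have "norm (u - \<psi>) \<le> \<theta>" using norm_le_H1_norm[of "u - \<psi>" D] \<psi>(2) by simp
      then show "lam n powr (1/2) * norm (u - \<psi>) \<le> lam n powr (1/2) * \<theta>"
        by (intro mult_left_mono) auto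
    qed
    moreover have "wnorm lam n (1/2) (coef (\<psi> - \<phi>)) \<le> V_norm D (\<psi> - \<phi>)"
      using wnorm_le_norm_Apow[of "1/2" "\<psi> - \<phi>" n] norm_half_test[OF d] d solenoidal_tests_space_V[OF open_D] V_eq by auto
    moreover have "V_norm D (\<psi> - \<phi>) \<le> V_norm D (u - \<phi>) + V_norm D ((-1) *\<^sub>R (u - \<psi>))"
      using V_norm_triangle[OF open_D H1_diff(1)[OF open_D uH1 \<phi>H1] H1_linear(3)[OF open_D H1_diff(1)[OF open_D uH1 \<psi>H1] uH1, of "-1"]]
      by simp
    moreover have "V_norm D ((-1) *\<^sub>R (u - \<psi>)) = V_norm D (u - \<psi>)"
      unfolding V_norm_def H1_linear(4)[OF open_D H1_diff(1)[OF open_D uH1 \<psi>H1] uH1] by simp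
    moreover have "lam n powr (1/2) * \<theta> + \<theta> = \<eta>" using \<theta>(2) by (simp add: algebra_simps)
    ultimately show "wnorm lam n (1/2) (coef (u - \<phi>)) \<le> \<delta> + \<eta>"
      using V_norm_le_H1_norm[of D "u - \<phi>"] V_norm_le_H1_norm[of D "u - \<psi>"] \<phi>(2) \<psi>(2)
      by linarith
  qed
  ultimately have "norm (Apow (1/2) (u - \<phi>)) \<le> \<delta>" by (intro norm_Apow_le_wnorm_bound) auto
  then show ?thesis using \<phi> V_norm_le_H1_norm[of D "u - \<phi>"] by force
qed

lemma V_norm_le:
  assumes u: "u \<in> space_V D" shows "V_norm D u \<le> norm (Apow (1/2) u)"
proof (rule field_le_epsilon)
  fix \<eta> :: real assume "\<eta> > 0"
  obtain \<phi> where \<phi>: "\<phi> \<in> solenoidal_tests D" "norm (Apow (1/2) (u - \<phi>)) \<le> \<eta>/2" "V_norm D (u - \<phi>) \<le> \<eta>/2"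
    using V_approx[OF u, of "\<eta>/2"] \<open>\<eta> > 0\<close> by auto
  have V: "u \<in> Dom (1/2)" "\<phi> \<in> Dom (1/2)" using u \<phi>(1) solenoidal_tests_space_V[OF open_D] V_eq by auto
  have H1: "u \<in> H1 D" "\<phi> \<in> H1 D" using u \<phi>(1) solenoidal_tests_H1[OF open_D] by (auto simp: space_V_def)
  have "V_norm D u \<le> V_norm D (u - \<phi>) + V_norm D \<phi>"
    using V_norm_triangle[OF open_D H1_diff(1)[OF open_D H1] H1(2)] by simp
  also have "V_norm D \<phi> = norm (Apow (1/2) u - Apow (1/2) (u - \<phi>))"
    using norm_half_test[OF \<phi>(1)] Apow_diff[OF _ V] by simp
  also have "\<dots> \<le> norm (Apow (1/2) u) + norm (Apow (1/2) (u - \<phi>))" by (rule norm_triangle_ineq4)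
  finally show "V_norm D u \<le> norm (Apow (1/2) u) + \<eta>" using \<phi> by simp
qed

lemma V_approx_seq:
  assumes u: "u \<in> space_V D"
  shows "\<exists>\<phi>. (\<forall>m::nat. \<phi> m \<in> solenoidal_tests D) \<and> (\<lambda>m. norm (Apow (1/2) (u - \<phi> m))) \<longlonglongrightarrow> 0"
proof -
  have "\<exists>\<phi>\<in>solenoidal_tests D. norm (Apow (1/2) (u - \<phi>)) \<le> inverse (real (Suc m))" for m
    using V_approx[OF u, of "inverse (real (Suc m))"] by auto
  then obtain \<phi> where \<phi>: "\<And>m. \<phi> m \<in> solenoidal_tests D" "\<And>m. norm (Apow (1/2) (u - \<phi> m)) \<le> inverse (real (Suc m))"
    by metis
  moreover have "(\<lambda>m. norm (Apow (1/2) (u - \<phi> m))) \<longlonglongrightarrow> 0"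
    by (rule tendsto_sandwich[OF _ _ tendsto_const LIMSEQ_inverse_real_of_nat]) (use \<phi>(2) in auto)
  ultimately show ?thesis by blast
qed

abbreviation N :: "L2field \<Rightarrow> real" where "N x \<equiv> norm (Apow (1/4) x)"

lemma V_subset_Dom14: "space_V D \<subseteq> Dom (1/4)"
  unfolding V_eq using Dom_mono(1)[of "1/4" "1/2"] by auto

lemma span_e_V: "span (range e) \<subseteq> space_V D"
  unfolding V_eq by (rule span_e_Dom) simp

lemma subspace_V: "subspace (space_V D)" unfolding V_eq by (rule subspace_Dom) simp

lemmas subspace_Dom14 = subspace_Dom[of "1/4", simplified]

lemma
  shows b_V: "x \<in> space_V D \<Longrightarrow> y \<in> space_V D \<Longrightarrow> z \<in> space_V D \<Longrightarrow> b x y z = b_form D x y z"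
    and b_lin1: "x \<in> Dom (1/4) \<Longrightarrow> x' \<in> Dom (1/4) \<Longrightarrow> y \<in> Dom (1/4) \<Longrightarrow> z \<in> space_V D \<Longrightarrow>
      b (c *\<^sub>R x + x') y z = c * b x y z + b x' y z"
    and b_lin2: "x \<in> Dom (1/4) \<Longrightarrow> y \<in> Dom (1/4) \<Longrightarrow> y' \<in> Dom (1/4) \<Longrightarrow> z \<in> space_V D \<Longrightarrow>
      b x (c *\<^sub>R y + y') z = c * b x y z + b x y' z"
    and b_lin3: "x \<in> Dom (1/4) \<Longrightarrow> y \<in> Dom (1/4) \<Longrightarrow> z \<in> space_V D \<Longrightarrow> z' \<in> space_V D \<Longrightarrow>
      b x y (c *\<^sub>R z + z') = c * b x y z + b x y z'"
proof -
  note ext' = ext[unfolded bounded_extension_def Let_def]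
  show "x \<in> space_V D \<Longrightarrow> y \<in> space_V D \<Longrightarrow> z \<in> space_V D \<Longrightarrow> b x y z = b_form D x y z"
    using conjunct1[OF ext'] by simp
  show "x \<in> Dom (1/4) \<Longrightarrow> x' \<in> Dom (1/4) \<Longrightarrow> y \<in> Dom (1/4) \<Longrightarrow> z \<in> space_V D \<Longrightarrow>
      b (c *\<^sub>R x + x') y z = c * b x y z + b x' y z"
    using conjunct1[OF conjunct2[OF ext']] by simp
  show "x \<in> Dom (1/4) \<Longrightarrow> y \<in> Dom (1/4) \<Longrightarrow> y' \<in> Dom (1/4) \<Longrightarrow> z \<in> space_V D \<Longrightarrow>
      b x (c *\<^sub>R y + y') z = c * b x y z + b x y' z"
    using conjunct1[OF conjunct2[OF conjunct2[OF ext']]] by simp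
  show "x \<in> Dom (1/4) \<Longrightarrow> y \<in> Dom (1/4) \<Longrightarrow> z \<in> space_V D \<Longrightarrow> z' \<in> space_V D \<Longrightarrow>
      b x y (c *\<^sub>R z + z') = c * b x y z + b x y z'"
    using conjunct1[OF conjunct2[OF conjunct2[OF conjunct2[OF ext']]]] by simp
qed

lemma b_diff1: "x \<in> Dom (1/4) \<Longrightarrow> x' \<in> Dom (1/4) \<Longrightarrow> y \<in> Dom (1/4) \<Longrightarrow> z \<in> space_V D \<Longrightarrow>
    b (x - x') y z = b x y z - b x' y z"
  using b_lin1[of x' x y z "-1"] by simp

lemma b_diff2: "x \<in> Dom (1/4) \<Longrightarrow> y \<in> Dom (1/4) \<Longrightarrow> y' \<in> Dom (1/4) \<Longrightarrow> z \<in> space_V D \<Longrightarrow>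
    b x (y - y') z = b x y z - b x y' z"
  using b_lin2[of x y' y z "-1"] by simp

lemma b_diff3: "x \<in> Dom (1/4) \<Longrightarrow> y \<in> Dom (1/4) \<Longrightarrow> z \<in> space_V D \<Longrightarrow> z' \<in> space_V D \<Longrightarrow>
    b x y (z - z') = b x y z - b x y z'"
  using b_lin3[of x y z' z "-1"] by simp

lemma b_add2: "x \<in> Dom (1/4) \<Longrightarrow> y \<in> Dom (1/4) \<Longrightarrow> y' \<in> Dom (1/4) \<Longrightarrow> z \<in> space_V D \<Longrightarrow>
    b x (y + y') z = b x y z + b x y' z"
  using b_lin2[of x y y' z 1] by simp

lemma b_add3: "x \<in> Dom (1/4) \<Longrightarrow> y \<in> Dom (1/4) \<Longrightarrow> z \<in> space_V D \<Longrightarrow> z' \<in> space_V D \<Longrightarrow>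
    b x y (z + z') = b x y z + b x y z'"
  using b_lin3[of x y z z' 1] by simp

lemma b_sum2:
  assumes x: "x \<in> Dom (1/4)" and z: "z \<in> space_V D"
  shows "b x (\<Sum>k<n::nat. c k *\<^sub>R e k) z = (\<Sum>k<n. c k * b x (e k) z)"
proof (induction n)
  case 0
  show ?case using b_diff2[OF x x x z] by simp
next
  case (Suc n)
  have e: "e k \<in> Dom (1/4)" for k using span_e_Dom[of "1/4"] span_base[of "e k" "range e"] by auto
  have "(\<Sum>k<n. c k *\<^sub>R e k) \<in> Dom (1/4)"
    by (intro subspace_sum subspace_Dom14 subspace_scale e)
  then show ?case using b_lin2[OF x e _ z, of "\<Sum>k<n. c k *\<^sub>R e k" "c n" n] Suc.IH by (simp add: add.commute)
qed

lemma b_sum3: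
  assumes x: "x \<in> Dom (1/4)" and y: "y \<in> Dom (1/4)"
  shows "b x y (\<Sum>k<n::nat. c k *\<^sub>R e k) = (\<Sum>k<n. c k * b x y (e k))"
proof (induction n)
  case 0
  show ?case using b_diff3[OF x y subspace_0[OF subspace_V] subspace_0[OF subspace_V]] by simp
next
  case (Suc n)
  have e: "e k \<in> space_V D" for k using span_e_V span_base[of "e k" "range e"] by auto
  have "(\<Sum>k<n. c k *\<^sub>R e k) \<in> space_V D"
    by (intro subspace_sum subspace_V subspace_scale e)
  then show ?case using b_lin3[OF x y e, of "\<Sum>k<n. c k *\<^sub>R e k" "c n" n] Suc.IH by (simp add: add.commute)
qed

text \<open>The extended form is bounded in terms of the gradient norm of the last argument; since that
  norm is at most the norm of \<open>A^{1/2}\<close>, the bound can be stated on the spectral scale.\<close>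

definition form_bound :: "real \<Rightarrow> bool" where
  "form_bound C \<longleftrightarrow> 0 \<le> C \<and> (\<forall>x\<in>Dom (1/4). \<forall>y\<in>Dom (1/4). \<forall>z\<in>space_V D.
     \<bar>b x y z\<bar> \<le> C * N x * N y * norm (Apow (1/2) z))"

definition b_const :: real where "b_const = (SOME C. form_bound C)"

lemma form_bound_b_const: "form_bound b_const"
proof -
  obtain C where C: "\<forall>x\<in>Dom (1/4). \<forall>y\<in>Dom (1/4). \<forall>z\<in>space_V D. \<bar>b x y z\<bar> \<le> C * N x * N y * V_norm D z"
    using conjunct2[OF conjunct2[OF conjunct2[OF conjunct2[OF ext[unfolded bounded_extension_def Let_def]]]]] by blast
  have "form_bound \<bar>C\<bar>"
    unfolding form_bound_def
  proof (intro conjI ballI)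
    fix x y z assume a: "x \<in> Dom (1/4)" "y \<in> Dom (1/4)" "z \<in> space_V D"
    have "0 \<le> V_norm D z" by (simp add: V_norm_def sum_nonneg)
    have "\<bar>b x y z\<bar> \<le> C * N x * N y * V_norm D z" using C a by blast
    also have "\<dots> \<le> \<bar>C\<bar> * N x * N y * norm (Apow (1/2) z)"
      using V_norm_le[OF a(3)] \<open>0 \<le> V_norm D z\<close> by (intro mult_mono) auto
    finally show "\<bar>b x y z\<bar> \<le> \<bar>C\<bar> * N x * N y * norm (Apow (1/2) z)" .
  qed simp
  then show ?thesis unfolding b_const_def by (rule someI)
qed

lemma b_const_nonneg: "0 \<le> b_const"
  and b_bound: "x \<in> Dom (1/4) \<Longrightarrow> y \<in> Dom (1/4) \<Longrightarrow> z \<in> space_V D \<Longrightarrow>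
      \<bar>b x y z\<bar> \<le> b_const * N x * N y * norm (Apow (1/2) z)"
  using form_bound_b_const by (auto simp: form_bound_def)

lemma Apow_zero: "0 \<le> s \<Longrightarrow> Apow s 0 = 0"
  using Apow_diff[of s 0 0] subspace_0[OF subspace_Dom] by simp

lemma N_triangle: "x \<in> Dom (1/4) \<Longrightarrow> y \<in> Dom (1/4) \<Longrightarrow> N (x + y) \<le> N x + N y"
  by (simp add: Apow_add norm_triangle_ineq)

lemma N_le_add_diff: 
  assumes "x \<in> Dom (1/4)" "y \<in> Dom (1/4)" shows "N y \<le> N x + N (x - y)"
proof -
  have "Apow (1/4) y = Apow (1/4) x - Apow (1/4) (x - y)" using Apow_diff[OF _ assms] by simp
  then show ?thesis using norm_triangle_ineq4[of "Apow (1/4) x" "Apow (1/4) (x - y)"] by simp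
qed

text \<open>All three density arguments for \<open>b\<close> go through this joint continuity.\<close>

lemma b_tendsto:
  assumes x: "x \<in> Dom (1/4)" "\<And>m. xs m \<in> Dom (1/4)" "(\<lambda>m. N (x - xs m)) \<longlonglongrightarrow> 0"
    and y: "y \<in> Dom (1/4)" "\<And>m. ys m \<in> Dom (1/4)" "(\<lambda>m. N (y - ys m)) \<longlonglongrightarrow> 0"
    and z: "z \<in> space_V D" "\<And>m. zs m \<in> space_V D" "(\<lambda>m. norm (Apow (1/2) (z - zs m))) \<longlonglongrightarrow> 0"
  shows "(\<lambda>m. b (xs m) (ys m) (zs m)) \<longlonglongrightarrow> b x y z"
proof (rule LIM_zero_cancel, rule tendsto_rabs_zero_cancel)
  let ?h = "\<lambda>x. norm (Apow (1/2) x)"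
  let ?g = "\<lambda>m. b_const * N (x - xs m) * N y * ?h z + b_const * (N x + N (x - xs m)) * N (y - ys m) * ?h z
      + b_const * (N x + N (x - xs m)) * (N y + N (y - ys m)) * ?h (z - zs m)"
  have "?g \<longlonglongrightarrow> b_const * 0 * N y * ?h z + b_const * (N x + 0) * 0 * ?h z + b_const * (N x + 0) * (N y + 0) * 0"
    by (intro tendsto_intros x y z)
  then have g: "?g \<longlonglongrightarrow> 0" by simp
  show "(\<lambda>m. \<bar>b (xs m) (ys m) (zs m) - b x y z\<bar>) \<longlonglongrightarrow> 0"
  proof (rule tendsto_sandwich[OF _ _ tendsto_const g])
    show "\<forall>\<^sub>F m in sequentially. \<bar>b (xs m) (ys m) (zs m) - b x y z\<bar> \<le> ?g m"
    proof (rule always_eventually, rule allI)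
      fix m
      note d = subspace_diff[OF subspace_Dom14 x(1) x(2)[of m]] subspace_diff[OF subspace_Dom14 y(1) y(2)[of m]]
        subspace_diff[OF subspace_V z(1) z(2)[of m]]
      have "b x y z - b (xs m) (ys m) (zs m)
          = b (x - xs m) y z + b (xs m) (y - ys m) z + b (xs m) (ys m) (z - zs m)"
        using x y z by (simp add: b_diff1 b_diff2 b_diff3)
      then have "\<bar>b (xs m) (ys m) (zs m) - b x y z\<bar>
          \<le> \<bar>b (x - xs m) y z\<bar> + \<bar>b (xs m) (y - ys m) z\<bar> + \<bar>b (xs m) (ys m) (z - zs m)\<bar>" by linarith
      also have "\<dots> \<le> b_const * N (x - xs m) * N y * ?h z + b_const * N (xs m) * N (y - ys m) * ?h z
          + b_const * N (xs m) * N (ys m) * ?h (z - zs m)"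
        by (intro add_mono b_bound x y z d)
      also have "\<dots> \<le> ?g m"
        using N_le_add_diff[OF x(1) x(2)[of m]] N_le_add_diff[OF y(1) y(2)[of m]] b_const_nonneg
        by (intro add_mono mult_mono order_refl) auto
      finally show "\<bar>b (xs m) (ys m) (zs m) - b x y z\<bar> \<le> ?g m" .
    qed
  qed auto
qed

lemma V_tendsto_imp_N:
  assumes "\<And>m. x m \<in> space_V D" "(\<lambda>m. norm (Apow (1/2) (x m))) \<longlonglongrightarrow> 0"
  shows "(\<lambda>m. N (x m)) \<longlonglongrightarrow> 0"
proof (rule tendsto_sandwich[OF _ _ tendsto_const])
  show "(\<lambda>m. lam 0 powr (1/4 - 1/2) * norm (Apow (1/2) (x m))) \<longlonglongrightarrow> 0"
    using tendsto_mult_left[OF assms(2), of "lam 0 powr (1/4 - 1/2)"] by simp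
  show "\<forall>\<^sub>F m in sequentially. N (x m) \<le> lam 0 powr (1/4 - 1/2) * norm (Apow (1/2) (x m))"
    using Dom_mono(2)[of "1/4" "1/2"] assms(1) V_eq by (intro always_eventually) auto
qed auto

text \<open>Both arguments are approximated at once by solenoidal test fields, for which the form is the
  integral expression.\<close>

lemma b_zero_V:
  assumes u: "u \<in> space_V D" and w: "w \<in> space_V D"
  shows "b u w w = 0"
proof -
  obtain f where f: "\<And>m. f m \<in> solenoidal_tests D" "(\<lambda>m. norm (Apow (1/2) (u - f m))) \<longlonglongrightarrow> 0"
    using V_approx_seq[OF u] by blast
  obtain g where g: "\<And>m. g m \<in> solenoidal_tests D" "(\<lambda>m. norm (Apow (1/2) (w - g m))) \<longlonglongrightarrow> 0"
    using V_approx_seq[OF w] by blast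
  have V: "f m \<in> space_V D" "g m \<in> space_V D" for m
    using f(1) g(1) solenoidal_tests_space_V[OF open_D] by auto
  have "(\<lambda>m. b (f m) (g m) (g m)) \<longlonglongrightarrow> b u w w"
  proof (rule b_tendsto)
    show "(\<lambda>m. N (u - f m)) \<longlonglongrightarrow> 0" "(\<lambda>m. N (w - g m)) \<longlonglongrightarrow> 0"
      using u w f(2) g(2) V subspace_diff[OF subspace_V] by (auto intro: V_tendsto_imp_N)
  qed (use u w V V_subset_Dom14 g(2) in auto)
  moreover have "b (f m) (g m) (g m) = 0" for m
    using b_form_test_zero[OF open_D f(1) g(1)] V by (simp add: b_V)
  ultimately show ?thesis by (simp add: LIMSEQ_const_iff)
qed

lemma proj_n_V: "proj_n e n x \<in> space_V D"
  using proj_n_in_span span_first_subset span_e_V by blast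

lemma b_zero:
  assumes u: "u \<in> Dom (1/4)" and w: "w \<in> space_V D"
  shows "b u w w = 0"
proof -
  have "(\<lambda>m. b (proj_n e m u) w w) \<longlonglongrightarrow> b u w w"
    by (rule b_tendsto) (use u w proj_n_V V_subset_Dom14 Apow_proj_n_tendsto[OF _ u] in \<open>auto simp: Apow_zero\<close>)
  then show ?thesis by (simp add: b_zero_V[OF proj_n_V w] LIMSEQ_const_iff)
qed

text \<open>Polarisation of \<open>b_zero\<close>.\<close>

lemma b_antisym:
  assumes u: "u \<in> Dom (1/4)" and y: "y \<in> space_V D" and w: "w \<in> space_V D"
  shows "b u y w = - b u w y"
proof -
  have X: "y \<in> Dom (1/4)" "w \<in> Dom (1/4)" "y + w \<in> space_V D"
    using y w V_subset_Dom14 subspace_add[OF subspace_V] by auto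
  have "b u (y + w) (y + w) = b u y y + b u y w + b u w y + b u w w"
    using u X y w by (simp add: b_add2 b_add3)
  then show ?thesis using b_zero[OF u] X(3) y w by simp
qed

definition interp_const :: "real \<Rightarrow> real" where
  "interp_const \<sigma> = 4 / (1 - 2 powr (- min \<sigma> (1/4 - \<sigma>))) * b_const"

lemma interp_const_nonneg:
  assumes "0 < \<sigma>" "\<sigma> < 1/4" shows "0 \<le> interp_const \<sigma>"
proof -
  have "2 powr (- min \<sigma> (1/4 - \<sigma>)) < (2::real) powr 0" using assms by (intro powr_less_mono) auto
  then show ?thesis using b_const_nonneg by (simp add: interp_const_def)
qed

lemma sum_e_span: "(\<Sum>k<n. a k *\<^sub>R e k) \<in> span (e ` {..<n})"
  by (intro span_sum span_scale span_base) auto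

lemma norm_Apow_sum_e: "0 \<le> s \<Longrightarrow> norm (Apow s (\<Sum>k<n. a k *\<^sub>R e k)) = wnorm lam n s a"
  using norm_Apow_span[OF _ sum_e_span, of s a n] unfolding wnorm_def
  by (simp add: orthonormal_inner_sum[OF orthonormal] real_sqrt_unique)

text \<open>On the span of finitely many eigenfunctions \<open>b(u,\<cdot>,\<cdot>)\<close> is a matrix. Skew symmetry yields the
  second endpoint bound from the first, so that the interpolation theorem applies.\<close>

lemma b_interpolated_span:
  assumes \<sigma>: "0 < \<sigma>" "\<sigma> < 1/4" and u: "u \<in> Dom (1/4)"
    and y: "y \<in> span (e ` {..<n})" and w: "w \<in> span (e ` {..<n})"
  shows "\<bar>b u y w\<bar> \<le> interp_const \<sigma> * N u * norm (Apow (1/4 + \<sigma>) y) * norm (Apow (1/2 - \<sigma>) w)"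
proof -
  have V: "(\<Sum>k<n. a k *\<^sub>R e k) \<in> space_V D" and X: "(\<Sum>k<n. a k *\<^sub>R e k) \<in> Dom (1/4)" for a n
    using sum_e_span span_first_subset span_e_V V_subset_Dom14 by blast+
  have form: "(\<Sum>i<n. \<Sum>k<n. b u (e i) (e k) * a i * c k) = b u (\<Sum>i<n. a i *\<^sub>R e i) (\<Sum>k<n. c k *\<^sub>R e k)" for a c
  proof -
    have eX: "e i \<in> Dom (1/4)" for i using span_e_Dom[of "1/4"] span_base[of "e i" "range e"] by auto
    have "b u (\<Sum>i<n. a i *\<^sub>R e i) (\<Sum>k<n. c k *\<^sub>R e k) = (\<Sum>i<n. a i * b u (e i) (\<Sum>k<n. c k *\<^sub>R e k))"
      by (rule b_sum2[OF u V])
    also have "\<dots> = (\<Sum>i<n. a i * (\<Sum>k<n. c k * b u (e i) (e k)))"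
      by (intro sum.cong refl arg_cong2[where f = "(*)"] b_sum3[OF u eX])
    finally show ?thesis by (simp add: sum_distrib_left mult_ac)
  qed
  have 1: "\<bar>\<Sum>i<n. \<Sum>k<n. b u (e i) (e k) * a i * c k\<bar> \<le> b_const * N u * wnorm lam n (1/4) a * wnorm lam n (1/2) c" for a c
    unfolding form using b_bound[OF u X V] by (simp add: norm_Apow_sum_e)
  have 2: "\<bar>\<Sum>i<n. \<Sum>k<n. b u (e i) (e k) * a i * c k\<bar> \<le> b_const * N u * wnorm lam n (1/2) a * wnorm lam n (1/4) c" for a c
  proof -
    have "\<bar>b u (\<Sum>i<n. a i *\<^sub>R e i) (\<Sum>k<n. c k *\<^sub>R e k)\<bar> = \<bar>b u (\<Sum>i<n. c i *\<^sub>R e i) (\<Sum>k<n. a k *\<^sub>R e k)\<bar>"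
      using b_antisym[OF u V V, of a n c n] by simp
    also have "\<dots> \<le> b_const * N u * wnorm lam n (1/4) c * wnorm lam n (1/2) a"
      using b_bound[OF u X V, of c n a n] by (simp add: norm_Apow_sum_e)
    finally show ?thesis unfolding form by (simp only: mult_ac)
  qed
  have "0 \<le> b_const * N u" using b_const_nonneg by simp
  from bilinear_interpolation[OF lam_pos \<sigma> this 1 2, of "coef y" "coef w"]
  have "\<bar>b u (\<Sum>i<n. coef y i *\<^sub>R e i) (\<Sum>k<n. coef w k *\<^sub>R e k)\<bar>
      \<le> interp_const \<sigma> * N u * wnorm lam n (1/4 + \<sigma>) (coef y) * wnorm lam n (1/2 - \<sigma>) (coef w)"
    unfolding form interp_const_def by (simp add: mult_ac)
  then show ?thesis
    using \<sigma> norm_Apow_sum_e[of "1/4 + \<sigma>" "coef y" n] norm_Apow_sum_e[of "1/2 - \<sigma>" "coef w" n]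
    by (simp add: span_expansion[OF y, symmetric] span_expansion[OF w, symmetric])
qed

text \<open>The exponents \<open>1/4 + \<sigma>\<close> and \<open>1/2 - \<sigma>\<close> sum to \<open>3/4\<close>, as at both endpoints. The middle argument
  may lie outside the span, as the trajectory \<open>z\<close> does; it is reached by truncation,
  which does not increase the norms.\<close>

lemma b_interpolated:
  assumes \<sigma>: "0 < \<sigma>" "\<sigma> < 1/4" and u: "u \<in> Dom (1/4)"
    and y: "y \<in> Dom (1/4 + \<sigma>)" and w: "w \<in> span (e ` {..<n})"
  shows "\<bar>b u y w\<bar> \<le> interp_const \<sigma> * N u * norm (Apow (1/4 + \<sigma>) y) * norm (Apow (1/2 - \<sigma>) w)"
proof -
  have y': "y \<in> Dom (1/4)" using Dom_mono(1)[OF _ _ y, of "1/4"] \<sigma> by simp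
  have wV: "w \<in> space_V D" using w span_first_subset span_e_V by blast
  have "(\<lambda>m. b u (proj_n e m y) w) \<longlonglongrightarrow> b u y w"
    by (rule b_tendsto) (use u wV y' proj_n_V V_subset_Dom14 Apow_proj_n_tendsto[OF _ y'] in \<open>auto simp: Apow_zero\<close>)
  then have lim: "(\<lambda>m. \<bar>b u (proj_n e m y) w\<bar>) \<longlonglongrightarrow> \<bar>b u y w\<bar>" by (rule tendsto_rabs)
  show ?thesis
  proof (rule LIMSEQ_le_const2[OF lim], intro exI allI impI)
    fix m assume "n \<le> m"
    then have "w \<in> span (e ` {..<m})" using w span_mono[of "e ` {..<n}" "e ` {..<m}"] by (auto simp: image_mono)
    from b_interpolated_span[OF \<sigma> u proj_n_in_span this, of y]
    have "\<bar>b u (proj_n e m y) w\<bar>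
        \<le> interp_const \<sigma> * N u * norm (Apow (1/4 + \<sigma>) (proj_n e m y)) * norm (Apow (1/2 - \<sigma>) w)" .
    also have "\<dots> \<le> interp_const \<sigma> * N u * norm (Apow (1/4 + \<sigma>) y) * norm (Apow (1/2 - \<sigma>) w)"
      using interp_const_nonneg[OF \<sigma>] norm_Apow_proj_n_le[OF _ y, of m] \<sigma>
      by (intro mult_right_mono mult_left_mono) auto
    finally show "\<bar>b u (proj_n e m y) w\<bar>
        \<le> interp_const \<sigma> * N u * norm (Apow (1/4 + \<sigma>) y) * norm (Apow (1/2 - \<sigma>) w)" .
  qed
qed

end

section \<open>Scalar inequalities\<close>

text \<open>Gronwall's lemma with the integral of the growth rate replaced by an antiderivative \<open>g\<close>. Only
  derivatives in the open interval enter, because the differential equation and the singular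
  kernels live there.\<close>

lemma gronwall_derivative:
  fixes f g :: "real \<Rightarrow> real"
  assumes "0 \<le> t" and cont: "continuous_on {0..t} f" "continuous_on {0..t} g"
    and f': "\<And>s. 0 < s \<Longrightarrow> s < t \<Longrightarrow> (f has_real_derivative f' s) (at s)"
    and g': "\<And>s. 0 < s \<Longrightarrow> s < t \<Longrightarrow> (g has_real_derivative g' s) (at s)"
    and le: "\<And>s. 0 < s \<Longrightarrow> s < t \<Longrightarrow> f' s \<le> g' s * f s"
  shows "f t \<le> f 0 * exp (g t - g 0)"
proof -
  have "f t * exp (- g t) \<le> f 0 * exp (- g 0)"
  proof (rule DERIV_nonpos_imp_decreasing_open[OF \<open>0 \<le> t\<close>])
    show "continuous_on {0..t} (\<lambda>s. f s * exp (- g s))" by (intro continuous_intros cont)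
    fix s assume s: "0 < s" "s < t"
    have "((\<lambda>s. f s * exp (- g s)) has_real_derivative (f' s - g' s * f s) * exp (- g s)) (at s)"
      using f'[OF s] g'[OF s] by (auto intro!: derivative_eq_intros simp: algebra_simps)
    moreover have "(f' s - g' s * f s) * exp (- g s) \<le> 0"
      using le[OF s] by (intro mult_nonpos_nonneg) auto
    ultimately show "\<exists>y. ((\<lambda>s. f s * exp (- g s)) has_real_derivative y) (at s) \<and> y \<le> 0" by blast
  qed
  then have "f t * exp (- g t) * exp (g t) \<le> f 0 * exp (- g 0) * exp (g t)"
    by (rule mult_right_mono) simp
  then show ?thesis by (simp add: mult.assoc flip: exp_add)
qed

lemma derivative_comparison:
  fixes f g :: "real \<Rightarrow> real"
  assumes "0 \<le> t" and cont: "continuous_on {0..t} f" "continuous_on {0..t} g"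
    and f': "\<And>s. 0 < s \<Longrightarrow> s < t \<Longrightarrow> (f has_real_derivative f' s) (at s)"
    and g': "\<And>s. 0 < s \<Longrightarrow> s < t \<Longrightarrow> (g has_real_derivative g' s) (at s)"
    and le: "\<And>s. 0 < s \<Longrightarrow> s < t \<Longrightarrow> f' s \<le> g' s"
  shows "f t - f 0 \<le> g t - g 0"
proof -
  have "g 0 - f 0 \<le> g t - f t"
  proof (rule DERIV_nonneg_imp_increasing_open[OF \<open>0 \<le> t\<close>])
    show "continuous_on {0..t} (\<lambda>s. g s - f s)" by (intro continuous_intros cont)
    fix s assume s: "0 < s" "s < t"
    show "\<exists>y. ((\<lambda>s. g s - f s) has_real_derivative y) (at s) \<and> 0 \<le> y"
      using le[OF s] by (intro exI[of _ "g' s - f' s"] conjI DERIV_diff f' g' s) simp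
  qed
  then show ?thesis by simp
qed

text \<open>Young's inequality, applied three times. The forcing term is subcritical in the dissipation
  \<open>d\<close>, with growth \<open>d^{3/2}\<close> at most.\<close>

lemma absorb_into_dissipation:
  fixes P Q a d :: real
  assumes "0 \<le> P" "0 \<le> Q" "0 \<le> a" "0 \<le> d"
  shows "2 * (P * (sqrt (a * d) + Q) * d) \<le> d\<^sup>2 + 4 * P ^ 4 * a\<^sup>2 + 4 * P\<^sup>2 * Q\<^sup>2"
proof -
  define r where "r = sqrt (a * d)"
  have r: "r\<^sup>2 = a * d" using assms by (simp add: r_def)
  have "0 \<le> (d - 2 * P * r)\<^sup>2" by simp
  then have 1: "2 * (P * r * d) \<le> d\<^sup>2 / 2 + 2 * P\<^sup>2 * (a * d)"
    unfolding r[symmetric] by (simp add: power2_eq_square algebra_simps)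
  have "0 \<le> (d / 2 - 2 * P\<^sup>2 * a)\<^sup>2" by simp
  then have 2: "2 * P\<^sup>2 * (a * d) \<le> d\<^sup>2 / 4 + 4 * P ^ 4 * a\<^sup>2"
    by (simp add: power2_eq_square power4_eq_xxxx algebra_simps)
  have "0 \<le> (d / 2 - 2 * P * Q)\<^sup>2" by simp
  then have 3: "2 * (P * Q * d) \<le> d\<^sup>2 / 4 + 4 * P\<^sup>2 * Q\<^sup>2"
    by (simp add: power2_eq_square algebra_simps)
  have "2 * (P * (r + Q) * d) = 2 * (P * r * d) + 2 * (P * Q * d)" by (simp add: algebra_simps)
  also have "\<dots> \<le> d\<^sup>2 + 4 * P ^ 4 * a\<^sup>2 + 4 * P\<^sup>2 * Q\<^sup>2" using 1 2 3 by simp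
  finally show ?thesis by (simp add: r_def)
qed

lemma power4_sum_le: "((p::real) + q) ^ 4 \<le> 8 * (p ^ 4 + q ^ 4)"
proof -
  have sq: "(x + y)\<^sup>2 \<le> 2 * (x\<^sup>2 + y\<^sup>2)" for x y :: real
    using zero_le_power2[of "x - y"] by (simp add: power2_sum power2_diff)
  have "((p + q)\<^sup>2)\<^sup>2 \<le> (2 * (p\<^sup>2 + q\<^sup>2))\<^sup>2" by (intro power_mono sq) auto
  also have "\<dots> = 4 * (p\<^sup>2 + q\<^sup>2)\<^sup>2" unfolding power_mult_distrib by simp
  also have "\<dots> \<le> 4 * (2 * ((p\<^sup>2)\<^sup>2 + (q\<^sup>2)\<^sup>2))" by (intro mult_left_mono sq) auto
  finally show ?thesis by simp
qed

text \<open>Either \<open>X\<close> dominates the left side, or it is smaller than a power of \<open>\<tau>\<close>, which is then inserted for \<open>X\<close>. For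
  \<open>\<kappa> < 1 - \<rho>\<close> the remaining singularity is integrable.\<close>

lemma singular_young:
  fixes X \<tau> \<rho> :: real
  assumes "0 \<le> X" "0 < \<tau>" "0 \<le> \<rho>" "\<rho> < 1"
  shows "\<tau> powr (- \<kappa>) * X powr \<rho> \<le> X + \<tau> powr (- (\<kappa> / (1 - \<rho>)))"
proof (cases "X = 0 \<or> \<tau> powr (- \<kappa>) * X powr \<rho> \<le> X")
  case True
  then show ?thesis using \<open>0 \<le> X\<close> powr_ge_zero[of \<tau> "- (\<kappa> / (1 - \<rho>))"] by (elim disjE) (simp, linarith)
next
  case False
  then have X: "0 < X" "X < \<tau> powr (- \<kappa>) * X powr \<rho>" using assms by auto
  have "X powr (1 - \<rho>) = X / X powr \<rho>" using X(1) by (simp add: powr_diff)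
  also have "\<dots> < \<tau> powr (- \<kappa>)" using X by (simp add: divide_less_eq)
  finally have "(X powr (1 - \<rho>)) powr (1 / (1 - \<rho>)) \<le> (\<tau> powr (- \<kappa>)) powr (1 / (1 - \<rho>))"
    using assms by (intro powr_mono2) auto
  then have X': "X \<le> \<tau> powr (- (\<kappa> / (1 - \<rho>)))" using X(1) assms by (simp add: powr_powr)
  have "\<tau> powr (- \<kappa>) * X powr \<rho> \<le> \<tau> powr (- \<kappa>) * (\<tau> powr (- (\<kappa> / (1 - \<rho>)))) powr \<rho>"
    using X' X(1) assms by (intro mult_left_mono powr_mono2) auto
  also have "\<dots> = \<tau> powr (- \<kappa> + - (\<kappa> / (1 - \<rho>)) * \<rho>)"
    by (simp only: powr_powr powr_add[symmetric])
  also have "- \<kappa> + - (\<kappa> / (1 - \<rho>)) * \<rho> = - (\<kappa> / (1 - \<rho>))"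
    using assms by (simp add: field_simps)
  finally show ?thesis using assms by simp
qed

lemma sublinear_bound:
  fixes Y K L \<delta> :: real
  assumes "Y \<le> K + L * Y powr (1 - \<delta>)" "0 \<le> Y" "0 \<le> K" "0 \<le> L" "0 < \<delta>" "\<delta> \<le> 1"
  shows "Y \<le> max 1 ((K + L) powr (1 / \<delta>))"
proof (cases "Y \<le> 1")
  case False
  then have Y: "1 < Y" by simp
  have "1 \<le> Y powr (1 - \<delta>)" using Y assms by (intro ge_one_powr_ge_zero) auto
  then have "K \<le> K * Y powr (1 - \<delta>)" using assms(3) by (simp add: mult_le_cancel_left1)
  then have "Y powr 1 \<le> (K + L) * Y powr (1 - \<delta>)" using assms(1) Y by (simp add: algebra_simps)
  then have "Y powr 1 / Y powr (1 - \<delta>) \<le> K + L" using Y by (simp add: divide_le_eq)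
  then have "Y powr \<delta> \<le> K + L" by (simp only: powr_diff[symmetric]) simp
  then have "(Y powr \<delta>) powr (1 / \<delta>) \<le> (K + L) powr (1 / \<delta>)"
    using assms Y by (intro powr_mono2) auto
  then show ?thesis using Y assms by (simp add: powr_powr)
qed simp

definition kernel_prim :: "real \<Rightarrow> real \<Rightarrow> real \<Rightarrow> real" where
  "kernel_prim t q s = - ((t - s) powr (1 - q) / (1 - q))"

lemma kernel_prim_derivative:
  assumes "q < 1" "s < t"
  shows "(kernel_prim t q has_real_derivative (t - s) powr (- q)) (at s)"
proof -
  have "((\<lambda>s. (t - s) powr (1 - q)) has_real_derivative (1 - q) * (t - s) powr (1 - q - 1) * (- 1)) (at s)"
    by (rule DERIV_chain2[OF has_real_derivative_powr]) (use assms in \<open>auto intro!: derivative_eq_intros\<close>)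
  from DERIV_minus[OF DERIV_cdivide[OF this, of "1 - q"]]
  show ?thesis using assms by (simp add: kernel_prim_def[abs_def])
qed

lemma kernel_prim_continuous: "q < 1 \<Longrightarrow> continuous_on {0..t} (kernel_prim t q)"
  unfolding kernel_prim_def[abs_def]
  by (intro continuous_intros continuous_on_powr') auto

lemma kernel_prim_diff_le:
  assumes "q < 1" "0 \<le> t" "t \<le> T"
  shows "kernel_prim t q t - kernel_prim t q 0 \<le> T powr (1 - q) / (1 - q)"
  using assms by (simp add: kernel_prim_def divide_right_mono powr_mono2)

text \<open>The smoothing of the heat semigroup on one eigenspace, from \<open>x^q \<le> max 1 x \<le> exp x\<close>.\<close>

lemma powr_exp_le:
  fixes l \<tau> q :: real
  assumes "0 < l" "0 < \<tau>" "0 \<le> q" "q \<le> 1"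
  shows "l powr q * exp (- (l * \<tau>)) \<le> \<tau> powr (- q)"
proof -
  have "(l * \<tau>) powr q \<le> exp (l * \<tau>)"
  proof (cases "l * \<tau> \<le> 1")
    case True
    then have "(l * \<tau>) powr q \<le> 1 powr q" using assms by (intro powr_mono2) auto
    also have "\<dots> \<le> exp (l * \<tau>)" using assms by simp
    finally show ?thesis .
  next
    case False
    then have "(l * \<tau>) powr q \<le> (l * \<tau>) powr 1" using assms by (intro powr_mono) auto
    also have "\<dots> = l * \<tau>" using assms by simp
    also have "\<dots> \<le> exp (l * \<tau>)" using exp_ge_add_one_self[of "l * \<tau>"] by linarith
    finally show ?thesis .
  qed
  then have "l powr q * \<tau> powr q \<le> exp (l * \<tau>)" using assms by (simp add: powr_mult)
  then show ?thesis using assms by (simp add: powr_minus exp_minus field_simps)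
qed

text \<open>Hoelder's inequality for sums, proved by applying Young's inequality to the terms after
  dividing the two endpoint sums by their values.\<close>

lemma wnorm_interpolation:
  assumes lam: "\<And>k. 0 < lam k" and \<theta>: "0 \<le> \<theta>" "\<theta> \<le> 1" and p: "p = (1 - \<theta>) * s + \<theta> * r"
  shows "(wnorm lam n p a)\<^sup>2 \<le> ((wnorm lam n s a)\<^sup>2) powr (1 - \<theta>) * ((wnorm lam n r a)\<^sup>2) powr \<theta>"
proof (cases "\<forall>k<n. a k = 0")
  case True
  then have "wnorm lam n p a = 0" by (simp add: wnorm_def)
  then show ?thesis by simp
next
  case False
  then obtain j where j: "j < n" "a j \<noteq> 0" by auto
  have pos: "0 < (wnorm lam n q a)\<^sup>2" for q
    unfolding wnorm_sq using j less_imp_neq[OF lam, symmetric]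
    by (intro sum_pos2[of _ j]) (auto intro!: mult_pos_pos)
  let ?A = "(wnorm lam n s a)\<^sup>2" and ?B = "(wnorm lam n r a)\<^sup>2"
  have "(wnorm lam n p a)\<^sup>2 = ?A powr (1 - \<theta>) * ?B powr \<theta> *
      (\<Sum>k<n. ((lam k powr (2 * s) / ?A) powr (1 - \<theta>) * (lam k powr (2 * r) / ?B) powr \<theta>) * (a k)\<^sup>2)"
    unfolding wnorm_sq[of lam n p] sum_distrib_left
  proof (intro sum.cong refl)
    fix k
    have "lam k powr (2 * p) = (lam k powr (2 * s)) powr (1 - \<theta>) * (lam k powr (2 * r)) powr \<theta>"
      unfolding p by (simp add: powr_powr algebra_simps flip: powr_add)
    then show "lam k powr (2 * p) * (a k)\<^sup>2 = ?A powr (1 - \<theta>) * ?B powr \<theta> *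
        ((lam k powr (2 * s) / ?A) powr (1 - \<theta>) * (lam k powr (2 * r) / ?B) powr \<theta> * (a k)\<^sup>2)"
      using pos[of s] pos[of r] by (simp add: powr_divide)
  qed
  also have "\<dots> \<le> ?A powr (1 - \<theta>) * ?B powr \<theta> *
      (\<Sum>k<n. ((1 - \<theta>) * (lam k powr (2 * s) / ?A) + \<theta> * (lam k powr (2 * r) / ?B)) * (a k)\<^sup>2)"
    using \<theta> pos lam
    by (intro mult_left_mono sum_mono mult_right_mono Youngs_inequality_0)
       (auto intro!: mult_nonneg_nonneg divide_pos_pos simp: less_imp_neq[OF lam, symmetric])
  also have "(\<Sum>k<n. ((1 - \<theta>) * (lam k powr (2 * s) / ?A) + \<theta> * (lam k powr (2 * r) / ?B)) * (a k)\<^sup>2)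
      = (1 - \<theta>) / ?A * ?A + \<theta> / ?B * ?B"
    unfolding wnorm_sq[of lam n s] wnorm_sq[of lam n r] sum_distrib_left sum.distrib[symmetric]
    by (intro sum.cong refl) (simp add: algebra_simps)
  also have "\<dots> = 1" using pos[of s] pos[of r] by simp
  finally show ?thesis by simp
qed

section \<open>Energy identity and mild formulation of a Galerkin solution\<close>

context stokes_flow
begin

text \<open>The energies at the various levels of regularity; \<open>En (s + 1/2)\<close> is the dissipation that
  belongs to \<open>En s\<close>.\<close>

abbreviation En :: "real \<Rightarrow> L2field \<Rightarrow> real" where "En s y \<equiv> (norm (Apow s y))\<^sup>2"

lemma En_wnorm: "0 \<le> s \<Longrightarrow> y \<in> span (e ` {..<n}) \<Longrightarrow> En s y = (wnorm lam n s (coef y))\<^sup>2"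
  by (simp add: norm_Apow_span wnorm_sq)

lemma norm_Apow_wnorm: "0 \<le> s \<Longrightarrow> y \<in> span (e ` {..<n}) \<Longrightarrow> norm (Apow s y) = wnorm lam n s (coef y)"
  using En_wnorm[of s y n] by (simp add: power2_eq_iff_nonneg)

lemma En_interpolation:
  assumes "0 \<le> s" "0 \<le> r" "0 \<le> \<theta>" "\<theta> \<le> 1" "p = (1 - \<theta>) * s + \<theta> * r" "y \<in> span (e ` {..<n})"
  shows "En p y \<le> En s y powr (1 - \<theta>) * En r y powr \<theta>"
proof -
  have "0 \<le> p" using assms by simp
  show ?thesis
    unfolding En_wnorm[OF \<open>0 \<le> p\<close> assms(6)] En_wnorm[OF assms(1,6)] En_wnorm[OF assms(2,6)]
    by (rule wnorm_interpolation[OF lam_pos assms(3,4,5)])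
qed

lemma norm_Apow_midpoint:
  assumes s: "0 \<le> s" and y: "y \<in> span (e ` {..<n})"
  shows "norm (Apow (s + 1/4) y) \<le> sqrt (norm (Apow s y) * norm (Apow (s + 1/2) y))"
proof -
  have "En (s + 1/4) y \<le> En s y powr (1 - 1/2) * En (s + 1/2) y powr (1/2)"
    by (rule En_interpolation[OF s _ _ _ _ y]) (use s in \<open>auto simp: field_simps\<close>)
  then have "En (s + 1/4) y \<le> norm (Apow s y) * norm (Apow (s + 1/2) y)"
    by (simp add: powr_half_sqrt)
  then show ?thesis by (rule real_le_rsqrt)
qed

end

locale galerkin_setting = stokes_flow +
  fixes T :: real and z :: "real \<Rightarrow> L2field" and x :: L2field and n :: nat and v :: "real \<Rightarrow> L2field"
  assumes galerkin: "galerkin_solution A e b T z x n v"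
    and z14: "\<And>t. t \<in> {0..T} \<Longrightarrow> z t \<in> Dom (1/4)"
begin

abbreviation u :: "real \<Rightarrow> L2field" where "u t \<equiv> v t + z t"

lemma v_span: "t \<in> {0..T} \<Longrightarrow> v t \<in> span (e ` {..<n})"
  using galerkin by (simp add: galerkin_solution_def)

lemma v_V: "t \<in> {0..T} \<Longrightarrow> v t \<in> space_V D"
  using v_span span_first_subset span_e_V by blast

lemma v_Dom: "0 \<le> s \<Longrightarrow> t \<in> {0..T} \<Longrightarrow> v t \<in> Dom s"
  using v_span span_first_subset span_e_Dom by blast

lemma u_Dom: "t \<in> {0..T} \<Longrightarrow> u t \<in> Dom (1/4)"
  using v_Dom[of "1/4"] z14 subspace_add[OF subspace_Dom14] by simp

lemma coef_derivative:
  assumes t: "0 < t" "t < T" and k: "k < n"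
  shows "((\<lambda>t. coef (v t) k) has_real_derivative - lam k * coef (v t) k - b (u t) (u t) (e k)) (at t)"
proof -
  have t': "t \<in> {0<..T}" "t \<in> {0..T}" using t by auto
  have "(v has_vector_derivative - (A (v t) + nonlin_n e b n (u t))) (at t within {0..T})"
    using galerkin t' by (simp add: galerkin_solution_def)
  then have "(v has_vector_derivative - (A (v t) + nonlin_n e b n (u t))) (at t)"
    using t at_within_interior[of t "{0..T}"] by simp
  then have "((\<lambda>t. coef (v t) k) has_vector_derivative coef (- (A (v t) + nonlin_n e b n (u t))) k) (at t)"
    by (rule bounded_linear.has_vector_derivative[OF bounded_linear_inner_left])
  moreover have "coef (- (A (v t) + nonlin_n e b n (u t))) k = - lam k * coef (v t) k - b (u t) (u t) (e k)"
    using k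
    by (simp add: inner_add_left inner_diff_left inner_minus_left coef_A[OF subsetD[OF span_e_DA v_span[OF t'(2)]]] nonlin_n_def orthonormal_inner_sum[OF orthonormal] nonlin_def)
  ultimately show ?thesis by (simp add: has_real_derivative_iff_has_vector_derivative)
qed

lemma coef_continuous: "continuous_on {0..T} (\<lambda>t. coef (v t) k)"
  using galerkin by (auto simp: galerkin_solution_def intro!: continuous_intros)

lemma En_v: "0 \<le> s \<Longrightarrow> t \<in> {0..T} \<Longrightarrow> En s (v t) = (\<Sum>k<n. lam k powr (2 * s) * (coef (v t) k)\<^sup>2)"
  using norm_Apow_span v_span by blast

lemma En_continuous: "0 \<le> s \<Longrightarrow> continuous_on {0..T} (\<lambda>t. En s (v t))"
  by (subst continuous_on_cong[OF refl En_v]) (auto intro!: continuous_intros coef_continuous)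

lemma norm_continuous: "0 \<le> s \<Longrightarrow> continuous_on {0..T} (\<lambda>t. norm (Apow s (v t)))"
  using continuous_on_real_sqrt[OF En_continuous] by simp

text \<open>The field \<open>A^{2s} v\<close> with which the equation is tested at level \<open>s\<close>.\<close>

definition test :: "real \<Rightarrow> real \<Rightarrow> L2field" where
  "test s t = (\<Sum>k<n. (lam k powr (2 * s) * coef (v t) k) *\<^sub>R e k)"

lemma test_span: "test s t \<in> span (e ` {..<n})"
  unfolding test_def by (rule sum_e_span)

lemma norm_Apow_test:
  assumes "0 \<le> r" "0 \<le> r + 2 * s" "t \<in> {0..T}"
  shows "norm (Apow r (test s t)) = norm (Apow (r + 2 * s) (v t))"
proof -
  have "lam k powr (2 * r) * (lam k powr (2 * s) * a)\<^sup>2 = lam k powr (2 * (r + 2 * s)) * a\<^sup>2" for k a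
  proof -
    have "2 * (r + 2 * s) = 2 * r + (2 * s + 2 * s)" by simp
    then show ?thesis by (simp only: powr_add) (simp add: power2_eq_square)
  qed
  then have "wnorm lam n r (\<lambda>k. lam k powr (2 * s) * coef (v t) k) = wnorm lam n (r + 2 * s) (coef (v t))"
    by (simp add: wnorm_def)
  then show ?thesis
    using assms by (simp add: test_def norm_Apow_sum_e norm_Apow_wnorm[OF _ v_span[OF assms(3)]])
qed

lemma energy_identity:
  assumes s: "0 \<le> s" and t: "0 < t" "t < T"
  shows "((\<lambda>t. En s (v t)) has_real_derivative - 2 * En (s + 1/2) (v t) - 2 * b (u t) (u t) (test s t)) (at t)"
proof -
  have t': "t \<in> {0..T}" using t by auto
  have "((\<lambda>t. \<Sum>k<n. lam k powr (2 * s) * (coef (v t) k)\<^sup>2) has_real_derivative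
      (\<Sum>k<n. lam k powr (2 * s) * (2 * coef (v t) k * (- lam k * coef (v t) k - b (u t) (u t) (e k))))) (at t)"
    using coef_derivative[OF t] by (auto intro!: derivative_eq_intros sum.cong)
  also have "(\<Sum>k<n. lam k powr (2 * s) * (2 * coef (v t) k * (- lam k * coef (v t) k - b (u t) (u t) (e k))))
      = - 2 * (\<Sum>k<n. lam k powr (2 * (s + 1/2)) * (coef (v t) k)\<^sup>2)
        - 2 * (\<Sum>k<n. (lam k powr (2 * s) * coef (v t) k) * b (u t) (u t) (e k))"
  proof -
    have "lam k powr (2 * (s + 1/2)) = lam k powr (2 * s) * lam k" for k
      using lam_pos[of k] by (simp add: powr_add distrib_left)
    then show ?thesis
      unfolding sum_distrib_left sum_subtractf[symmetric]
      by (intro sum.cong refl) (simp add: algebra_simps power2_eq_square)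
  qed
  also have "(\<Sum>k<n. lam k powr (2 * (s + 1/2)) * (coef (v t) k)\<^sup>2) = En (s + 1/2) (v t)"
    using En_v[of "s + 1/2" t] s t' by simp
  also have "(\<Sum>k<n. (lam k powr (2 * s) * coef (v t) k) * b (u t) (u t) (e k)) = b (u t) (u t) (test s t)"
    unfolding test_def by (rule b_sum3[OF u_Dom[OF t'] u_Dom[OF t'], symmetric])
  finally show ?thesis
    by (rule has_field_derivative_transform_within_open[of _ _ _ "{0<..<T}"]) (use t En_v s in auto)
qed

text \<open>The mild formulation by duality. With \<open>w\<close> the normalised coefficients of \<open>A^\<alpha> v(t)\<close>, the function
  \<open>\<phi>(s) = \<langle>A^\<alpha> exp(-(t-s)A) v(s), w\<rangle>\<close> runs up to \<open>|v(t)|_\<alpha>\<close>, and the linear part of the equation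
  drops out of its derivative. What remains is \<open>b\<close> with a smoothed test field, whose \<open>V\<close> norm
  is at most \<open>(t-s)^{-(\<alpha>+1/2)}\<close>. The bound on the increment of \<open>\<phi>\<close> is supplied as an antiderivative \<open>\<Psi>\<close>.\<close>

lemma mild_bound:
  assumes t: "0 < t" "t \<le> T" and \<alpha>: "0 \<le> \<alpha>" "\<alpha> \<le> 1/2"
    and \<Psi>: "continuous_on {0..t} \<Psi>" "\<And>s. 0 < s \<Longrightarrow> s < t \<Longrightarrow> (\<Psi> has_real_derivative \<Psi>' s) (at s)"
    and le: "\<And>s. 0 < s \<Longrightarrow> s < t \<Longrightarrow> b_const * (N (u s))\<^sup>2 * (t - s) powr (- (\<alpha> + 1/2)) \<le> \<Psi>' s"
  shows "norm (Apow \<alpha> (v t)) \<le> norm (Apow \<alpha> (v 0)) + (\<Psi> t - \<Psi> 0)"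
proof (cases "norm (Apow \<alpha> (v t)) = 0")
  case True
  have "(\<lambda>_. 0) t - (\<lambda>_. 0) 0 \<le> \<Psi> t - \<Psi> 0"
  proof (rule derivative_comparison[where f' = "\<lambda>_. 0" and g' = \<Psi>'])
    show "0 \<le> \<Psi>' s" if "0 < s" "s < t" for s
      using le[OF that] b_const_nonneg by (meson mult_nonneg_nonneg order.trans powr_ge_zero zero_le_power2)
  qed (use t \<Psi> in \<open>auto intro: continuous_intros\<close>)
  then show ?thesis using True by simp
next
  case False
  define r where "r = norm (Apow \<alpha> (v t))"
  define w where "w k = lam k powr \<alpha> * coef (v t) k / r" for k
  define m where "m s k = lam k powr \<alpha> * exp (- (lam k * (t - s))) * w k" for s k
  define \<phi> where "\<phi> s = (\<Sum>k<n. m s k * coef (v s) k)" for s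
  have "0 < r" using False by (simp add: r_def)
  have sq: "(lam k powr \<alpha>)\<^sup>2 = lam k powr (2 * \<alpha>)" for k
    using lam_pos[of k] by (simp add: powr_power mult.commute)
  have rsq: "r\<^sup>2 = (\<Sum>k<n. lam k powr (2 * \<alpha>) * (coef (v t) k)\<^sup>2)"
    unfolding r_def using En_v \<alpha> t by simp
  have w1: "(\<Sum>k<n. (w k)\<^sup>2) = 1"
    using \<open>0 < r\<close> by (simp add: w_def power_divide power_mult_distrib sq sum_divide_distrib[symmetric] rsq[symmetric])
  have "\<phi> t = r\<^sup>2 / r"
    unfolding \<phi>_def rsq sum_divide_distrib
    by (intro sum.cong refl) (simp add: m_def w_def sq[symmetric] power2_eq_square)
  then have \<phi>t: "\<phi> t = norm (Apow \<alpha> (v t))" using \<open>0 < r\<close> by (simp add: r_def power2_eq_square)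
  have \<phi>0: "\<phi> 0 \<le> norm (Apow \<alpha> (v 0))"
  proof -
    have "\<phi> 0 = (\<Sum>k<n. (lam k powr \<alpha> * coef (v 0) k) * (exp (- (lam k * t)) * w k))"
      by (simp add: \<phi>_def m_def mult_ac)
    also have "\<dots> \<le> L2_set (\<lambda>k. lam k powr \<alpha> * coef (v 0) k) {..<n} * L2_set (\<lambda>k. exp (- (lam k * t)) * w k) {..<n}"
    proof -
      have "(\<Sum>k<n. (lam k powr \<alpha> * coef (v 0) k) * (exp (- (lam k * t)) * w k))
          \<le> (\<Sum>k<n. \<bar>lam k powr \<alpha> * coef (v 0) k\<bar> * \<bar>exp (- (lam k * t)) * w k\<bar>)"
        by (intro sum_mono) (simp only: abs_mult[symmetric] abs_ge_self)
      then show ?thesis by (rule order.trans[OF _ L2_set_mult_ineq])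
    qed
    also have "L2_set (\<lambda>k. exp (- (lam k * t)) * w k) {..<n} \<le> 1"
    proof -
      have "(\<Sum>k<n. (exp (- (lam k * t)) * w k)\<^sup>2) \<le> (\<Sum>k<n. (w k)\<^sup>2)"
      proof (rule sum_mono)
        fix k
        have "(exp (- (lam k * t)))\<^sup>2 \<le> 1"
          using lam_pos[of k] t by (intro power_le_one) auto
        then show "(exp (- (lam k * t)) * w k)\<^sup>2 \<le> (w k)\<^sup>2"
          unfolding power_mult_distrib using mult_right_mono[of _ 1 "(w k)\<^sup>2"] by simp
      qed
      then show ?thesis using w1 by (simp add: L2_set_def)
    qed
    then have "L2_set (\<lambda>k. lam k powr \<alpha> * coef (v 0) k) {..<n} * L2_set (\<lambda>k. exp (- (lam k * t)) * w k) {..<n}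
        \<le> L2_set (\<lambda>k. lam k powr \<alpha> * coef (v 0) k) {..<n} * 1"
      by (intro mult_left_mono) auto
    finally show ?thesis
      using norm_Apow_wnorm[OF \<alpha>(1) v_span, of 0] t by (simp add: wnorm_eq_L2)
  qed
  have \<phi>': "(\<phi> has_real_derivative - b (u s) (u s) (\<Sum>k<n. m s k *\<^sub>R e k)) (at s)" if s: "0 < s" "s < t" for s
  proof -
    have "(\<phi> has_real_derivative (\<Sum>k<n. m s k * lam k * coef (v s) k
        + m s k * (- lam k * coef (v s) k - b (u s) (u s) (e k)))) (at s)"
      unfolding \<phi>_def m_def using s t coef_derivative[of s]
      by (auto intro!: derivative_eq_intros sum.cong simp: algebra_simps)
    also have "(\<Sum>k<n. m s k * lam k * coef (v s) k + m s k * (- lam k * coef (v s) k - b (u s) (u s) (e k)))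
        = - (\<Sum>k<n. m s k * b (u s) (u s) (e k))"
      unfolding sum_negf[symmetric] by (intro sum.cong refl) (simp add: algebra_simps)
    also have "\<dots> = - b (u s) (u s) (\<Sum>k<n. m s k *\<^sub>R e k)"
      using s t by (subst b_sum3) (auto intro: u_Dom)
    finally show ?thesis .
  qed
  have bound: "- b (u s) (u s) (\<Sum>k<n. m s k *\<^sub>R e k) \<le> \<Psi>' s" if s: "0 < s" "s < t" for s
  proof -
    have s': "s \<in> {0..T}" using s t by auto
    have "wnorm lam n (1/2) (m s) \<le> (t - s) powr (- (\<alpha> + 1/2))"
    proof (rule power2_le_imp_le)
      have "(lam k powr (1/2) * m s k)\<^sup>2 \<le> ((t - s) powr (- (\<alpha> + 1/2)))\<^sup>2 * (w k)\<^sup>2" for k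
      proof -
        have "lam k powr (1/2) * m s k = (lam k powr (\<alpha> + 1/2) * exp (- (lam k * (t - s)))) * w k"
          by (simp add: m_def powr_add)
        moreover have "(lam k powr (\<alpha> + 1/2) * exp (- (lam k * (t - s))))\<^sup>2 \<le> ((t - s) powr (- (\<alpha> + 1/2)))\<^sup>2"
          using s \<alpha> by (intro power_mono powr_exp_le lam_pos) auto
        ultimately show ?thesis
          using mult_right_mono[of _ _ "(w k)\<^sup>2"] by (simp only: power_mult_distrib[of _ "w k"] zero_le_power2)
      qed
      then have "(\<Sum>k<n. (lam k powr (1/2) * m s k)\<^sup>2) \<le> ((t - s) powr (- (\<alpha> + 1/2)))\<^sup>2 * (\<Sum>k<n. (w k)\<^sup>2)"
        unfolding sum_distrib_left by (intro sum_mono)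
      then show "(wnorm lam n (1/2) (m s))\<^sup>2 \<le> ((t - s) powr (- (\<alpha> + 1/2)))\<^sup>2"
        unfolding wnorm_eq_L2 L2_set_def by (simp add: w1 sum_nonneg)
    qed simp
    then have W: "norm (Apow (1/2) (\<Sum>k<n. m s k *\<^sub>R e k)) \<le> (t - s) powr (- (\<alpha> + 1/2))"
      by (simp add: norm_Apow_sum_e)
    have WV: "(\<Sum>k<n. m s k *\<^sub>R e k) \<in> space_V D"
      using sum_e_span span_first_subset span_e_V by blast
    have "- b (u s) (u s) (\<Sum>k<n. m s k *\<^sub>R e k) \<le> b_const * N (u s) * N (u s) * norm (Apow (1/2) (\<Sum>k<n. m s k *\<^sub>R e k))"
      using b_bound[OF u_Dom[OF s'] u_Dom[OF s'] WV] by linarith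
    also have "\<dots> \<le> b_const * N (u s) * N (u s) * (t - s) powr (- (\<alpha> + 1/2))"
      using W b_const_nonneg by (intro mult_left_mono) auto
    also have "\<dots> \<le> \<Psi>' s" using le[OF s] by (simp add: power2_eq_square mult.assoc)
    finally show ?thesis .
  qed
  have "continuous_on {0..t} \<phi>"
    unfolding \<phi>_def m_def using t
    by (intro continuous_intros continuous_on_subset[OF coef_continuous]) auto
  then have "\<phi> t - \<phi> 0 \<le> \<Psi> t - \<Psi> 0"
    using t(1) by (intro derivative_comparison[OF _ _ \<Psi>(1) \<phi>' \<Psi>(2) bound]) auto
  then show ?thesis using \<phi>t \<phi>0 by linarith
qed

end

section \<open>Bounds uniform in the Galerkin dimension\<close>

text \<open>The constant is given a name of its own so that its independence of the dimension and of the
  solution is visible: only \<open>\<sigma>\<close>, \<open>Z\<close>, the bound \<open>R\<close> on the initial energies and \<open>T\<close> enter.\<close>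

definition (in stokes_flow) spacetime_const :: "real \<Rightarrow> real \<Rightarrow> real \<Rightarrow> real \<Rightarrow> real" where
  "spacetime_const \<sigma> Z R T =
    (let K0 = 4 * (b_const * Z) ^ 4 + 4 * (b_const * Z)\<^sup>2 * Z\<^sup>2;
         K\<sigma> = 4 * interp_const \<sigma> ^ 4 + 4 * (interp_const \<sigma>)\<^sup>2 * Z\<^sup>2;
         M0 = (1 + R) * exp (K0 * T);
         c1 = 1 + 8 * M0 * (K0 * (1 + M0)) + 8 * Z ^ 4;
         c2 = 8 * M0;
         M1 = (1 + R) * exp (K\<sigma> * c1 * T + K\<sigma> * c2 * M0)
     in M1 + K\<sigma> * c1 * M1 + K\<sigma> * c2 * M1 * M0)"

text \<open>Here \<open>\<theta>\<close> is the weight with which \<open>1/4\<close> lies between \<open>\<sigma>\<close> and \<open>\<sigma> + 1/2\<close>, \<open>\<delta>\<close> is the part of the quadratic power that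
  is traded for sublinearity, and \<open>q\<close> is the order of the singularity left by Young's inequality.\<close>

definition (in stokes_flow) quarter_const :: "real \<Rightarrow> real \<Rightarrow> real \<Rightarrow> real \<Rightarrow> real \<Rightarrow> real" where
  "quarter_const \<sigma> Z R M T =
    (let \<theta> = 1/2 - 2 * \<sigma>; \<delta> = 2 * \<sigma>; \<rho> = \<theta> * ((1 + \<delta>) / 2); q = (3/4) / (1 - \<rho>);
         c = (M powr (1 - \<theta>)) powr ((1 + \<delta>) / 2);
         L = 2 * b_const * c * (M * T + M + T powr (1 - q) / (1 - q));
         K = R + 8 * b_const * Z\<^sup>2 * T powr (1/4)
     in max 1 ((K + L) powr (1 / \<delta>)))"

context galerkin_setting
begin

abbreviation En_der :: "real \<Rightarrow> real \<Rightarrow> real" where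
  "En_der s t \<equiv> - 2 * En (s + 1/2) (v t) - 2 * b (u t) (u t) (test s t)"

lemma test_zero: "t \<in> {0..T} \<Longrightarrow> test 0 t = v t"
proof -
  assume t: "t \<in> {0..T}"
  have "lam k powr (2 * 0) = 1" for k using lam_pos[of k] by simp
  then show ?thesis using span_expansion[OF v_span[OF t]] by (simp add: test_def)
qed

lemma N_u_le: "t \<in> {0..T} \<Longrightarrow> N (u t) \<le> N (v t) + N (z t)"
  using N_triangle[OF v_Dom z14] by simp

lemma N_v_le: "t \<in> {0..T} \<Longrightarrow> N (v t) \<le> sqrt (norm (Apow 0 (v t)) * norm (Apow (1/2) (v t)))"
  using norm_Apow_midpoint[OF _ v_span, of 0 t] by simp

text \<open>Testing with \<open>v\<close> itself: \<open>b(u,v,v)\<close> vanishes, so only \<open>b(u,z,v)\<close> has to be absorbed.\<close>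

lemma energy_zero:
  assumes t: "t \<in> {0..T}" and Z: "N (z t) \<le> Z"
  shows "En_der 0 t + En (1/2) (v t)
     \<le> (4 * (b_const * Z) ^ 4 + 4 * (b_const * Z)\<^sup>2 * Z\<^sup>2) * (1 + En 0 (v t))"
proof -
  let ?a = "norm (Apow 0 (v t))" and ?d = "norm (Apow (1/2) (v t))"
  have "0 \<le> Z" using Z norm_ge_zero order_trans by blast
  have "b (u t) (u t) (test 0 t) = b (u t) (v t) (v t) + b (u t) (z t) (v t)"
    unfolding test_zero[OF t] by (rule b_add2[OF u_Dom[OF t] v_Dom[OF _ t] z14[OF t] v_V[OF t]]) simp
  also have "b (u t) (v t) (v t) = 0" by (rule b_zero[OF u_Dom[OF t] v_V[OF t]])
  finally have "- 2 * b (u t) (u t) (test 0 t) \<le> 2 * (b_const * N (u t) * N (z t) * ?d)"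
    using b_bound[OF u_Dom[OF t] z14[OF t] v_V[OF t]] by linarith
  also have "\<dots> \<le> 2 * (b_const * (sqrt (?a * ?d) + Z) * Z * ?d)"
    using N_u_le[OF t] N_v_le[OF t] Z \<open>0 \<le> Z\<close> b_const_nonneg
    by (intro mult_left_mono mult_right_mono mult_mono mult_nonneg_nonneg) auto
  also have "\<dots> = 2 * ((b_const * Z) * (sqrt (?a * ?d) + Z) * ?d)" by (simp only: mult_ac)
  also have "\<dots> \<le> ?d\<^sup>2 + 4 * (b_const * Z) ^ 4 * ?a\<^sup>2 + 4 * (b_const * Z)\<^sup>2 * Z\<^sup>2"
    using \<open>0 \<le> Z\<close> b_const_nonneg by (intro absorb_into_dissipation) auto
  finally have *: "- 2 * b (u t) (u t) (test 0 t)
      \<le> ?d\<^sup>2 + 4 * (b_const * Z) ^ 4 * ?a\<^sup>2 + 4 * (b_const * Z)\<^sup>2 * Z\<^sup>2" .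
  have "0 \<le> 4 * (b_const * Z) ^ 4" "0 \<le> 4 * (b_const * Z)\<^sup>2 * Z\<^sup>2 * ?a\<^sup>2" by auto
  then have "4 * (b_const * Z) ^ 4 * ?a\<^sup>2 + 4 * (b_const * Z)\<^sup>2 * Z\<^sup>2
      \<le> (4 * (b_const * Z) ^ 4 + 4 * (b_const * Z)\<^sup>2 * Z\<^sup>2) * (1 + ?a\<^sup>2)"
    unfolding distrib_left distrib_right by linarith
  then show ?thesis using * by simp
qed

text \<open>Testing with \<open>A^{2\<sigma>} v\<close>. Here \<open>b(u,v,\<cdot>)\<close> does not vanish, but the intermediate bound keeps it at the
  critical order: half of the dissipation absorbs it, at the price of the coefficient
  \<open>|u|_{1/4}^4\<close>.\<close>

lemma energy_sigma:
  assumes t: "t \<in> {0..T}" and \<sigma>: "0 < \<sigma>" "\<sigma> < 1/4"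
    and z: "z t \<in> Dom (1/4 + \<sigma>)" "norm (Apow (1/4 + \<sigma>) (z t)) \<le> Z"
  shows "En_der \<sigma> t + En (\<sigma> + 1/2) (v t)
     \<le> (4 * interp_const \<sigma> ^ 4 + 4 * (interp_const \<sigma>)\<^sup>2 * Z\<^sup>2) * (1 + N (u t) ^ 4) * (1 + En \<sigma> (v t))"
proof -
  let ?a = "norm (Apow \<sigma> (v t))" and ?d = "norm (Apow (\<sigma> + 1/2) (v t))" and ?C = "interp_const \<sigma>" and ?U = "N (u t)"
  have C: "0 \<le> ?C" by (rule interp_const_nonneg[OF \<sigma>])
  have "0 \<le> Z" using z norm_ge_zero order_trans by blast
  have W: "norm (Apow (1/2 - \<sigma>) (test \<sigma> t)) = ?d"
    using norm_Apow_test[of "1/2 - \<sigma>" \<sigma> t] \<sigma> t by (simp add: add.commute)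
  have WV: "test \<sigma> t \<in> space_V D" using test_span span_first_subset span_e_V by blast
  have "b (u t) (u t) (test \<sigma> t) = b (u t) (v t) (test \<sigma> t) + b (u t) (z t) (test \<sigma> t)"
    by (rule b_add2[OF u_Dom[OF t] v_Dom[OF _ t] z14[OF t] WV]) simp
  then have "- 2 * b (u t) (u t) (test \<sigma> t) \<le> 2 * (\<bar>b (u t) (v t) (test \<sigma> t)\<bar> + \<bar>b (u t) (z t) (test \<sigma> t)\<bar>)"
    using abs_ge_minus_self[of "b (u t) (v t) (test \<sigma> t)"] abs_ge_minus_self[of "b (u t) (z t) (test \<sigma> t)"] by argo
  also have "\<dots> \<le> 2 * (?C * ?U * norm (Apow (1/4 + \<sigma>) (v t)) * ?d + ?C * ?U * norm (Apow (1/4 + \<sigma>) (z t)) * ?d)"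
    using b_interpolated[OF \<sigma> u_Dom[OF t] v_Dom[OF _ t] test_span[of \<sigma> t]]
      b_interpolated[OF \<sigma> u_Dom[OF t] z(1) test_span[of \<sigma> t]] \<sigma>
    unfolding W by (intro mult_left_mono add_mono) auto
  also have "\<dots> = 2 * (?C * ?U * (norm (Apow (1/4 + \<sigma>) (v t)) + norm (Apow (1/4 + \<sigma>) (z t))) * ?d)"
    by (simp add: algebra_simps)
  also have "\<dots> \<le> 2 * (?C * ?U * (sqrt (?a * ?d) + Z) * ?d)"
    using norm_Apow_midpoint[OF _ v_span[OF t], of \<sigma>] z(2) \<sigma> C
    by (intro mult_left_mono mult_right_mono add_mono mult_nonneg_nonneg) (auto simp: add.commute)
  also have "\<dots> \<le> ?d\<^sup>2 + 4 * (?C * ?U) ^ 4 * ?a\<^sup>2 + 4 * (?C * ?U)\<^sup>2 * Z\<^sup>2"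
    using \<open>0 \<le> Z\<close> C by (intro absorb_into_dissipation) auto
  finally have *: "- 2 * b (u t) (u t) (test \<sigma> t) \<le> ?d\<^sup>2 + 4 * (?C * ?U) ^ 4 * ?a\<^sup>2 + 4 * (?C * ?U)\<^sup>2 * Z\<^sup>2" .
  have 1: "?U ^ 4 * ?a\<^sup>2 \<le> (1 + ?U ^ 4) * (1 + ?a\<^sup>2)"
    by (intro mult_mono) auto
  have "0 \<le> (?U\<^sup>2 - 1)\<^sup>2" by simp
  then have "?U\<^sup>2 \<le> 1 + ?U ^ 4" by (simp add: power2_diff) (smt (verit) zero_le_power2)
  also have "\<dots> \<le> (1 + ?U ^ 4) * (1 + ?a\<^sup>2)"
    using mult_left_mono[of 1 "1 + ?a\<^sup>2" "1 + ?U ^ 4"] by simp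
  finally have 2: "?U\<^sup>2 \<le> (1 + ?U ^ 4) * (1 + ?a\<^sup>2)" .
  have "4 * (?C * ?U) ^ 4 * ?a\<^sup>2 + 4 * (?C * ?U)\<^sup>2 * Z\<^sup>2
      = 4 * ?C ^ 4 * (?U ^ 4 * ?a\<^sup>2) + 4 * ?C\<^sup>2 * Z\<^sup>2 * ?U\<^sup>2"
    by (simp add: power_mult_distrib)
  also have "\<dots> \<le> 4 * ?C ^ 4 * ((1 + ?U ^ 4) * (1 + ?a\<^sup>2)) + 4 * ?C\<^sup>2 * Z\<^sup>2 * ((1 + ?U ^ 4) * (1 + ?a\<^sup>2))"
    using 1 2 by (intro add_mono mult_left_mono) auto
  also have "\<dots> = (4 * ?C ^ 4 + 4 * ?C\<^sup>2 * Z\<^sup>2) * (1 + ?U ^ 4) * (1 + ?a\<^sup>2)"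
    by (simp only: distrib_right mult.assoc)
  finally show ?thesis using * by simp
qed

text \<open>The energy inequality at level 0 bounds the dissipation by a constant minus the derivative of \<open>En 0\<close>;
  hence so is \<open>|u|_{1/4}^4\<close>, the growth rate at level \<open>\<sigma>\<close>. Gronwall's lemma with the antiderivative
  \<open>K\<sigma> c1 s - K\<sigma> c2 En 0\<close> of that rate then bounds \<open>En \<sigma>\<close>. The function \<open>\<Theta>\<close> carries the
  integral bound on the dissipation at level \<open>\<sigma>\<close>.\<close>

lemma spacetime_bound:
  fixes \<sigma> Z R :: real
  assumes T: "0 < T" and \<sigma>: "0 < \<sigma>" "\<sigma> < 1/4"
    and z: "\<And>t. t \<in> {0..T} \<Longrightarrow> N (z t) \<le> Z"
      "\<And>t. t \<in> {0..T} \<Longrightarrow> z t \<in> Dom (1/4 + \<sigma>)"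
      "\<And>t. t \<in> {0..T} \<Longrightarrow> norm (Apow (1/4 + \<sigma>) (z t)) \<le> Z"
    and init: "En 0 (v 0) \<le> R" "En \<sigma> (v 0) \<le> R"
  defines "M \<equiv> spacetime_const \<sigma> Z R T"
  shows "t \<in> {0..T} \<Longrightarrow> En \<sigma> (v t) \<le> M"
    and "\<exists>\<Theta> \<Theta>'. continuous_on {0..T} \<Theta> \<and> (\<forall>s\<in>{0..T}. 0 \<le> \<Theta> s \<and> \<Theta> s \<le> M) \<and>
      (\<forall>s. 0 < s \<and> s < T \<longrightarrow> (\<Theta> has_real_derivative \<Theta>' s) (at s) \<and> En (\<sigma> + 1/2) (v s) \<le> M - \<Theta>' s)"
proof -
  define K0 where "K0 = 4 * (b_const * Z) ^ 4 + 4 * (b_const * Z)\<^sup>2 * Z\<^sup>2"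
  define K\<sigma> where "K\<sigma> = 4 * interp_const \<sigma> ^ 4 + 4 * (interp_const \<sigma>)\<^sup>2 * Z\<^sup>2"
  define M0 where "M0 = (1 + R) * exp (K0 * T)"
  define c1 where "c1 = 1 + 8 * M0 * (K0 * (1 + M0)) + 8 * Z ^ 4"
  define c2 where "c2 = 8 * M0"
  define M1 where "M1 = (1 + R) * exp (K\<sigma> * c1 * T + K\<sigma> * c2 * M0)"
  have M_eq: "M = M1 + K\<sigma> * c1 * M1 + K\<sigma> * c2 * M1 * M0"
    unfolding M_def spacetime_const_def Let_def M1_def c1_def c2_def M0_def K\<sigma>_def K0_def ..
  have R: "0 \<le> R" using init(1) zero_le_power2 order_trans by blast
  have K: "0 \<le> K0" "0 \<le> K\<sigma>" by (auto simp: K0_def K\<sigma>_def)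
  have "0 \<le> M0" using R by (simp add: M0_def)
  have "0 \<le> M1" using R by (simp add: M1_def)
  have c: "0 \<le> c1" "0 \<le> c2" using \<open>0 \<le> M0\<close> K by (auto simp: c1_def c2_def)
  have e0: "En_der 0 t + En (1/2) (v t) \<le> K0 * (1 + En 0 (v t))" if "t \<in> {0..T}" for t
    unfolding K0_def by (rule energy_zero[OF that z(1)[OF that]])
  have E0: "1 + En 0 (v t) \<le> M0" if t: "t \<in> {0..T}" for t
  proof -
    have "1 + En 0 (v t) \<le> (1 + En 0 (v 0)) * exp (K0 * t - K0 * 0)"
    proof (rule gronwall_derivative[where f' = "En_der 0" and g' = "\<lambda>_. K0"])
      show "continuous_on {0..t} (\<lambda>t. 1 + En 0 (v t))"
        using t by (intro continuous_intros continuous_on_subset[OF En_continuous]) auto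
      fix s assume s: "0 < s" "s < t"
      show "((\<lambda>t. 1 + En 0 (v t)) has_real_derivative En_der 0 s) (at s)"
        using DERIV_add[OF DERIV_const[of 1] energy_identity[of 0 s]] s t by simp
      show "En_der 0 s \<le> K0 * (1 + En 0 (v s))"
      proof -
        have "s \<in> {0..T}" "0 \<le> En (1/2) (v s)" using s t by auto
        then show ?thesis using e0[of s] by linarith
      qed
    qed (use t in \<open>auto intro!: continuous_intros derivative_eq_intros\<close>)
    also have "\<dots> \<le> M0"
      unfolding M0_def using init t K R by (intro mult_mono) (auto intro!: mult_left_mono)
    finally show ?thesis .
  qed
  have half: "En (1/2) (v t) \<le> K0 * (1 + M0) - En_der 0 t" if "t \<in> {0..T}" for t
  proof -
    have "K0 * (1 + En 0 (v t)) \<le> K0 * (1 + M0)" using E0[OF that] K by (intro mult_left_mono) auto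
    then show ?thesis using e0[OF that] by linarith
  qed
  have U4: "1 + N (u t) ^ 4 \<le> c1 - c2 * En_der 0 t" if t: "t \<in> {0..T}" for t
  proof -
    have "N (u t) ^ 4 \<le> (N (v t) + Z) ^ 4"
      using N_u_le[OF t] z(1)[OF t] by (intro power_mono) auto
    also have "\<dots> \<le> 8 * (N (v t) ^ 4 + Z ^ 4)" by (rule power4_sum_le)
    also have "N (v t) ^ 4 \<le> En 0 (v t) * En (1/2) (v t)"
    proof -
      have "N (v t) ^ 4 \<le> (sqrt (norm (Apow 0 (v t)) * norm (Apow (1/2) (v t)))) ^ (2 * 2)"
        using power_mono[OF N_v_le[OF t], of 4] by simp
      also have "\<dots> = En 0 (v t) * En (1/2) (v t)"
        unfolding power_mult by (simp add: power_mult_distrib)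
      finally show ?thesis .
    qed
    also have "En 0 (v t) * En (1/2) (v t) \<le> M0 * (K0 * (1 + M0) - En_der 0 t)"
      using E0[OF t] half[OF t] \<open>0 \<le> M0\<close> by (intro mult_mono) auto
    finally show ?thesis by (simp add: c1_def c2_def algebra_simps)
  qed
  have pos: "0 \<le> c1 - c2 * En_der 0 t" if "t \<in> {0..T}" for t
  proof -
    have "0 \<le> N (u t) ^ 4" by simp
    then show ?thesis using U4[OF that] by linarith
  qed
  have e\<sigma>: "En_der \<sigma> t + En (\<sigma> + 1/2) (v t) \<le> (K\<sigma> * c1 - K\<sigma> * c2 * En_der 0 t) * (1 + En \<sigma> (v t))"
    if t: "t \<in> {0..T}" for t
  proof -
    have "En_der \<sigma> t + En (\<sigma> + 1/2) (v t) \<le> K\<sigma> * (1 + N (u t) ^ 4) * (1 + En \<sigma> (v t))"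
      unfolding K\<sigma>_def by (rule energy_sigma[OF t \<sigma> z(2)[OF t] z(3)[OF t]])
    also have "\<dots> \<le> K\<sigma> * (c1 - c2 * En_der 0 t) * (1 + En \<sigma> (v t))"
      using U4[OF t] K by (intro mult_right_mono mult_left_mono) auto
    finally show ?thesis by (simp only: right_diff_distrib mult.assoc)
  qed
  have E\<sigma>: "1 + En \<sigma> (v t) \<le> M1" if t: "t \<in> {0..T}" for t
  proof -
    let ?g = "\<lambda>s. K\<sigma> * c1 * s - K\<sigma> * c2 * En 0 (v s)"
    have "1 + En \<sigma> (v t) \<le> (1 + En \<sigma> (v 0)) * exp (?g t - ?g 0)"
    proof (rule gronwall_derivative[where f' = "En_der \<sigma>" and g' = "\<lambda>s. K\<sigma> * c1 - K\<sigma> * c2 * En_der 0 s"])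
      show "continuous_on {0..t} (\<lambda>t. 1 + En \<sigma> (v t))" "continuous_on {0..t} ?g"
        using t \<sigma> by (intro continuous_intros continuous_on_subset[OF En_continuous]; auto)+
      fix s assume s: "0 < s" "s < t"
      show "((\<lambda>t. 1 + En \<sigma> (v t)) has_real_derivative En_der \<sigma> s) (at s)"
        using DERIV_add[OF DERIV_const[of 1] energy_identity[of \<sigma> s]] s t \<sigma> by simp
      show "(?g has_real_derivative K\<sigma> * c1 - K\<sigma> * c2 * En_der 0 s) (at s)"
        using DERIV_diff[OF DERIV_cmult[OF DERIV_ident, of "K\<sigma> * c1"] DERIV_cmult[OF energy_identity[of 0 s], of "K\<sigma> * c2"]] s t
        by simp
      have "s \<in> {0..T}" "0 \<le> En (\<sigma> + 1/2) (v s)" using s t by auto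
      then show "En_der \<sigma> s \<le> (K\<sigma> * c1 - K\<sigma> * c2 * En_der 0 s) * (1 + En \<sigma> (v s))"
        using e\<sigma>[of s] by linarith
    qed (use t in auto)
    also have "\<dots> \<le> M1"
    proof -
      have "K\<sigma> * c2 * En 0 (v 0) \<le> K\<sigma> * c2 * M0" "0 \<le> K\<sigma> * c2 * En 0 (v t)" "K\<sigma> * c1 * t \<le> K\<sigma> * c1 * T"
        using E0[of 0] t K c by (auto intro!: mult_left_mono mult_nonneg_nonneg)
      then show ?thesis unfolding M1_def using init R by (intro mult_mono) auto
    qed
    finally show ?thesis .
  qed
  have M: "M1 \<le> M" "K\<sigma> * c1 * M1 \<le> M" "K\<sigma> * c2 * M1 * M0 + M1 \<le> M"
    using \<open>0 \<le> M1\<close> \<open>0 \<le> M0\<close> K c by (auto simp: M_eq)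
  show "En \<sigma> (v t) \<le> M" if "t \<in> {0..T}" using E\<sigma>[OF that] M by simp
  \<comment> \<open>The inequality \<open>e\<sigma>\<close> with \<open>1 + En \<sigma>\<close> replaced by its bound \<open>M1\<close>, solved for the dissipation.\<close>
  let ?\<Theta> = "\<lambda>s. K\<sigma> * c2 * M1 * En 0 (v s) + En \<sigma> (v s)"
  let ?\<Theta>' = "\<lambda>s. K\<sigma> * c2 * M1 * En_der 0 s + En_der \<sigma> s"
  have \<Theta>1: "continuous_on {0..T} ?\<Theta>" using \<sigma> by (intro continuous_intros En_continuous) auto
  have \<Theta>2: "\<forall>s\<in>{0..T}. 0 \<le> ?\<Theta> s \<and> ?\<Theta> s \<le> M"
  proof (intro ballI conjI)
    fix s assume s: "s \<in> {0..T}"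
    show "0 \<le> ?\<Theta> s" using K c \<open>0 \<le> M1\<close> by simp
    have "?\<Theta> s \<le> K\<sigma> * c2 * M1 * M0 + M1"
      using E0[OF s] E\<sigma>[OF s] K c \<open>0 \<le> M1\<close> by (intro add_mono mult_left_mono) auto
    then show "?\<Theta> s \<le> M" using M by linarith
  qed
  have \<Theta>3: "(?\<Theta> has_real_derivative ?\<Theta>' s) (at s) \<and> En (\<sigma> + 1/2) (v s) \<le> M - ?\<Theta>' s" if s: "0 < s" "s < T" for s
  proof
    show "(?\<Theta> has_real_derivative ?\<Theta>' s) (at s)"
      using DERIV_add[OF DERIV_cmult[OF energy_identity[of 0 s], of "K\<sigma> * c2 * M1"] energy_identity[of \<sigma> s]] s \<sigma> by simp
    have s': "s \<in> {0..T}" using s by auto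
    have "(K\<sigma> * c1 - K\<sigma> * c2 * En_der 0 s) * (1 + En \<sigma> (v s)) \<le> (K\<sigma> * c1 - K\<sigma> * c2 * En_der 0 s) * M1"
    proof (intro mult_left_mono E\<sigma>[OF s'])
      have "0 \<le> K\<sigma> * (c1 - c2 * En_der 0 s)" using K pos[OF s'] by (intro mult_nonneg_nonneg)
      then show "0 \<le> K\<sigma> * c1 - K\<sigma> * c2 * En_der 0 s" by (simp only: right_diff_distrib mult.assoc)
    qed
    also have "\<dots> = K\<sigma> * c1 * M1 - K\<sigma> * c2 * M1 * En_der 0 s"
    proof -
      have "(p - r * y) * m = p * m - r * m * y" for p r y m :: real by (simp add: algebra_simps)
      then show ?thesis .
    qed
    finally show "En (\<sigma> + 1/2) (v s) \<le> M - ?\<Theta>' s" using e\<sigma>[OF s'] M(2) by linarith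
  qed
  show "\<exists>\<Theta> \<Theta>'. continuous_on {0..T} \<Theta> \<and> (\<forall>s\<in>{0..T}. 0 \<le> \<Theta> s \<and> \<Theta> s \<le> M) \<and>
      (\<forall>s. 0 < s \<and> s < T \<longrightarrow> (\<Theta> has_real_derivative \<Theta>' s) (at s) \<and> En (\<sigma> + 1/2) (v s) \<le> M - \<Theta>' s)"
  proof (rule exI[of _ ?\<Theta>], rule exI[of _ ?\<Theta>'], intro conjI allI impI)
    show "continuous_on {0..T} ?\<Theta>" by (rule \<Theta>1)
    show "\<forall>s\<in>{0..T}. 0 \<le> ?\<Theta> s \<and> ?\<Theta> s \<le> M" by (rule \<Theta>2)
    fix s assume "0 < s \<and> s < T"
    then show "(?\<Theta> has_real_derivative ?\<Theta>' s) (at s)" "En (\<sigma> + 1/2) (v s) \<le> M - ?\<Theta>' s"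
      using \<Theta>3 by auto
  qed
qed

text \<open>At the time where \<open>|v|_{1/4}\<close> attains its maximum \<open>Y\<close>, one factor \<open>|v|_{1/4}^{1-\<delta>}\<close> of the quadratic term is
  estimated by \<open>Y^{1-\<delta>}\<close>. The other, \<open>|v|_{1/4}^{1+\<delta>}\<close>, is by interpolation at most a constant times
  \<open>X^\<rho>\<close>, with \<open>X\<close> the dissipation at level \<open>\<sigma>\<close>. The choice \<open>\<delta> = 2\<sigma>\<close> gives \<open>\<rho> < 1/4\<close>, which
  is exactly what keeps the product with \<open>(t-s)^{-3/4}\<close> integrable.\<close>

lemma quarter_bound:
  fixes \<sigma> Z R M :: real and \<Theta> \<Theta>' :: "real \<Rightarrow> real"
  assumes T: "0 < T" and \<sigma>: "0 < \<sigma>" "\<sigma> \<le> 1/8"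
    and Z: "0 \<le> Z" "\<And>t. t \<in> {0..T} \<Longrightarrow> N (z t) \<le> Z" and R: "N (v 0) \<le> R"
    and M: "\<And>t. t \<in> {0..T} \<Longrightarrow> En \<sigma> (v t) \<le> M"
    and \<Theta>: "continuous_on {0..T} \<Theta>" "\<And>s. s \<in> {0..T} \<Longrightarrow> 0 \<le> \<Theta> s \<and> \<Theta> s \<le> M"
      "\<And>s. 0 < s \<Longrightarrow> s < T \<Longrightarrow> (\<Theta> has_real_derivative \<Theta>' s) (at s)"
      "\<And>s. 0 < s \<Longrightarrow> s < T \<Longrightarrow> En (\<sigma> + 1/2) (v s) \<le> M - \<Theta>' s"
    and t: "t \<in> {0..T}"
  shows "N (v t) \<le> quarter_const \<sigma> Z R M T"
proof -
  define \<theta> where "\<theta> = 1/2 - 2 * \<sigma>"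
  define \<delta> where "\<delta> = 2 * \<sigma>"
  define \<rho> where "\<rho> = \<theta> * ((1 + \<delta>) / 2)"
  define q where "q = (3/4) / (1 - \<rho>)"
  define c where "c = (M powr (1 - \<theta>)) powr ((1 + \<delta>) / 2)"
  define L where "L = 2 * b_const * c * (M * T + M + T powr (1 - q) / (1 - q))"
  define K where "K = R + 8 * b_const * Z\<^sup>2 * T powr (1/4)"
  have const: "quarter_const \<sigma> Z R M T = max 1 ((K + L) powr (1 / \<delta>))"
    unfolding quarter_const_def Let_def K_def L_def c_def q_def \<rho>_def \<theta>_def \<delta>_def ..
  have M0: "0 \<le> M" using \<Theta>(2)[of 0] T by auto
  have R0: "0 \<le> R" using R norm_ge_zero order_trans by blast
  have \<theta>: "0 \<le> \<theta>" "\<theta> \<le> 1" and \<delta>: "0 < \<delta>" "\<delta> \<le> 1" using \<sigma> by (auto simp: \<theta>_def \<delta>_def)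
  have "\<rho> = 1/4 - \<sigma> / 2 - 2 * (\<sigma> * \<sigma>)" unfolding \<rho>_def \<theta>_def \<delta>_def by (simp add: field_simps)
  moreover have "0 < \<sigma> * \<sigma>" "0 \<le> \<rho>" using \<sigma> \<theta> \<delta> by (auto simp: \<rho>_def)
  ultimately have \<rho>: "0 \<le> \<rho>" "\<rho> < 1/4" using \<sigma>(1) by linarith+
  then have q: "q < 1" by (simp add: q_def)
  have L: "0 \<le> L" and K: "0 \<le> K" and c0: "0 \<le> c"
    using b_const_nonneg M0 T q R0 by (auto simp: L_def K_def c_def intro!: mult_nonneg_nonneg add_nonneg_nonneg)
  have "\<exists>tm\<in>{0..T}. \<forall>s\<in>{0..T}. N (v s) \<le> N (v tm)"
    using T by (intro continuous_attains_sup norm_continuous) auto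
  then obtain tm where tm: "tm \<in> {0..T}" and sup: "\<And>s. s \<in> {0..T} \<Longrightarrow> N (v s) \<le> N (v tm)" by blast
  define Y where "Y = N (v tm)"
  have "Y \<le> K + L * Y powr (1 - \<delta>)"
  proof (cases "tm = 0")
    case True
    have "0 \<le> 8 * b_const * Z\<^sup>2 * T powr (1/4)" using b_const_nonneg by simp
    then have "Y \<le> K" using R unfolding Y_def K_def True by linarith
    moreover have "0 \<le> L * Y powr (1 - \<delta>)" using L by simp
    ultimately show ?thesis by linarith
  next
    case False
    then have tm': "0 < tm" "tm \<le> T" using tm by auto
    let ?p = "2 * b_const * c * Y powr (1 - \<delta>)"
    let ?\<Psi> = "\<lambda>s. ?p * (M * s - \<Theta> s + kernel_prim tm q s) + 2 * b_const * Z\<^sup>2 * kernel_prim tm (3/4) s"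
    let ?\<Psi>' = "\<lambda>s. ?p * (M - \<Theta>' s + (tm - s) powr (- q)) + 2 * b_const * Z\<^sup>2 * (tm - s) powr (- (3/4))"
    have "N (v tm) \<le> N (v 0) + (?\<Psi> tm - ?\<Psi> 0)"
    proof (rule mild_bound[OF tm', where \<Psi> = ?\<Psi> and \<Psi>' = ?\<Psi>'])
      show "continuous_on {0..tm} ?\<Psi>"
        using tm' q by (intro continuous_intros continuous_on_subset[OF \<Theta>(1)] kernel_prim_continuous) auto
      fix s assume s: "0 < s" "s < tm"
      then have s': "s \<in> {0..T}" "s < T" using tm' by auto
      show "(?\<Psi> has_real_derivative ?\<Psi>' s) (at s)"
        by (intro DERIV_add DERIV_cmult DERIV_diff DERIV_cmult_Id \<Theta>(3) kernel_prim_derivative s s' q) simp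
      let ?y = "N (v s)" and ?X = "En (\<sigma> + 1/2) (v s)" and ?\<tau> = "tm - s"
      have "?y\<^sup>2 \<le> En \<sigma> (v s) powr (1 - \<theta>) * ?X powr \<theta>"
        by (rule En_interpolation[OF _ _ \<theta> _ v_span[OF s'(1)]]) (use \<sigma> in \<open>auto simp: \<theta>_def algebra_simps\<close>)
      also have "\<dots> \<le> M powr (1 - \<theta>) * ?X powr \<theta>"
        using M[OF s'(1)] \<theta> by (intro mult_right_mono powr_mono2) auto
      finally have "(?y\<^sup>2) powr ((1 + \<delta>) / 2) \<le> (M powr (1 - \<theta>) * ?X powr \<theta>) powr ((1 + \<delta>) / 2)"
        using \<delta> by (intro powr_mono2) auto
      also have "\<dots> = c * ?X powr \<rho>"
        by (simp add: powr_mult c_def \<rho>_def powr_powr)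
      also have "(?y\<^sup>2) powr ((1 + \<delta>) / 2) = ?y powr (1 + \<delta>)"
      proof -
        have "?y\<^sup>2 = ?y powr 2" by (simp add: powr_numeral)
        moreover have "2 * ((1 + \<delta>) / 2) = 1 + \<delta>" by (simp add: field_simps)
        ultimately show ?thesis by (simp only: powr_powr)
      qed
      finally have y1: "?y powr (1 + \<delta>) \<le> c * ?X powr \<rho>" .
      have "?y\<^sup>2 = ?y powr (1 - \<delta>) * ?y powr (1 + \<delta>)"
        by (simp add: powr_add[symmetric] powr_numeral)
      also have "\<dots> \<le> Y powr (1 - \<delta>) * (c * ?X powr \<rho>)"
        using y1 sup[OF s'(1)] \<delta> by (intro mult_mono powr_mono2) (auto simp: Y_def)
      finally have "?\<tau> powr (- (3/4)) * ?y\<^sup>2 \<le> ?\<tau> powr (- (3/4)) * (Y powr (1 - \<delta>) * (c * ?X powr \<rho>))"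
        by (intro mult_left_mono) auto
      also have "\<dots> = Y powr (1 - \<delta>) * c * (?\<tau> powr (- (3/4)) * ?X powr \<rho>)" by (simp only: mult_ac)
      also have "\<dots> \<le> Y powr (1 - \<delta>) * c * (?X + ?\<tau> powr (- q))"
        unfolding q_def using s \<rho> c0 by (intro mult_left_mono singular_young) auto
      also have "\<dots> \<le> Y powr (1 - \<delta>) * c * (M - \<Theta>' s + ?\<tau> powr (- q))"
        using \<Theta>(4)[OF s(1) s'(2)] c0 by (intro mult_left_mono add_right_mono) auto
      finally have y2: "?\<tau> powr (- (3/4)) * ?y\<^sup>2 \<le> Y powr (1 - \<delta>) * c * (M - \<Theta>' s + ?\<tau> powr (- q))" .
      have "(N (u s))\<^sup>2 \<le> (?y + Z)\<^sup>2"
        using N_u_le[OF s'(1)] Z(2)[OF s'(1)] by (intro power_mono) auto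
      also have "\<dots> \<le> 2 * ?y\<^sup>2 + 2 * Z\<^sup>2"
        using zero_le_power2[of "?y - Z"] unfolding power2_sum power2_diff by linarith
      finally have "b_const * (N (u s))\<^sup>2 * ?\<tau> powr (- (3/4)) \<le> b_const * (2 * ?y\<^sup>2 + 2 * Z\<^sup>2) * ?\<tau> powr (- (3/4))"
        using b_const_nonneg by (intro mult_right_mono mult_left_mono) auto
      also have "\<dots> = 2 * b_const * (?\<tau> powr (- (3/4)) * ?y\<^sup>2) + 2 * b_const * Z\<^sup>2 * ?\<tau> powr (- (3/4))"
        by (simp add: algebra_simps)
      also have "\<dots> \<le> 2 * b_const * (Y powr (1 - \<delta>) * c * (M - \<Theta>' s + ?\<tau> powr (- q))) + 2 * b_const * Z\<^sup>2 * ?\<tau> powr (- (3/4))"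
        using y2 b_const_nonneg by (intro add_right_mono mult_left_mono) auto
      also have "\<dots> = ?\<Psi>' s" by (simp only: mult_ac)
      finally show "b_const * (N (u s))\<^sup>2 * ?\<tau> powr (- (1/4 + 1/2)) \<le> ?\<Psi>' s" by simp
    qed auto
    also have "\<dots> \<le> R + (?p * (M * T + M + T powr (1 - q) / (1 - q)) + 2 * b_const * Z\<^sup>2 * (T powr (1/4) / (1/4)))"
    proof (rule add_mono[OF R])
      have p: "0 \<le> ?p" using b_const_nonneg c0 by simp
      have k1: "kernel_prim tm q tm - kernel_prim tm q 0 \<le> T powr (1 - q) / (1 - q)"
        using tm' q by (intro kernel_prim_diff_le) auto
      have k2: "kernel_prim tm (3/4) tm - kernel_prim tm (3/4) 0 \<le> T powr (1/4) / (1/4)"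
        using kernel_prim_diff_le[of "3/4" tm T] tm' by simp
      have "M * tm \<le> M * T" using M0 tm' by (intro mult_left_mono) auto
      moreover have "\<Theta> 0 - \<Theta> tm \<le> M" using \<Theta>(2)[of 0] \<Theta>(2)[OF tm] T by force
      ultimately have "(M * tm - \<Theta> tm + kernel_prim tm q tm) - (M * 0 - \<Theta> 0 + kernel_prim tm q 0)
          \<le> M * T + M + T powr (1 - q) / (1 - q)" using k1 by linarith
      from mult_left_mono[OF this p] mult_left_mono[OF k2, of "2 * b_const * Z\<^sup>2"] b_const_nonneg
      show "?\<Psi> tm - ?\<Psi> 0 \<le> ?p * (M * T + M + T powr (1 - q) / (1 - q)) + 2 * b_const * Z\<^sup>2 * (T powr (1/4) / (1/4))"
        unfolding right_diff_distrib by simp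
    qed
    also have "\<dots> = K + L * Y powr (1 - \<delta>)" by (simp add: K_def L_def algebra_simps)
    finally show ?thesis by (simp only: Y_def[symmetric])
  qed
  then have "Y \<le> max 1 ((K + L) powr (1 / \<delta>))"
    by (rule sublinear_bound) (use K L \<delta> in \<open>auto simp: Y_def\<close>)
  then show ?thesis using sup[OF t] unfolding const Y_def by linarith
qed

text \<open>Once \<open>|u|_{1/4}\<close> is bounded the mild formulation is linear in known quantities.\<close>

lemma power_bound:
  fixes \<gamma> Y Z R :: real
  assumes \<gamma>: "0 \<le> \<gamma>" "\<gamma> < 1/2" and Y: "\<And>t. t \<in> {0..T} \<Longrightarrow> N (v t) \<le> Y"
    and Z: "\<And>t. t \<in> {0..T} \<Longrightarrow> N (z t) \<le> Z" and R: "norm (Apow \<gamma> (v 0)) \<le> R"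
    and t: "t \<in> {0..T}"
  shows "norm (Apow \<gamma> (v t)) \<le> R + b_const * (Y + Z)\<^sup>2 * (T powr (1/2 - \<gamma>) / (1/2 - \<gamma>))"
proof (cases "t = 0")
  case True
  have "0 \<le> b_const * (Y + Z)\<^sup>2 * (T powr (1/2 - \<gamma>) / (1/2 - \<gamma>))"
    using b_const_nonneg \<gamma> by (intro mult_nonneg_nonneg divide_nonneg_nonneg) auto
  then show ?thesis using True R by simp
next
  case False
  then have t': "0 < t" "t \<le> T" using t by auto
  have q: "\<gamma> + 1/2 < 1" using \<gamma> by simp
  let ?k = "b_const * (Y + Z)\<^sup>2"
  have "norm (Apow \<gamma> (v t)) \<le> norm (Apow \<gamma> (v 0)) + (?k * kernel_prim t (\<gamma> + 1/2) t - ?k * kernel_prim t (\<gamma> + 1/2) 0)"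
  proof (rule mild_bound[OF t', where \<Psi>' = "\<lambda>s. ?k * (t - s) powr (- (\<gamma> + 1/2))"])
    show "continuous_on {0..t} (\<lambda>s. ?k * kernel_prim t (\<gamma> + 1/2) s)"
      by (intro continuous_intros kernel_prim_continuous q)
    fix s assume s: "0 < s" "s < t"
    then have s': "s \<in> {0..T}" using t' by auto
    show "((\<lambda>s. ?k * kernel_prim t (\<gamma> + 1/2) s) has_real_derivative ?k * (t - s) powr (- (\<gamma> + 1/2))) (at s)"
      by (intro DERIV_cmult kernel_prim_derivative q s)
    have "(N (u s))\<^sup>2 \<le> (Y + Z)\<^sup>2"
      using N_u_le[OF s'] Y[OF s'] Z[OF s'] by (intro power_mono) auto
    then show "b_const * (N (u s))\<^sup>2 * (t - s) powr (- (\<gamma> + 1/2)) \<le> ?k * (t - s) powr (- (\<gamma> + 1/2))"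
      using b_const_nonneg by (intro mult_right_mono mult_left_mono) auto
  qed (use \<gamma> in auto)
  moreover have "?k * (kernel_prim t (\<gamma> + 1/2) t - kernel_prim t (\<gamma> + 1/2) 0) \<le> ?k * (T powr (1 - (\<gamma> + 1/2)) / (1 - (\<gamma> + 1/2)))"
    using t' q b_const_nonneg by (intro mult_left_mono kernel_prim_diff_le) auto
  ultimately show ?thesis using R by (simp add: right_diff_distrib)
qed

end

context stokes_flow
begin

text \<open>The deterministic statement. The norms of the initial value at the lower levels are controlled by
  the one at level \<open>\<gamma>\<close>, because the eigenvalues are bounded away from 0.\<close>

theorem galerkin_uniform_bound:
  fixes T \<gamma> \<sigma> Z R :: real
  assumes T: "0 < T" and \<gamma>: "1/4 \<le> \<gamma>" "\<gamma> < 1/2" and \<sigma>: "0 < \<sigma>" "\<sigma> \<le> 1/8"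
    and z: "\<And>t. t \<in> {0..T} \<Longrightarrow> z t \<in> Dom (1/4)" "\<And>t. t \<in> {0..T} \<Longrightarrow> N (z t) \<le> Z"
      "\<And>t. t \<in> {0..T} \<Longrightarrow> z t \<in> Dom (1/4 + \<sigma>)"
      "\<And>t. t \<in> {0..T} \<Longrightarrow> norm (Apow (1/4 + \<sigma>) (z t)) \<le> Z"
  shows "\<exists>K. \<forall>x\<in>Dom \<gamma>. norm (Apow \<gamma> x) \<le> R \<longrightarrow>
    (\<forall>n v. galerkin_solution A e b T z x n v \<longrightarrow> (\<forall>t\<in>{0..T}. norm (Apow \<gamma> (v t)) \<le> K))"
proof -
  define R0 where "R0 = (lam 0 powr (0 - \<gamma>) * R)\<^sup>2 + (lam 0 powr (\<sigma> - \<gamma>) * R)\<^sup>2"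
  define M where "M = spacetime_const \<sigma> Z R0 T"
  define Y where "Y = quarter_const \<sigma> Z (lam 0 powr (1/4 - \<gamma>) * R) M T"
  have Z0: "0 \<le> Z" by (rule order.trans[OF norm_ge_zero z(2)[of 0]]) (use T in simp)
  show ?thesis
  proof (intro exI ballI allI impI)
    fix x n v t
    assume x: "x \<in> Dom \<gamma>" "norm (Apow \<gamma> x) \<le> R" and sol: "galerkin_solution A e b T z x n v" and t: "t \<in> {0..T}"
    interpret galerkin_setting D DA A e lam b T z x n v
      by unfold_locales (use sol z(1) in auto)
    have v0: "v 0 = proj_n e n x" using sol by (simp add: galerkin_solution_def)
    have i\<gamma>: "norm (Apow \<gamma> (v 0)) \<le> R"
      unfolding v0 using norm_Apow_proj_n_le[OF _ x(1), of n] x(2) \<gamma> by simp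
    have i: "norm (Apow s (v 0)) \<le> lam 0 powr (s - \<gamma>) * R" if "0 \<le> s" "s \<le> \<gamma>" for s
    proof -
      have "norm (Apow s (v 0)) \<le> lam 0 powr (s - \<gamma>) * norm (Apow \<gamma> (v 0))"
        using Dom_mono(2)[OF that v_Dom] \<gamma> T by simp
      also have "\<dots> \<le> lam 0 powr (s - \<gamma>) * R" using i\<gamma> by (intro mult_left_mono) auto
      finally show ?thesis .
    qed
    have "En 0 (v 0) \<le> (lam 0 powr (0 - \<gamma>) * R)\<^sup>2" "En \<sigma> (v 0) \<le> (lam 0 powr (\<sigma> - \<gamma>) * R)\<^sup>2"
      using i[of 0] i[of \<sigma>] \<gamma> \<sigma> by (intro power_mono; simp)+
    then have init: "En 0 (v 0) \<le> R0" "En \<sigma> (v 0) \<le> R0" by (auto simp: R0_def intro: order.trans)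
    have \<sigma>': "\<sigma> < 1/4" using \<sigma> by simp
    note st = spacetime_bound[OF T \<sigma>(1) \<sigma>' z(2,3,4) init, folded M_def]
    obtain \<Theta> \<Theta>' where \<Theta>: "continuous_on {0..T} \<Theta>" "\<forall>s\<in>{0..T}. 0 \<le> \<Theta> s \<and> \<Theta> s \<le> M"
      "\<forall>s. 0 < s \<and> s < T \<longrightarrow> (\<Theta> has_real_derivative \<Theta>' s) (at s) \<and> En (\<sigma> + 1/2) (v s) \<le> M - \<Theta>' s"
      using st(2) by blast
    have Y: "N (v s) \<le> Y" if "s \<in> {0..T}" for s
      unfolding Y_def
      by (rule quarter_bound[OF T \<sigma> Z0 z(2) i st(1) \<Theta>(1), of \<Theta>']) (use \<gamma> \<Theta> that in auto)
    show "norm (Apow \<gamma> (v t)) \<le> R + b_const * (Y + Z)\<^sup>2 * (T powr (1/2 - \<gamma>) / (1/2 - \<gamma>))"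
      by (rule power_bound[OF _ \<gamma>(2) Y z(2) i\<gamma> t]) (use \<gamma> in auto)
  qed
qed

end

section \<open>The random constant\<close>

text \<open>For a regular trajectory the constant is 1 plus the supremum of all the norms that have to be
  bounded when the datum ranges over a ball; this is monotone in the radius by construction, and finite by
  \<open>galerkin_uniform_bound\<close>. On the exceptional null set it is 1. Inserting 0 makes the supremum nonnegative.\<close>

theorem lemma3p5:
  fixes D :: "(real^2) set"
    and DA :: "L2field set" and A :: "L2field \<Rightarrow> L2field"
    and e :: "nat \<Rightarrow> L2field" and lam :: "nat \<Rightarrow> real"
    and b :: "L2field \<Rightarrow> L2field \<Rightarrow> L2field \<Rightarrow> real"
    and M :: "'w measure" and F :: "real \<Rightarrow> 'w measure"
    and w :: "nat \<Rightarrow> real \<Rightarrow> 'w \<Rightarrow> real"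
    and G :: "L2field \<Rightarrow> L2field" and Z :: "real \<Rightarrow> 'w \<Rightarrow> L2field"
    and \<epsilon> :: real and T \<gamma> :: real
  assumes domain: "D \<noteq> {}" "open D" "connected D" "bounded D" "lipschitz_boundary D"
    and stokes: "stokes_setting D DA A e lam"
    and b: "bounded_extension D e lam b"
    and stoch: "filtered_complete_space M F"
      "\<And>k. adapted_brownian_motion M F (w k)" "independent_processes M w"
    and eps: "0 < \<epsilon>" "\<epsilon> \<le> 1/4"
    and G: "bounded_linear_on_H D G" "inj_on G (space_H D)"
      "space_V D \<subseteq> G ` space_H D" "G ` space_H D \<subseteq> dom_pow D e lam (1/4 + \<epsilon>)"
    and OU: "OU_process D DA A e G M F w Z"
    and OU_regular: "AE \<omega> in M. \<forall>\<gamma>'\<in>{0..<1/4 + \<epsilon>}. \<forall>S>0.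
      (\<forall>t\<in>{0..S}. Z t \<omega> \<in> dom_pow D e lam \<gamma>') \<and>
      continuous_on {0..S} (\<lambda>t. A_pow D e lam \<gamma>' (Z t \<omega>))"
    and T: "T > 0" and \<gamma>: "\<gamma> \<in> {1/4..<1/4 + \<epsilon>}"
  shows "\<exists>c2 :: 'w \<Rightarrow> real \<Rightarrow> real.
    (\<forall>\<omega>. \<forall>r\<ge>0. c2 \<omega> r > 0) \<and> (\<forall>\<omega>. mono_on {0..} (c2 \<omega>)) \<and>
    (AE \<omega> in M. \<forall>x \<in> dom_pow D e lam \<gamma>. \<forall>v :: nat \<Rightarrow> real \<Rightarrow> L2field.
       (\<forall>n. galerkin_solution A e b T (\<lambda>t. Z t \<omega>) x n (v n)) \<longrightarrow>
       (\<forall>n. \<forall>t\<in>{0..T}. norm (A_pow D e lam \<gamma> (v n t)) \<le> c2 \<omega> (norm (A_pow D e lam \<gamma> x))))"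
proof -
  interpret stokes_flow D DA A e lam b
    by unfold_locales (rule domain(2), rule stokes, rule b)
  \<comment> \<open>Any \<open>\<sigma>\<close> below \<open>\<epsilon>\<close> keeps the trajectory in \<open>D(A^{1/4+\<sigma>})\<close>; the half also ensures \<open>\<sigma> \<le> 1/8\<close>.\<close>
  define \<sigma> where "\<sigma> = \<epsilon> / 2"
  have \<sigma>: "0 < \<sigma>" "\<sigma> \<le> 1/8" using eps by (auto simp: \<sigma>_def)
  have \<gamma>': "1/4 \<le> \<gamma>" "\<gamma> < 1/2" using \<gamma> eps by auto
  define regular where "regular \<omega> \<longleftrightarrow> (\<forall>\<gamma>'\<in>{0..<1/4 + \<epsilon>}. \<forall>S>0.
      (\<forall>t\<in>{0..S}. Z t \<omega> \<in> dom_pow D e lam \<gamma>') \<and>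
      continuous_on {0..S} (\<lambda>t. A_pow D e lam \<gamma>' (Z t \<omega>)))" for \<omega>
  define vals where "vals \<omega> r = insert 0 {norm (Apow \<gamma> (v t)) | x n v t. x \<in> Dom \<gamma> \<and> norm (Apow \<gamma> x) \<le> r \<and>
      galerkin_solution A e b T (\<lambda>t. Z t \<omega>) x n v \<and> t \<in> {0..T}}" for \<omega> r
  define c2 where "c2 \<omega> r = (if regular \<omega> then 1 + Sup (vals \<omega> r) else 1)" for \<omega> r
  have bdd: "bdd_above (vals \<omega> r)" if reg: "regular \<omega>" for \<omega> r
  proof -
    have bound: "\<exists>B. \<forall>t\<in>{0..T}. norm (Apow s (Z t \<omega>)) \<le> B" if "s \<in> {0..<1/4 + \<epsilon>}" for s
    proof -
      have "continuous_on {0..T} (\<lambda>t. Apow s (Z t \<omega>))" using reg that T by (auto simp: regular_def)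
      then have "bounded ((\<lambda>t. Apow s (Z t \<omega>)) ` {0..T})"
        by (intro compact_imp_bounded compact_continuous_image) auto
      then show ?thesis by (auto simp: bounded_iff)
    qed
    obtain B1 where B1: "\<forall>t\<in>{0..T}. N (Z t \<omega>) \<le> B1" using bound[of "1/4"] eps by auto
    obtain B2 where B2: "\<forall>t\<in>{0..T}. norm (Apow (1/4 + \<sigma>) (Z t \<omega>)) \<le> B2"
      using bound[of "1/4 + \<sigma>"] eps by (auto simp: \<sigma>_def)
    have dom: "Z t \<omega> \<in> Dom (1/4)" "Z t \<omega> \<in> Dom (1/4 + \<sigma>)" if "t \<in> {0..T}" for t
      using reg that T eps by (auto simp: regular_def \<sigma>_def)
    have "\<exists>K. \<forall>x\<in>Dom \<gamma>. norm (Apow \<gamma> x) \<le> r \<longrightarrow>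
      (\<forall>n v. galerkin_solution A e b T (\<lambda>t. Z t \<omega>) x n v \<longrightarrow> (\<forall>t\<in>{0..T}. norm (Apow \<gamma> (v t)) \<le> K))"
      by (rule galerkin_uniform_bound[OF T \<gamma>' \<sigma>, where Z = "max B1 B2"])
         (use B1 B2 dom in \<open>auto simp: le_max_iff_disj\<close>)
    then obtain K where K: "\<And>x n v t. x \<in> Dom \<gamma> \<Longrightarrow> norm (Apow \<gamma> x) \<le> r \<Longrightarrow>
        galerkin_solution A e b T (\<lambda>t. Z t \<omega>) x n v \<Longrightarrow> t \<in> {0..T} \<Longrightarrow> norm (Apow \<gamma> (v t)) \<le> K" by blast
    show ?thesis
      by (rule bdd_aboveI[of _ "max 0 K"]) (auto simp: vals_def le_max_iff_disj intro: K)
  qed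
  show ?thesis
  proof (rule exI[of _ c2], intro conjI allI impI)
    fix \<omega> and r :: real
    have "0 \<le> Sup (vals \<omega> r)" if "regular \<omega>"
      by (rule cSup_upper[OF _ bdd[OF that]]) (simp add: vals_def)
    then show "0 < c2 \<omega> r" by (auto simp: c2_def intro: add_pos_nonneg)
  next
    fix \<omega>
    show "mono_on {0..} (c2 \<omega>)"
    proof (rule mono_onI)
      fix r s :: real assume "r \<le> s"
      then have "vals \<omega> r \<subseteq> vals \<omega> s" unfolding vals_def by fastforce
      then have "Sup (vals \<omega> r) \<le> Sup (vals \<omega> s)" if "regular \<omega>"
        by (intro cSup_subset_mono bdd[OF that]) (auto simp: vals_def)
      then show "c2 \<omega> r \<le> c2 \<omega> s" by (simp add: c2_def)
    qed
  next
    show "AE \<omega> in M. \<forall>x \<in> dom_pow D e lam \<gamma>. \<forall>v :: nat \<Rightarrow> real \<Rightarrow> L2field.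
       (\<forall>n. galerkin_solution A e b T (\<lambda>t. Z t \<omega>) x n (v n)) \<longrightarrow>
       (\<forall>n. \<forall>t\<in>{0..T}. norm (A_pow D e lam \<gamma> (v n t)) \<le> c2 \<omega> (norm (A_pow D e lam \<gamma> x)))"
      using OU_regular
    proof eventually_elim
      case (elim \<omega>)
      then have reg: "regular \<omega>" by (simp only: regular_def)
      show ?case
      proof (intro ballI allI impI)
        fix x v n t
        assume a: "x \<in> Dom \<gamma>" "\<forall>n. galerkin_solution A e b T (\<lambda>t. Z t \<omega>) x n (v n)" "t \<in> {0..T}"
        then have "norm (Apow \<gamma> (v n t)) \<in> vals \<omega> (norm (Apow \<gamma> x))"
          unfolding vals_def by blast
        from cSup_upper[OF this bdd[OF reg]]
        show "norm (Apow \<gamma> (v n t)) \<le> c2 \<omega> (norm (Apow \<gamma> x))" using reg by (simp add: c2_def)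
      qed
    qed
  qed
qed

end
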